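(* Let $V_1,V_2$ be complex Banach spaces and, for $j=1,2$, let $C_j\subset V_j$ be a complex cone for which there is a closed convex cone $R_j\subset V_j$ such that: (C1) $C_j=\mathbb{C}^*R_j$ and $\overline{(R_j+iR_j)}\cap\overline{(R_j-iR_j)}=R_j$; (C2) $C_j$ is proper and contains at least two (complex) linearly independent vectors. Let $T:V_1\to V_2$ be a (complex) linear map, and suppose that $T(C_1\setminus\{0\})\subset C_2\setminus\{0\}$. If the diameter $\tilde{\Delta}=\sup_{x,y\in C_1\setminus\{0\}}\tilde{d}_{C_2}(Tx,Ty)$ is finite, then $$ \forall x,y\in C_1\setminus\{0\},\quad \tilde{d}_{C_2}(Tx,Ty)\leq\tanh\left(\frac{\pi\exp(\tilde{\Delta})}{2\sqrt{2}}\right)\tilde{d}_{C_1}(x,y). $$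
   Context: $\mathbb{C}^*=\mathbb{C}\setminus\{0\}$ and $\hat{\mathbb{C}}$ is the Riemann sphere. Let $V$ be a complex Banach space. A complex cone is a non-empty subset $C\subset V$ with $\mathbb{C}^*C\subset C$; it is proper if its closure contains no complex vector subspace of complex dimension 2. A closed convex cone $R\subset V$ is a closed non-empty subset with $R+R\subset R$ and $(0,\infty)R\subset R$. (Condition (C1) implies that the complex cone is closed.) For a complex cone $C$ satisfying (C1)-(C2) and $x,y\in C\setminus\{0\}$, let $L(x,y)=\{z\in\hat{\mathbb{C}}: zx-y\in C\}$, with the convention $\infty\in L(x,y)$, and let $\mathring{L}(x,y)$ be its interior in $\hat{\mathbb{C}}$ (it is simply connected when non-empty). The gauge $d_C$ (Rugh) is defined for $x,y\in C\setminus\{0\}$ by: $d_C(x,y)=0$ if $x,y$ are colinear; if $x,y$ are linearly independent and $0,\infty\in\mathring{L}(x,y)$, then $d_C(x,y)$ is the Poincaré distance between $0$ and $\infty$ in the hyperbolic Riemann surface $\mathring{L}(x,y)$, normalized to have Gaussian curvature $-1$ (on the unit disk the metric is $2|dz|/(1-|z|^2)$); $d_C(x,y)=\infty$ otherwise. $\tilde{d}_C(x,y)=\inf\big\{\sum_{k=0}^{n-1} d_C(x_k,x_{k+1}):\ n\ge 1,\ x_0=x,\ x_1,\dots,x_n=y\in C\setminus\{0\}\big\}$. *)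

theory Defs
  imports "HOL-Complex_Analysis.Complex_Analysis"
begin

section \<open>Complex Banach spaces\<close>

text \<open>
  A complex Banach space is a real Banach space carrying a complex scalar multiplication that
  extends the real one and for which the norm is homogeneous.
\<close>

class complex_banach = banach +
  fixes scaleC :: "complex \<Rightarrow> 'a \<Rightarrow> 'a"  (infixr \<open>*\<^sub>C\<close> 75)
  assumes scaleC_add_right: "a *\<^sub>C (x + y) = a *\<^sub>C x + a *\<^sub>C y"
    and scaleC_add_left: "(a + b) *\<^sub>C x = a *\<^sub>C x + b *\<^sub>C x"
    and scaleC_scaleC: "a *\<^sub>C (b *\<^sub>C x) = (a * b) *\<^sub>C x"
    and scaleC_one: "1 *\<^sub>C x = x"
    and scaleC_of_real: "complex_of_real r *\<^sub>C x = r *\<^sub>R x"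
    and norm_scaleC: "norm (a *\<^sub>C x) = cmod a * norm x"

lemma vector_space_scaleC: "vector_space (scaleC :: complex \<Rightarrow> 'a \<Rightarrow> 'a::complex_banach)"
  by unfold_locales (simp_all add: scaleC_add_right scaleC_add_left scaleC_scaleC scaleC_one)

instantiation complex :: complex_banach
begin

definition scaleC_complex :: "complex \<Rightarrow> complex \<Rightarrow> complex"
  where "scaleC_complex a x = a * x"

instance
  by standard (simp_all add: scaleC_complex_def algebra_simps norm_mult scaleR_conv_of_real)

end

definition clin_indep :: "'a::complex_banach \<Rightarrow> 'a \<Rightarrow> bool"
  where "clin_indep x y \<longleftrightarrow> x \<noteq> y \<and> \<not> module.dependent scaleC {x, y}"


section \<open>Cones\<close>

definition complex_cone :: "'a::complex_banach set \<Rightarrow> bool"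
  where "complex_cone C \<longleftrightarrow> C \<noteq> {} \<and> (\<forall>c x. c \<noteq> 0 \<longrightarrow> x \<in> C \<longrightarrow> c *\<^sub>C x \<in> C)"

definition proper_cone :: "'a::complex_banach set \<Rightarrow> bool"
  where "proper_cone C \<longleftrightarrow>
    \<not> (\<exists>W. module.subspace scaleC W \<and> vector_space.dim scaleC W = 2 \<and> W \<subseteq> closure C)"

definition closed_convex_cone :: "'a::complex_banach set \<Rightarrow> bool"
  where "closed_convex_cone R \<longleftrightarrow>
    closed R \<and> R \<noteq> {} \<and> (\<forall>x\<in>R. \<forall>y\<in>R. x + y \<in> R) \<and> (\<forall>t>0. \<forall>x\<in>R. t *\<^sub>R x \<in> R)"

definition cond_C1 :: "'a::complex_banach set \<Rightarrow> 'a set \<Rightarrow> bool"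
  where "cond_C1 C R \<longleftrightarrow>
    C = {c *\<^sub>C r |c r. c \<noteq> 0 \<and> r \<in> R} \<and>
    closure {r + \<i> *\<^sub>C s |r s. r \<in> R \<and> s \<in> R} \<inter> closure {r - \<i> *\<^sub>C s |r s. r \<in> R \<and> s \<in> R} = R"

definition cond_C2 :: "'a::complex_banach set \<Rightarrow> bool"
  where "cond_C2 C \<longleftrightarrow> proper_cone C \<and> (\<exists>x\<in>C. \<exists>y\<in>C. clin_indep x y)"


section \<open>The Poincare distance on domains of the Riemann sphere\<close>

text \<open>
  The Riemann sphere is the one-point compactification of the complex plane; its points are
  \<open>Some z\<close> and the point at infinity \<open>None\<close>.
\<close>

abbreviation riemann_sphere :: "complex option topology"
  where "riemann_sphere \<equiv> Alexandroff_compactification euclidean"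

definition sphere_inverse :: "complex \<Rightarrow> complex option"
  where "sphere_inverse w = (if w = 0 then None else Some (1 / w))"

text \<open>
  Holomorphy is expressed in the two standard charts, whose inverses are \<open>Some\<close> and
  \<open>sphere_inverse\<close>.
\<close>

definition sphere_holomorphic_on :: "(complex \<Rightarrow> complex option) \<Rightarrow> complex set \<Rightarrow> bool"
  where "sphere_holomorphic_on f S \<longleftrightarrow>
    (\<forall>z\<in>S. \<exists>U g. open U \<and> z \<in> U \<and> U \<subseteq> S \<and> g holomorphic_on U \<and>
       ((\<forall>w\<in>U. f w = Some (g w)) \<or> (\<forall>w\<in>U. f w = sphere_inverse (g w))))"

text \<open>
  The geodesic distance of the metric \<open>2 |dz| / (1 - |z|^2)\<close> on the unit disk:
  \<open>2 artanh |(b - a) / (1 - cnj a * b)|\<close>.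
\<close>

definition disk_dist :: "complex \<Rightarrow> complex \<Rightarrow> real"
  where "disk_dist a b = 2 * artanh (cmod (Moebius_function 0 a b))"

text \<open>
  On a simply connected hyperbolic domain \<open>D\<close> of the sphere the Poincare metric is transported
  from the unit disk by a conformal isomorphism. The distance of two points does not depend on
  this isomorphism, as the automorphisms of the disk are isometries, so the infimum below is over a
  single value (and it is infinite if the disk is not isomorphic to \<open>D\<close>).
\<close>

definition poincare_dist :: "complex option set \<Rightarrow> complex option \<Rightarrow> complex option \<Rightarrow> ennreal"
  where "poincare_dist D p q =
    Inf {ennreal (disk_dist a b) |f a b.
           sphere_holomorphic_on f (ball 0 1) \<and> bij_betw f (ball 0 1) D \<and>
           a \<in> ball 0 1 \<and> b \<in> ball 0 1 \<and> f a = p \<and> f b = q}"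


section \<open>The gauge and the associated projective metric\<close>

definition cone_L :: "'a::complex_banach set \<Rightarrow> 'a \<Rightarrow> 'a \<Rightarrow> complex option set"
  where "cone_L C x y = insert None (Some ` {z. z *\<^sub>C x - y \<in> C})"

definition cone_L_interior :: "'a::complex_banach set \<Rightarrow> 'a \<Rightarrow> 'a \<Rightarrow> complex option set"
  where "cone_L_interior C x y = riemann_sphere interior_of (cone_L C x y)"

definition gauge_dist :: "'a::complex_banach set \<Rightarrow> 'a \<Rightarrow> 'a \<Rightarrow> ennreal"
  where "gauge_dist C x y =
    (if \<not> clin_indep x y then 0
     else if Some 0 \<in> cone_L_interior C x y \<and> None \<in> cone_L_interior C x y
       then poincare_dist (cone_L_interior C x y) (Some 0) None
     else \<infinity>)"

definition chain_dist :: "'a::complex_banach set \<Rightarrow> 'a \<Rightarrow> 'a \<Rightarrow> ennreal"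
  where "chain_dist C x y =
    Inf {(\<Sum>k<n. gauge_dist C (X k) (X (Suc k))) |n X.
           1 \<le> n \<and> X 0 = x \<and> X n = y \<and> (\<forall>k\<le>n. X k \<in> C - {0})}"

end

theory Submission
  imports Defs
begin

text \<open>
  The theorem is a Schwarz-Pick estimate with a gain. Write \<open>L\<^sub>1\<close> for the domain of a pair
  \<open>x, y\<close> in \<open>C\<^sub>1\<close> and \<open>L\<^sub>2\<close> for the domain of \<open>T x, T y\<close>. As \<open>z x - y \<in> C\<^sub>1\<close> implies
  \<open>z (T x) - T y \<in> C\<^sub>2\<close>, the first lies in the second. The inclusion of one simply connected
  hyperbolic domain in another does not increase Poincare distances, and it multiplies them by at
  most \<open>tanh (\<delta> / 4)\<close> when the smaller domain has diameter at most \<open>\<delta>\<close> in the larger one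
  (\<open>disk_contraction\<close>). Two points of \<open>L\<^sub>1\<close> stand for two vectors of \<open>C\<^sub>1\<close>, and the
  chain distance of their images is at most \<open>\<Delta>\<close>. So it remains to bound the
  Poincare distance in \<open>L\<^sub>2\<close> by \<open>\<delta> = sqrt 2 * pi * exp \<Delta>\<close>, given that the chain distance is
  at most \<open>\<Delta>\<close>.

  Let \<open>m\<close> and \<open>l\<close> range over the complex linear functionals that map \<open>R\<^sub>2\<close> to the closed first
  quadrant. By the Hahn-Banach theorem, the second half of (C1) says that \<open>R\<^sub>2\<close> consists of all
  vectors that these functionals map to that quadrant. Hence \<open>v \<in> C\<^sub>2\<close> iff
  \<open>Re (m v * cnj (l v)) \<ge> 0\<close> for all \<open>m\<close> and \<open>l\<close> (\<open>in_C_iff_form\<close>): the complement of the domain of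
  a pair is the closure of a union of disks, one for each pair of functionals, and \<open>m / l\<close> maps the outside of
  its disk to the right half-plane.

  This gives a lower bound for the chain distance. By Schwarz-Pick for \<open>m / l\<close>, the gauge distance
  of two vectors is at least the half-plane distance of their values under \<open>m / l\<close>. For fixed \<open>m\<close>
  and \<open>l\<close> the latter satisfies the triangle inequality, so it also bounds the chain
  distance from below (\<open>cross_bound\<close>).

  It also gives an upper bound for the Poincare distance. If all these half-plane distances are at
  most \<open>2 * ln G\<close>, then none of the disks meets a certain lens that contains the two points, after
  a suitable rotation and scaling. The lens is a Moebius image of a wedge, so the distance of the two
  points in it is explicit, and it is at most \<open>sqrt 2 * pi * G\<^sup>2\<close> (\<open>slice_distance_bound\<close>). Let
  \<open>G\<close> tend to \<open>exp (\<Delta> / 2)\<close>.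

  Finally, the Poincare distance refers to a Riemann map, so the domains have to be
  simply connected. They are connected because two points in them are joined by the image of a
  segment in \<open>R\<^sub>2\<close>, and their complements are connected because each disk contains a zero of
  \<open>m + l\<close> and those zeros form a connected set (\<open>slice_Riemann_map\<close>).
\<close>


section \<open>The hyperbolic metric of the disk\<close>

lemma cmod_Moebius_identity:
  "(cmod (1 - cnj a * b))\<^sup>2 = (cmod (b - a))\<^sup>2 + (1 - (cmod a)\<^sup>2) * (1 - (cmod b)\<^sup>2)"
  unfolding cmod_power2 by (simp add: power2_eq_square algebra_simps)

lemma Moebius_denominator_nonzero:
  assumes "cmod a < 1" "cmod b < 1"
  shows "1 - cnj a * b \<noteq> 0"
proof
  assume "1 - cnj a * b = 0"
  then have "cmod (cnj a * b) = 1" by (metis norm_one right_minus_eq)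
  moreover have "cmod (cnj a * b) < 1 * 1"
    unfolding norm_mult using assms by (intro mult_strict_mono') auto
  ultimately show False by simp
qed

lemma Moebius_complement:
  assumes "cmod a < 1" "cmod b < 1"
  shows "1 - (cmod (Moebius_function 0 a b))\<^sup>2
    = (1 - (cmod a)\<^sup>2) * (1 - (cmod b)\<^sup>2) / (cmod (1 - cnj a * b))\<^sup>2"
  using Moebius_denominator_nonzero[OF assms] cmod_Moebius_identity[of a b]
  by (simp add: Moebius_function_simple norm_divide power_divide field_simps)

lemma artanh_mono_real:
  fixes x y :: real
  assumes "0 \<le> x" "x \<le> y" "y < 1"
  shows "artanh x \<le> artanh y"
proof -
  have "(1 + x) / (1 - x) \<le> (1 + y) / (1 - y)"
    using assms by (intro frac_le) auto
  then show ?thesis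
    using assms by (simp add: artanh_def)
qed

lemma tanh_artanh_real:
  fixes x :: real
  assumes "\<bar>x\<bar> < 1"
  shows "tanh (artanh x) = x"
proof -
  have x: "-1 < x" "x < 1" using assms by auto
  have "exp (2 * artanh x) = (1 + x) / (1 - x)"
    using x by (simp add: artanh_def)
  then have "tanh (artanh x) = (1 - (1 - x) / (1 + x)) / (1 + (1 - x) / (1 + x))"
    by (simp add: tanh_real_altdef exp_minus)
  also have "\<dots> = x" using x by (simp add: field_simps)
  finally show ?thesis .
qed

lemma artanh_nonneg_real: "0 \<le> x \<Longrightarrow> x < 1 \<Longrightarrow> 0 \<le> artanh (x::real)"
  using artanh_mono_real[of 0 x] by simp

lemma disk_dist_nonneg:
  "cmod a < 1 \<Longrightarrow> cmod b < 1 \<Longrightarrow> 0 \<le> disk_dist a b"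
  unfolding disk_dist_def by (intro mult_nonneg_nonneg artanh_nonneg_real Moebius_function_norm_lt_1) auto

lemma cmod_Moebius_eq_tanh:
  assumes "cmod a < 1" "cmod b < 1"
  shows "cmod (Moebius_function 0 a b) = tanh (disk_dist a b / 2)"
  using Moebius_function_norm_lt_1[OF assms, of 0] by (simp add: disk_dist_def tanh_artanh_real)

lemma disk_dist_self: "disk_dist a a = 0"
  by (simp add: disk_dist_def Moebius_function_eq_zero)

lemma disk_dist_mono:
  assumes "cmod a < 1" "cmod b < 1" "cmod c < 1" "cmod d < 1"
    and "cmod (Moebius_function 0 a b) \<le> cmod (Moebius_function 0 c d)"
  shows "disk_dist a b \<le> disk_dist c d"
  unfolding disk_dist_def using assms Moebius_function_norm_lt_1[of c d 0]
  by (auto intro!: artanh_mono_real)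

lemma holomorphic_on_comp:
  assumes "f holomorphic_on S" "g holomorphic_on T" "\<And>x. x \<in> S \<Longrightarrow> f x \<in> T"
  shows "(\<lambda>x. g (f x)) holomorphic_on S"
  using holomorphic_on_compose_gen[of f S g T] assms by (auto simp: o_def image_subset_iff)

text \<open>
  Moving one point and its image to the centre reduces this to the Schwarz lemma.
\<close>

lemma Schwarz_Pick:
  assumes h: "h holomorphic_on ball 0 1" "h ` ball 0 1 \<subseteq> ball 0 1"
    and a: "cmod a < 1" and b: "cmod b < 1"
  shows "disk_dist (h a) (h b) \<le> disk_dist a b"
proof -
  define g where "g = (\<lambda>z. Moebius_function 0 (h a) (h (Moebius_function 0 (-a) z)))"
  have hin: "cmod (h z) < 1" if "cmod z < 1" for z using h(2) that by (force simp: image_subset_iff)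
  have Min: "cmod (Moebius_function 0 (-a) z) < 1" if "cmod z < 1" for z
    using Moebius_function_norm_lt_1[of "-a" z 0] a that by simp
  have hol: "(\<lambda>z. h (Moebius_function 0 (-a) z)) holomorphic_on ball 0 1"
    using a Min by (intro holomorphic_on_comp[OF Moebius_function_holomorphic h(1)]) auto
  have "g holomorphic_on ball 0 1"
    unfolding g_def
    using Min hin by (intro holomorphic_on_comp[OF hol Moebius_function_holomorphic[OF hin[OF a]]]) auto
  moreover have "g 0 = 0" by (simp add: g_def Moebius_function_of_zero Moebius_function_eq_zero)
  moreover have "cmod (g z) < 1" if "cmod z < 1" for z
    unfolding g_def by (rule Moebius_function_norm_lt_1[OF hin[OF a] hin[OF Min[OF that]]])
  moreover have "cmod (Moebius_function 0 a b) < 1" by (rule Moebius_function_norm_lt_1[OF a b])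
  ultimately have "cmod (g (Moebius_function 0 a b)) \<le> cmod (Moebius_function 0 a b)"
    by (rule Schwarz_Lemma(1))
  moreover have "Moebius_function 0 (-a) (Moebius_function 0 a b) = b"
    using a b by (intro Moebius_function_compose) auto
  ultimately have "cmod (Moebius_function 0 (h a) (h b)) \<le> cmod (Moebius_function 0 a b)"
    by (simp add: g_def)
  then show ?thesis using a b hin by (intro disk_dist_mono) auto
qed

lemma Moebius_isometry:
  assumes c: "cmod c < 1" and a: "cmod a < 1" and b: "cmod b < 1"
  shows "disk_dist (Moebius_function 0 c a) (Moebius_function 0 c b) = disk_dist a b"
proof (rule antisym)
  have sub: "Moebius_function 0 d ` ball 0 1 \<subseteq> ball 0 1" if "cmod d < 1" for d
    using Moebius_function_norm_lt_1[OF that] by auto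
  show "disk_dist (Moebius_function 0 c a) (Moebius_function 0 c b) \<le> disk_dist a b"
    using c a b by (intro Schwarz_Pick Moebius_function_holomorphic sub)
  have "disk_dist (Moebius_function 0 (-c) (Moebius_function 0 c a)) (Moebius_function 0 (-c) (Moebius_function 0 c b))
     \<le> disk_dist (Moebius_function 0 c a) (Moebius_function 0 c b)"
    using c a b by (intro Schwarz_Pick Moebius_function_holomorphic sub Moebius_function_norm_lt_1) auto
  moreover have "Moebius_function 0 (-c) (Moebius_function 0 c z) = z" if "cmod z < 1" for z
    using c that by (intro Moebius_function_compose) auto
  ultimately show "disk_dist a b \<le> disk_dist (Moebius_function 0 c a) (Moebius_function 0 c b)"
    using a b by simp
qed

lemma disk_dist_commute: "disk_dist a b = disk_dist b a"
proof -
  have "cmod (1 - cnj a * b) = cmod (1 - cnj b * a)"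
    by (metis (no_types) complex_cnj_cnj complex_cnj_diff complex_cnj_mult complex_cnj_one complex_mod_cnj mult.commute)
  then show ?thesis by (simp add: disk_dist_def Moebius_function_simple norm_divide norm_minus_commute)
qed

text \<open>
  With the middle point at the centre, this is the addition theorem of the hyperbolic tangent.
\<close>

lemma disk_dist_triangle:
  assumes a: "cmod a < 1" and b: "cmod b < 1" and c: "cmod c < 1"
  shows "disk_dist a b \<le> disk_dist a c + disk_dist c b"
proof -
  define p where "p = Moebius_function 0 c a"
  define q where "q = Moebius_function 0 c b"
  have p: "cmod p < 1" and q: "cmod q < 1"
    unfolding p_def q_def using assms by (auto intro: Moebius_function_norm_lt_1)
  have e1: "disk_dist a b = disk_dist p q" unfolding p_def q_def using assms by (simp add: Moebius_isometry)
  have "disk_dist a c = disk_dist p 0"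
    using Moebius_isometry[OF c a c] by (simp add: p_def Moebius_function_eq_zero)
  then have e2: "disk_dist a c = 2 * artanh (cmod p)"
    by (simp add: disk_dist_def Moebius_function_of_zero)
  have "disk_dist c b = disk_dist 0 q"
    using Moebius_isometry[OF c c b] by (simp add: q_def Moebius_function_eq_zero)
  then have e3: "disk_dist c b = 2 * artanh (cmod q)"
    by (simp add: disk_dist_def Moebius_function_simple)
  define s where "s = (cmod p + cmod q) / (1 + cmod p * cmod q)"
  have pq: "cmod p * cmod q < 1" using mult_strict_mono'[of "cmod p" 1 "cmod q" 1] p q by simp
  have pos: "0 < 1 + cmod p * cmod q" by (simp add: add_pos_nonneg)
  have "0 < (1 - cmod p) * (1 - cmod q)" using p q by simp
  then have s1: "s < 1" unfolding s_def using pos by (simp add: divide_less_eq algebra_simps)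
  have s0: "0 \<le> s" unfolding s_def using pos by simp
  have d0: "1 - cnj p * q \<noteq> 0" by (rule Moebius_denominator_nonzero[OF p q])
  have dle: "cmod (1 - cnj p * q) \<le> 1 + cmod p * cmod q"
    using norm_triangle_ineq4[of 1 "cnj p * q"] by (simp add: norm_mult)
  have pp: "(cmod p)\<^sup>2 < 1" "(cmod q)\<^sup>2 < 1" using p q by (simp_all add: power_less_one_iff)
  have "1 - s\<^sup>2 = (1 - (cmod p)\<^sup>2) * (1 - (cmod q)\<^sup>2) / (1 + cmod p * cmod q)\<^sup>2"
    unfolding s_def power_divide using pos by (simp add: field_simps) (simp add: power2_eq_square algebra_simps)
  also have "\<dots> \<le> (1 - (cmod p)\<^sup>2) * (1 - (cmod q)\<^sup>2) / (cmod (1 - cnj p * q))\<^sup>2"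
    using pp d0 dle by (intro divide_left_mono power_mono mult_nonneg_nonneg mult_pos_pos) (auto simp: pos)
  also have "\<dots> = 1 - (cmod (Moebius_function 0 p q))\<^sup>2"
    by (rule Moebius_complement[OF p q, symmetric])
  finally have "(cmod (Moebius_function 0 p q))\<^sup>2 \<le> s\<^sup>2" by linarith
  then have "cmod (Moebius_function 0 p q) \<le> s"
    using s0 by (rule power2_le_imp_le)
  then have "artanh (cmod (Moebius_function 0 p q)) \<le> artanh s"
    using s1 by (intro artanh_mono_real) auto
  also have "artanh s = artanh (cmod p) + artanh (cmod q)"
  proof -
    have "(1 + s) / (1 - s) = ((1 + cmod p) / (1 - cmod p)) * ((1 + cmod q) / (1 - cmod q))"
    proof -
      have "1 + s = (1 + cmod p) * (1 + cmod q) / (1 + cmod p * cmod q)"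
        "1 - s = (1 - cmod p) * (1 - cmod q) / (1 + cmod p * cmod q)"
        unfolding s_def using pos by (simp_all add: field_simps)
      then show ?thesis using pos by simp
    qed
    moreover have "0 < (1 + cmod p) / (1 - cmod p)" "0 < (1 + cmod q) / (1 - cmod q)"
      using p q by (auto intro!: divide_pos_pos add_pos_nonneg)
    ultimately show ?thesis by (simp add: artanh_def ln_mult add_divide_distrib)
  qed
  finally show ?thesis unfolding e1 e2 e3 by (simp add: disk_dist_def)
qed

lemma disk_dist_antipodal:
  assumes "cmod u < 1"
  shows "disk_dist (-u) u = 4 * artanh (cmod u)"
proof -
  define t where "t = artanh (cmod u)"
  have tu: "tanh t = cmod u" using assms by (simp add: t_def tanh_artanh_real)
  have "1 - cnj (-u) * u = of_real (1 + (cmod u)\<^sup>2)"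
    by (simp add: complex_norm_square[symmetric] mult.commute)
  then have "Moebius_function 0 (-u) u = 2 * u / of_real (1 + (cmod u)\<^sup>2)"
    by (simp add: Moebius_function_simple)
  then have "cmod (Moebius_function 0 (-u) u) = 2 * cmod u / (1 + (cmod u)\<^sup>2)"
    by (simp only: norm_divide norm_mult norm_of_real) (simp add: abs_of_pos add_pos_nonneg)
  also have "\<dots> = tanh (t + t)"
    by (subst tanh_add) (auto simp: tu power2_eq_square)
  finally show ?thesis
    by (simp add: disk_dist_def artanh_tanh_real t_def)
qed

text \<open>
  Every pair of points becomes antipodal in suitable conformal coordinates, namely those centred at
  its hyperbolic midpoint.
\<close>

lemma antipodal_coordinates:
  assumes a: "cmod a < 1" and b: "cmod b < 1"
  obtains g k u where
    "g holomorphic_on ball 0 1" "g ` ball 0 1 \<subseteq> ball 0 1"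
    "k holomorphic_on ball 0 1" "k ` ball 0 1 \<subseteq> ball 0 1"
    "\<And>z w. cmod z < 1 \<Longrightarrow> cmod w < 1 \<Longrightarrow> disk_dist (k z) (k w) = disk_dist z w"
    "cmod u < 1" "g (-u) = a" "g u = b" "k a = -u" "k b = u"
proof -
  define c where "c = Moebius_function 0 a b"
  have c: "cmod c < 1" unfolding c_def by (rule Moebius_function_norm_lt_1[OF a b])
  define \<rho> where "\<rho> = tanh (artanh (cmod c) / 2)"
  define u where "u = complex_of_real \<rho> * sgn c"
  have \<rho>: "0 \<le> \<rho>" "\<rho> < 1" unfolding \<rho>_def using c by (auto intro!: artanh_nonneg_real tanh_real_lt_1)
  have cu: "cmod u = (if c = 0 then 0 else \<rho>)" using \<rho> by (simp add: u_def norm_mult norm_sgn)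
  have u: "cmod u < 1" using cu \<rho> by simp
  have d2: "2 * \<rho> / (1 + \<rho>\<^sup>2) = cmod c"
  proof -
    have "tanh (artanh (cmod c) / 2 + artanh (cmod c) / 2) = 2 * \<rho> / (1 + \<rho>\<^sup>2)"
      by (subst tanh_add) (auto simp: \<rho>_def power2_eq_square)
    then show ?thesis using c by (simp add: tanh_artanh_real)
  qed
  have Muu: "Moebius_function 0 (-u) u = c"
  proof (cases "c = 0")
    case True then show ?thesis by (simp add: u_def Moebius_function_simple)
  next
    case False
    have "1 - cnj (-u) * u = of_real (1 + (cmod u)\<^sup>2)"
      by (simp add: complex_norm_square[symmetric] mult.commute)
    then have "Moebius_function 0 (-u) u = 2 * u / of_real (1 + \<rho>\<^sup>2)"
      using cu False by (simp add: Moebius_function_simple)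
    also have "\<dots> = of_real (2 * \<rho> / (1 + \<rho>\<^sup>2)) * sgn c" by (simp add: u_def)
    also have "\<dots> = c" unfolding d2 using False by (simp add: sgn_eq)
    finally show ?thesis .
  qed
  define g where "g = Moebius_function 0 (-a) \<circ> Moebius_function 0 (-u)"
  define k where "k = Moebius_function 0 u \<circ> Moebius_function 0 a"
  have sub: "Moebius_function 0 d ` ball 0 1 \<subseteq> ball 0 1" if "cmod d < 1" for d
    using Moebius_function_norm_lt_1[OF that] by auto
  have inM: "cmod (Moebius_function 0 d z) < 1" if "cmod d < 1" "cmod z < 1" for d z
    using Moebius_function_norm_lt_1[OF that] .
  show thesis
  proof
    show "g holomorphic_on ball 0 1" unfolding g_def
      using a u by (intro holomorphic_on_compose_gen[OF _ _ sub] Moebius_function_holomorphic) auto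
    show "k holomorphic_on ball 0 1" unfolding k_def
      using a u by (intro holomorphic_on_compose_gen[OF _ _ sub] Moebius_function_holomorphic) auto
    show "g ` ball 0 1 \<subseteq> ball 0 1" "k ` ball 0 1 \<subseteq> ball 0 1"
      unfolding g_def k_def using a u by (auto intro!: inM)
    show "disk_dist (k z) (k w) = disk_dist z w" if "cmod z < 1" "cmod w < 1" for z w
      unfolding k_def using that a u by (simp add: Moebius_isometry inM)
    show "cmod u < 1" by fact
    show "g (-u) = a" "k a = -u"
      by (simp_all add: g_def k_def Moebius_function_eq_zero Moebius_function_of_zero)
    show "g u = b" unfolding g_def using a b by (simp add: Muu c_def Moebius_function_compose)
    show "k b = u" unfolding k_def using u by (simp add: Muu[symmetric] c_def[symmetric] Moebius_function_compose)
  qed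
qed

text \<open>
  The inverse hyperbolic tangent is convex on \<open>[0, 1)\<close> and vanishes at \<open>0\<close>.
\<close>

lemma artanh_scale_le:
  fixes \<kappa> s :: real
  assumes \<kappa>: "0 \<le> \<kappa>" "\<kappa> < 1" and s: "0 \<le> s" "s < 1"
  shows "artanh (\<kappa> * s) \<le> \<kappa> * artanh s"
proof -
  define f where "f = (\<lambda>x. \<kappa> * artanh x - artanh (\<kappa> * x))"
  have "f 0 \<le> f s"
  proof (rule DERIV_nonneg_imp_nondecreasing[OF s(1)])
    fix x :: real assume x: "0 \<le> x" "x \<le> s"
    then have x1: "x < 1" using s by simp
    have kx: "\<kappa> * x \<le> x" using \<kappa> x by (simp add: mult_left_le_one_le)
    have kx0: "0 \<le> \<kappa> * x" using \<kappa> x by simp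
    have "(\<kappa> * x)\<^sup>2 \<le> x\<^sup>2" using kx kx0 by (intro power_mono)
    moreover have "x\<^sup>2 < 1" using x x1 by (simp add: power_less_one_iff)
    ultimately have "1 / (1 - (\<kappa> * x)\<^sup>2) \<le> 1 / (1 - x\<^sup>2)" by (intro divide_left_mono) auto
    then have "0 \<le> \<kappa> * (1 / (1 - x\<^sup>2)) - 1 / (1 - (\<kappa> * x)\<^sup>2) * \<kappa>"
      using \<kappa> mult_left_mono[of "1 / (1 - (\<kappa> * x)\<^sup>2)" "1 / (1 - x\<^sup>2)" \<kappa>] by (simp add: mult.commute)
    moreover have "(f has_real_derivative \<kappa> * (1 / (1 - x\<^sup>2)) - 1 / (1 - (\<kappa> * x)\<^sup>2) * \<kappa>) (at x)"
    proof -
      have "(artanh has_real_derivative 1 / (1 - x\<^sup>2)) (at x)"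
        using x x1 by (intro artanh_real_has_field_derivative) auto
      moreover have "((\<lambda>x. artanh (\<kappa> * x)) has_real_derivative 1 / (1 - (\<kappa> * x)\<^sup>2) * \<kappa>) (at x)"
        using kx kx0 x1 by (intro DERIV_chain2[OF artanh_real_has_field_derivative]) (auto intro!: derivative_eq_intros)
      ultimately show ?thesis unfolding f_def by (intro DERIV_diff DERIV_cmult)
    qed
    ultimately show "\<exists>y. (f has_real_derivative y) (at x) \<and> 0 \<le> y" by blast
  qed
  then show ?thesis by (simp add: f_def)
qed

text \<open>
  A hyperbolic form of the Landau-Toeplitz theorem, in which the diameter of the image takes the
  place of its radius. Choose coordinates in which both \<open>a, b\<close> and their images are antipodal. Then
  the odd part \<open>q\<close> of the map carries all the information on this pair. The bound on the distance
  of the values at \<open>z\<close> and \<open>- z\<close> turns into \<open>2 |q| / (1 + |q|\<^sup>2) \<le> tanh (D / 2)\<close>, which is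
  \<open>|q| \<le> tanh (D / 4)\<close>, and \<open>q 0 = 0\<close>, so the Schwarz lemma applies to \<open>q\<close>.
\<close>

lemma disk_contraction:
  assumes h: "h holomorphic_on ball 0 1" "h ` ball 0 1 \<subseteq> ball 0 1"
    and diam: "\<And>z w. cmod z < 1 \<Longrightarrow> cmod w < 1 \<Longrightarrow> disk_dist (h z) (h w) \<le> D"
    and a: "cmod a < 1" and b: "cmod b < 1"
  shows "disk_dist (h a) (h b) \<le> tanh (D / 4) * disk_dist a b"
proof -
  have hin: "cmod (h z) < 1" if "cmod z < 1" for z using h(2) that by (force simp: image_subset_iff)
  have D0: "0 \<le> D" using diam[OF a a] by (simp add: disk_dist_self)
  define \<kappa> where "\<kappa> = tanh (D / 4)"
  have \<kappa>: "0 \<le> \<kappa>" "\<kappa> < 1" unfolding \<kappa>_def using D0 by (auto intro: tanh_real_lt_1)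
  obtain g k u where g: "g holomorphic_on ball 0 1" "g ` ball 0 1 \<subseteq> ball 0 1"
    and gk: "\<And>z w. cmod z < 1 \<Longrightarrow> cmod w < 1 \<Longrightarrow> disk_dist (k z) (k w) = disk_dist z w"
    and u: "cmod u < 1" "g (-u) = a" "g u = b" "k a = -u" "k b = u"
    using antipodal_coordinates[OF a b] by metis
  obtain g' k' u' where k': "k' holomorphic_on ball 0 1" "k' ` ball 0 1 \<subseteq> ball 0 1"
    and iso': "\<And>z w. cmod z < 1 \<Longrightarrow> cmod w < 1 \<Longrightarrow> disk_dist (k' z) (k' w) = disk_dist z w"
    and u': "cmod u' < 1" "k' (h a) = -u'" "k' (h b) = u'"
    using antipodal_coordinates[OF hin[OF a] hin[OF b]] by metis
  have gin: "cmod (g z) < 1" if "cmod z < 1" for z using g(2) that by (force simp: image_subset_iff)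
  have k'in: "cmod (k' z) < 1" if "cmod z < 1" for z using k'(2) that by (force simp: image_subset_iff)
  define f where "f = k' \<circ> (h \<circ> g)"
  have f: "f holomorphic_on ball 0 1"
    unfolding f_def o_def using gin hin
    by (intro holomorphic_on_comp[OF _ k'(1)] holomorphic_on_comp[OF g(1) h(1)]) auto
  have fin: "cmod (f z) < 1" if "cmod z < 1" for z using that by (simp add: f_def gin hin k'in)
  have fdiam: "disk_dist (f z) (f w) \<le> D" if "cmod z < 1" "cmod w < 1" for z w
    unfolding f_def using that by (simp add: iso' gin hin diam)
  define q where "q = (\<lambda>z. (f z - f (- z)) / 2)"
  have qhol: "q holomorphic_on ball 0 1"
  proof -
    have "(\<lambda>z. f (- z)) holomorphic_on ball 0 1"
      by (rule holomorphic_on_comp[OF _ f]) (auto intro!: holomorphic_intros)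
    then show ?thesis unfolding q_def using f by (intro holomorphic_intros) auto
  qed
  have qle: "cmod (q z) \<le> \<kappa>" if z: "cmod z < 1" for z
  proof -
    define s where "s = cmod (q z)"
    have mz: "cmod (- z) < 1" using z by simp
    have s0: "0 \<le> s" by (simp add: s_def)
    have s1: "s < 1"
    proof -
      have "cmod (f z - f (-z)) < 2"
        using norm_triangle_ineq4[of "f z" "f (-z)"] fin[OF z] fin[OF mz] by simp
      then show ?thesis by (simp add: s_def q_def norm_divide)
    qed
    have diff: "cmod (f z - f (-z)) = 2 * s" by (simp add: s_def q_def norm_divide)
    define A B where "A = (cmod (f z))\<^sup>2" and "B = (cmod (f (-z)))\<^sup>2"
    have AB: "A \<le> 1" "B \<le> 1" unfolding A_def B_def using fin[OF z] fin[OF mz] by (simp_all add: power_le_one)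
    \<comment> \<open>The parallelogram law for \<open>f z\<close> and \<open>f (- z)\<close>.\<close>
    have par: "2 * s\<^sup>2 \<le> A + B"
    proof -
      have "(2 * s)\<^sup>2 + (cmod (f z + f (-z)))\<^sup>2 = 2 * A + 2 * B"
        unfolding diff[symmetric] A_def B_def cmod_power2 by (simp add: power2_eq_square algebra_simps)
      moreover have "0 \<le> (cmod (f z + f (-z)))\<^sup>2" by simp
      moreover have "(2 * s)\<^sup>2 = 4 * s\<^sup>2" by (simp add: power_mult_distrib)
      ultimately show ?thesis by linarith
    qed
    have "(1 - A) * (1 - B) \<le> (1 - (A + B) / 2)\<^sup>2"
      using zero_le_power2[of "A - B"] by (simp add: power2_eq_square field_simps)
    also have "\<dots> \<le> (1 - s\<^sup>2)\<^sup>2" using par AB by (intro power_mono) auto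
    finally have "(cmod (1 - cnj (f (-z)) * f z))\<^sup>2 \<le> (2 * s)\<^sup>2 + (1 - s\<^sup>2)\<^sup>2"
      unfolding cmod_Moebius_identity diff by (simp add: A_def B_def mult.commute)
    also have "\<dots> = (1 + s\<^sup>2)\<^sup>2" by (simp add: power2_eq_square algebra_simps)
    \<comment> \<open>Equality holds if the even part of \<open>f\<close> vanishes at \<open>z\<close>.\<close>
    finally have den: "cmod (1 - cnj (f (-z)) * f z) \<le> 1 + s\<^sup>2"
      by (rule power2_le_imp_le) auto
    have dpos: "0 < cmod (1 - cnj (f (-z)) * f z)"
      using Moebius_denominator_nonzero[OF fin[OF mz] fin[OF z]] by simp
    have "2 * s / (1 + s\<^sup>2) \<le> 2 * s / cmod (1 - cnj (f (-z)) * f z)"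
      using den dpos s0 by (intro divide_left_mono mult_pos_pos) (auto simp: add_pos_nonneg)
    also have "\<dots> = cmod (Moebius_function 0 (f (-z)) (f z))"
      by (simp add: Moebius_function_simple norm_divide diff)
    also have "\<dots> \<le> tanh (D / 2)"
      using fdiam[OF mz z] by (simp add: cmod_Moebius_eq_tanh[OF fin[OF mz] fin[OF z]])
    also have "\<dots> = tanh (D / 4 + D / 4)" by simp
    also have "\<dots> = 2 * \<kappa> / (1 + \<kappa>\<^sup>2)"
      by (subst tanh_add) (auto simp: \<kappa>_def power2_eq_square)
    finally have le: "2 * s / (1 + s\<^sup>2) \<le> 2 * \<kappa> / (1 + \<kappa>\<^sup>2)" .
    have "0 < 1 + s\<^sup>2" "0 < 1 + \<kappa>\<^sup>2" by (simp_all add: add_pos_nonneg)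
    then have "2 * s * (1 + \<kappa>\<^sup>2) \<le> 2 * \<kappa> * (1 + s\<^sup>2)"
      using le by (simp add: pos_divide_le_eq pos_le_divide_eq mult.commute mult.left_commute)
    then have "(s - \<kappa>) * (1 - s * \<kappa>) \<le> 0" by (simp add: power2_eq_square algebra_simps)
    moreover have "s * \<kappa> < 1" using mult_strict_mono'[of s 1 \<kappa> 1] s0 s1 \<kappa> by simp
    ultimately have "s \<le> \<kappa>" by (simp add: mult_le_0_iff)
    then show ?thesis by (simp add: s_def)
  qed
  have qu: "cmod (q u) \<le> \<kappa> * cmod u"
  proof (rule field_le_epsilon)
    \<comment> \<open>\<open>\<kappa> + e\<close> turns the weak bound on \<open>q\<close> into the strict one of the Schwarz lemma.\<close>
    fix e :: real assume e: "0 < e"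
    have e1: "0 < \<kappa> + e" using \<kappa> e by simp
    have "cmod ((\<lambda>z. q z / of_real (\<kappa> + e)) u) \<le> cmod u"
    proof (rule Schwarz_Lemma(1))
      show "(\<lambda>z. q z / of_real (\<kappa> + e)) holomorphic_on ball 0 1"
        using qhol e1 by (intro holomorphic_intros) (auto simp flip: of_real_add)
      show "q 0 / of_real (\<kappa> + e) = 0" by (simp add: q_def)
      show "cmod (q z / of_real (\<kappa> + e)) < 1" if "cmod z < 1" for z
        using qle[OF that] e e1 by (simp add: norm_divide divide_less_eq flip: of_real_add)
    qed (rule u(1))
    then have "cmod (q u) \<le> cmod u * (\<kappa> + e)"
      using e1 by (simp add: norm_divide divide_le_eq flip: of_real_add)
    also have "\<dots> \<le> \<kappa> * cmod u + e" using u(1) e by (simp add: algebra_simps mult_left_le)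
    finally show "cmod (q u) \<le> \<kappa> * cmod u + e" .
  qed
  have "q u = u'" by (simp add: q_def f_def u u')
  then have u'le: "cmod u' \<le> \<kappa> * cmod u" using qu by simp
  have "disk_dist (h a) (h b) = disk_dist (-u') u'"
    using iso'[OF hin[OF a] hin[OF b]] by (simp add: u')
  also have "\<dots> = 4 * artanh (cmod u')" by (rule disk_dist_antipodal[OF u'(1)])
  also have "artanh (cmod u') \<le> artanh (\<kappa> * cmod u)"
    using u'le u(1) \<kappa> mult_strict_mono'[of \<kappa> 1 "cmod u" 1] by (intro artanh_mono_real) auto
  also have "\<dots> \<le> \<kappa> * artanh (cmod u)" using \<kappa> u(1) by (intro artanh_scale_le) auto
  also have "4 * (\<kappa> * artanh (cmod u)) = \<kappa> * disk_dist (-u) u"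
    by (simp add: disk_dist_antipodal[OF u(1)])
  also have "disk_dist (-u) u = disk_dist a b"
    using gk[OF a b] by (simp add: u)
  finally show ?thesis by (simp add: \<kappa>_def)
qed


section \<open>Separation of a point from a closed convex cone\<close>

definition sublinear :: "('a::real_vector \<Rightarrow> real) \<Rightarrow> bool"
  where "sublinear p \<longleftrightarrow> (\<forall>x y. p (x + y) \<le> p x + p y) \<and> (\<forall>t x. 0 < t \<longrightarrow> p (t *\<^sub>R x) = t * p x)"

lemma sublinear_zero:
  assumes "sublinear p" shows "p 0 = 0"
proof -
  have "p ((2::real) *\<^sub>R 0) = 2 * p 0" using assms unfolding sublinear_def by (metis zero_less_numeral)
  then show ?thesis by simp
qed

lemma sublinear_minus:
  assumes "sublinear p" shows "- p (- x) \<le> p x"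
  using assms sublinear_zero[OF assms] unfolding sublinear_def
  by (metis add.right_inverse le_minus_iff minus_le_iff add_increasing diff_ge_0_iff_ge diff_minus_eq_add)

text \<open>
  For sublinear \<open>p\<close> this is a sublinear functional below \<open>p\<close> with value at most \<open>- p v\<close> at \<open>- v\<close>;
  in other words, it makes \<open>p\<close> odd in the direction \<open>v\<close>.
\<close>

definition sublinear_drop :: "('a::real_vector \<Rightarrow> real) \<Rightarrow> 'a \<Rightarrow> 'a \<Rightarrow> real"
  where "sublinear_drop p v x = (INF t\<in>{0..}. p (x + t *\<^sub>R v) - t * p v)"

lemma sublinear_drop:
  assumes p: "sublinear p"
  shows "sublinear (sublinear_drop p v)" and "sublinear_drop p v x \<le> p x"
    and "sublinear_drop p v (- v) \<le> - p v"
proof -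
  have add: "p (x + y) \<le> p x + p y" and scale: "0 < t \<Longrightarrow> p (t *\<^sub>R x) = t * p x" for x y t
    using p unfolding sublinear_def by auto
  have scale0: "0 \<le> t \<Longrightarrow> p (t *\<^sub>R x) = t * p x" for t x
    using scale sublinear_zero[OF p] by (cases "t = 0") auto
  have low: "- p (- x) \<le> p (x + t *\<^sub>R v) - t * p v" if "0 \<le> t" for x t
    using add[of "x + t *\<^sub>R v" "- x"] scale0[OF that, of v] by simp
  have bdd: "bdd_below ((\<lambda>t. p (x + t *\<^sub>R v) - t * p v) ` {0..})" for x
    using low by (auto intro!: bdd_belowI2)
  have le: "sublinear_drop p v x \<le> p (x + t *\<^sub>R v) - t * p v" if "0 \<le> t" for x t
    unfolding sublinear_drop_def using that by (intro cINF_lower[OF bdd]) auto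
  show "sublinear_drop p v x \<le> p x" for x using le[of 0 x] by simp
  show "sublinear_drop p v (- v) \<le> - p v" using le[of 1 "- v"] sublinear_zero[OF p] by simp
  have homle: "sublinear_drop p v (t *\<^sub>R x) \<le> t * sublinear_drop p v x" if t: "0 < t" for t x
  proof -
    have "inverse t * sublinear_drop p v (t *\<^sub>R x) \<le> sublinear_drop p v x"
      unfolding sublinear_drop_def[of p v x]
    proof (rule cINF_greatest)
      fix s :: real assume s: "s \<in> {0..}"
      have "sublinear_drop p v (t *\<^sub>R x) \<le> p (t *\<^sub>R (x + s *\<^sub>R v)) - (t * s) * p v"
        using le[of "t * s" "t *\<^sub>R x"] s t by (simp add: scaleR_add_right)
      also have "\<dots> = t * (p (x + s *\<^sub>R v) - s * p v)" unfolding scale[OF t] by (simp add: algebra_simps)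
      finally show "inverse t * sublinear_drop p v (t *\<^sub>R x) \<le> p (x + s *\<^sub>R v) - s * p v"
        using t by (simp add: field_simps)
    qed auto
    then show ?thesis using t by (simp add: field_simps)
  qed
  show "sublinear (sublinear_drop p v)"
    unfolding sublinear_def
  proof (intro conjI allI impI)
    fix x y
    have "sublinear_drop p v (x + y) - (p (y + s *\<^sub>R v) - s * p v) \<le> sublinear_drop p v x" if s: "0 \<le> s" for s
      unfolding sublinear_drop_def[of p v x]
    proof (rule cINF_greatest)
      fix t :: real assume t: "t \<in> {0..}"
      have "sublinear_drop p v (x + y) \<le> p ((x + t *\<^sub>R v) + (y + s *\<^sub>R v)) - (t + s) * p v"
        using le[of "t + s" "x + y"] s t by (simp add: algebra_simps)
      also have "\<dots> \<le> (p (x + t *\<^sub>R v) - t * p v) + (p (y + s *\<^sub>R v) - s * p v)"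
        using add[of "x + t *\<^sub>R v" "y + s *\<^sub>R v"] by (simp add: algebra_simps)
      finally show "sublinear_drop p v (x + y) - (p (y + s *\<^sub>R v) - s * p v) \<le> p (x + t *\<^sub>R v) - t * p v" by simp
    qed auto
    then have "sublinear_drop p v (x + y) - sublinear_drop p v x \<le> p (y + s *\<^sub>R v) - s * p v" if "0 \<le> s" for s
      using that by (smt (verit))
    then have "sublinear_drop p v (x + y) - sublinear_drop p v x \<le> sublinear_drop p v y"
      unfolding sublinear_drop_def[of p v y] by (intro cINF_greatest) auto
    then show "sublinear_drop p v (x + y) \<le> sublinear_drop p v x + sublinear_drop p v y" by simp
  next
    fix t :: real and x assume t: "0 < t"
    have "sublinear_drop p v x = sublinear_drop p v (inverse t *\<^sub>R (t *\<^sub>R x))" using t by simp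
    also have "\<dots> \<le> inverse t * sublinear_drop p v (t *\<^sub>R x)" using t by (intro homle) auto
    finally have "t * sublinear_drop p v x \<le> sublinear_drop p v (t *\<^sub>R x)" using t by (simp add: field_simps)
    then show "sublinear_drop p v (t *\<^sub>R x) = t * sublinear_drop p v x" using homle[OF t, of x] by simp
  qed
qed

text \<open>
  By Zorn's lemma there is a minimal sublinear functional below \<open>p\<close>. It agrees with all
  its \<open>sublinear_drop\<close>s, so it is odd, and an odd sublinear functional is linear.
\<close>

theorem Hahn_Banach_sublinear:
  fixes p :: "'a::real_vector \<Rightarrow> real"
  assumes p: "sublinear p"
  obtains f where "linear f" "\<And>x. f x \<le> p x"
proof -
  define A where "A = {q. sublinear q \<and> q \<le> p}"
  have refl: "partial_order_on A (relation_of (\<lambda>f g. g \<le> f) A)"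
    unfolding partial_order_on_def preorder_on_def refl_on_def trans_def antisym_def relation_of_def
    by auto
  have chain: "\<exists>u\<in>A. \<forall>a\<in>K. u \<le> a" if K: "K \<in> Chains (relation_of (\<lambda>f g. g \<le> f) A)" for K
  proof (cases "K = {}")
    case True then show ?thesis using p by (auto simp: A_def)
  next
    case False
    have KA: "K \<subseteq> A" and lin: "\<And>f g. f \<in> K \<Longrightarrow> g \<in> K \<Longrightarrow> f \<le> g \<or> g \<le> f"
      using K unfolding Chains_def relation_of_def by auto
    define u where "u = (\<lambda>x. INF q\<in>K. q x)"
    have low: "- p (- x) \<le> q x" if "q \<in> K" for q x
    proof -
      have "q \<in> A" using KA that by auto
      then have "sublinear q" "q (- x) \<le> p (- x)" by (auto simp: A_def le_fun_def)
      then show ?thesis using sublinear_minus[of q x] by linarith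
    qed
    have bdd: "bdd_below ((\<lambda>q. q x) ` K)" for x using low by (intro bdd_belowI2)
    have ule: "u x \<le> q x" if "q \<in> K" for q x unfolding u_def using that by (rule cINF_lower[OF bdd])
    have ugr: "c \<le> u x" if "\<And>q. q \<in> K \<Longrightarrow> c \<le> q x" for c x unfolding u_def using False that by (rule cINF_greatest)
    have sub: "sublinear q" if "q \<in> K" for q using KA that by (auto simp: A_def)
    have "sublinear u" unfolding sublinear_def
    proof (intro conjI allI impI)
      fix x y
      have "u (x + y) - q' y \<le> u x" if q': "q' \<in> K" for q'
      proof (rule ugr)
        fix q assume q: "q \<in> K"
        obtain r where r: "r \<in> K" "r \<le> q" "r \<le> q'" using lin[OF q q'] q q' by auto
        have "u (x + y) \<le> r (x + y)" by (rule ule[OF r(1)])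
        also have "\<dots> \<le> r x + r y" using sub[OF r(1)] by (auto simp: sublinear_def)
        also have "\<dots> \<le> q x + q' y" using r by (auto simp: le_fun_def intro: add_mono)
        finally show "u (x + y) - q' y \<le> q x" by simp
      qed
      then have "u (x + y) - u x \<le> u y" by (intro ugr) (smt (verit))
      then show "u (x + y) \<le> u x + u y" by simp
    next
      fix t :: real and x assume t: "0 < t"
      have e: "q (t *\<^sub>R x) = t * q x" if "q \<in> K" for q using sub[OF that] t by (auto simp: sublinear_def)
      have "t * u x \<le> u (t *\<^sub>R x)"
        using t by (intro ugr) (auto simp: e intro!: mult_left_mono ule)
      moreover have "inverse t * u (t *\<^sub>R x) \<le> u x"
      proof (rule ugr)
        fix q assume "q \<in> K"
        then show "inverse t * u (t *\<^sub>R x) \<le> q x" using ule[of q "t *\<^sub>R x"] e[of q] t by (simp add: field_simps)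
      qed
      ultimately show "u (t *\<^sub>R x) = t * u x" using t by (simp add: field_simps)
    qed
    moreover have "u \<le> p"
    proof -
      obtain q where "q \<in> K" using False by auto
      then have "u \<le> q" "q \<le> p" using ule KA by (auto simp: le_fun_def A_def)
      then show ?thesis by (rule order_trans)
    qed
    ultimately show ?thesis using ule by (auto simp: A_def le_fun_def)
  qed
  obtain f where f: "f \<in> A" and min: "\<And>q. q \<in> A \<Longrightarrow> q \<le> f \<Longrightarrow> q = f"
    using predicate_Zorn[OF refl chain] by blast
  have sf: "sublinear f" and fp: "f \<le> p" using f by (auto simp: A_def)
  have odd: "f (- v) = - f v" for v
  proof -
    have le: "sublinear_drop f v \<le> f" using sublinear_drop(2)[OF sf] by (auto simp: le_fun_def)
    then have "sublinear_drop f v = f"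
      using fp sublinear_drop(1)[OF sf] by (intro min) (auto simp: A_def intro: order_trans)
    then have "f (- v) \<le> - f v" using sublinear_drop(3)[OF sf, of v] by simp
    moreover have "- f (- v) \<le> f v" by (rule sublinear_minus[OF sf])
    ultimately show ?thesis by simp
  qed
  have "linear f"
  proof (rule linearI)
    fix x y
    have sub: "f (x + y) \<le> f x + f y" for x y using sf by (auto simp: sublinear_def)
    have "f x \<le> f (x + y) + f (- y)" using sub[of "x + y" "- y"] by simp
    then show "f (x + y) = f x + f y" using sub[of x y] odd[of y] by simp
  next
    fix t :: real and x
    have pos: "f (t *\<^sub>R x) = t * f x" if "0 < t" for t x using sf that by (auto simp: sublinear_def)
    consider "0 < t" | "t = 0" | "t < 0" by linarith
    then show "f (t *\<^sub>R x) = t *\<^sub>R f x"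
    proof cases
      case 3
      then have "f (t *\<^sub>R x) = - f ((- t) *\<^sub>R x)" using odd[of "t *\<^sub>R x"] by simp
      then show ?thesis using pos[of "- t" x] 3 by simp
    qed (use pos sublinear_zero[OF sf] in auto)
  qed
  then show thesis using fp that by (auto simp: le_fun_def)
qed

text \<open>
  The distance to the cone is sublinear, vanishes on the cone and is positive at \<open>v\<close>. A linear
  functional below its drop along \<open>v\<close> is nonpositive on the cone and positive at \<open>v\<close>.
\<close>

lemma closed_cone_separation:
  fixes P :: "'a::real_normed_vector set"
  assumes cl: "closed P" and ne: "P \<noteq> {}"
    and add: "\<And>x y. x \<in> P \<Longrightarrow> y \<in> P \<Longrightarrow> x + y \<in> P"
    and scale: "\<And>t x. 0 < t \<Longrightarrow> x \<in> P \<Longrightarrow> t *\<^sub>R x \<in> P"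
    and v: "v \<notin> P"
  obtains f :: "'a \<Rightarrow> real" where "linear f" "\<And>x. x \<in> P \<Longrightarrow> 0 \<le> f x" "f v < 0"
proof -
  define p where "p = (\<lambda>x. infdist x P)"
  have homle: "p (t *\<^sub>R x) \<le> t * p x" if t: "0 < t" for t x
  proof -
    have "inverse t * p (t *\<^sub>R x) \<le> p x"
      unfolding p_def infdist_notempty[OF ne, of x]
    proof (rule cINF_greatest[OF ne])
      fix y assume y: "y \<in> P"
      have "infdist (t *\<^sub>R x) P \<le> dist (t *\<^sub>R x) (t *\<^sub>R y)" using y t by (intro infdist_le scale)
      also have "\<dots> = t * dist x y" using t by (simp add: dist_norm flip: scaleR_diff_right)
      finally show "inverse t * infdist (t *\<^sub>R x) P \<le> dist x y" using t by (simp add: field_simps)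
    qed
    then show ?thesis using t by (simp add: field_simps)
  qed
  have "sublinear p" unfolding sublinear_def
  proof (intro conjI allI impI)
    fix x y
    have "p (x + y) - dist y b \<le> p x" if b: "b \<in> P" for b
      unfolding p_def infdist_notempty[OF ne, of x]
    proof (rule cINF_greatest[OF ne])
      fix a assume a: "a \<in> P"
      have "infdist (x + y) P \<le> dist (x + y) (a + b)" using a b by (intro infdist_le add)
      also have "\<dots> \<le> dist x a + dist y b" by (rule dist_triangle_add)
      finally show "infdist (x + y) P - dist y b \<le> dist x a" by simp
    qed
    then have "p (x + y) - p x \<le> p y"
      unfolding p_def infdist_notempty[OF ne, of y] by (intro cINF_greatest[OF ne]) (smt (verit))
    then show "p (x + y) \<le> p x + p y" by simp
  next
    fix t :: real and x assume t: "0 < t"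
    have "p x \<le> inverse t * p (t *\<^sub>R x)" using homle[of "inverse t" "t *\<^sub>R x"] t by simp
    then show "p (t *\<^sub>R x) = t * p x" using homle[OF t, of x] t by (simp add: field_simps)
  qed
  note sub = sublinear_drop[OF this, of v]
  obtain f where f: "linear f" "\<And>x. f x \<le> sublinear_drop p v x"
    using Hahn_Banach_sublinear[OF sub(1)] by metis
  show thesis
  proof (rule that[of "\<lambda>x. - f x"])
    show "linear (\<lambda>x. - f x)" using f(1) by (intro linear_compose_neg)
    show "0 \<le> - f x" if "x \<in> P" for x
      using f(2)[of x] sub(2)[of x] that by (simp add: p_def)
    have "f (- v) \<le> - p v" using f(2)[of "- v"] sub(3) by simp
    moreover have "0 < p v" using in_closed_iff_infdist_zero[OF cl ne, of v] v infdist_nonneg[of v P]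
      by (simp add: p_def)
    ultimately show "- f v < 0" using linear_neg[OF f(1), of v] by simp
  qed
qed


section \<open>The dual description of a quadrant cone\<close>

definition complex_linear :: "('a::complex_banach \<Rightarrow> complex) \<Rightarrow> bool"
  where "complex_linear m \<longleftrightarrow> (\<forall>x y. m (x + y) = m x + m y) \<and> (\<forall>c x. m (c *\<^sub>C x) = c * m x)"

lemma complex_linear_add: "complex_linear m \<Longrightarrow> m (x + y) = m x + m y"
  and complex_linear_scale: "complex_linear m \<Longrightarrow> m (c *\<^sub>C x) = c * m x"
  by (auto simp: complex_linear_def)

lemma scaleC_zero_left [simp]: "0 *\<^sub>C (x::'a::complex_banach) = 0"
  by (metis of_real_0 scaleC_of_real scaleR_zero_left)

lemma scaleC_zero_right [simp]: "c *\<^sub>C (0::'a::complex_banach) = 0"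
  using scaleC_scaleC[of c 0 "0::'a"] by simp

lemma scaleC_minus_left: "(- c) *\<^sub>C x = - (c *\<^sub>C (x::'a::complex_banach))"
  using scaleC_add_left[of c "- c" x] by (simp add: eq_neg_iff_add_eq_0 add.commute)

lemma scaleC_minus_right: "c *\<^sub>C (- x) = - (c *\<^sub>C (x::'a::complex_banach))"
  using scaleC_add_right[of c x "- x"] by (simp add: eq_neg_iff_add_eq_0 add.commute)

lemma scaleC_diff_right: "c *\<^sub>C (x - y) = c *\<^sub>C x - c *\<^sub>C (y::'a::complex_banach)"
  unfolding diff_conv_add_uminus scaleC_add_right scaleC_minus_right ..

lemma scaleC_diff_left: "(a - b) *\<^sub>C x = a *\<^sub>C x - b *\<^sub>C (x::'a::complex_banach)"
  unfolding diff_conv_add_uminus scaleC_add_left scaleC_minus_left ..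

lemma complex_linear_of_real_part:
  fixes f :: "'a::complex_banach \<Rightarrow> real"
  assumes f: "linear f"
  shows "complex_linear (\<lambda>x. Complex (f x) (- f (\<i> *\<^sub>C x)))"
proof -
  have add: "f (x + y) = f x + f y" for x y by (rule linear_add[OF f])
  have sc: "f (r *\<^sub>R x) = r * f x" for r x using linear_scale[OF f] by simp
  have c: "f (c *\<^sub>C x) = Re c * f x + Im c * f (\<i> *\<^sub>C x)" for c x
  proof -
    have "c *\<^sub>C x = (complex_of_real (Re c) + complex_of_real (Im c) * \<i>) *\<^sub>C x"
      by (subst complex_eq[of c]) (simp add: mult.commute)
    also have "\<dots> = Re c *\<^sub>R x + Im c *\<^sub>R (\<i> *\<^sub>C x)"
      by (simp add: scaleC_add_left scaleC_of_real flip: scaleC_scaleC)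
    finally show ?thesis by (simp add: add sc)
  qed
  show ?thesis
    unfolding complex_linear_def
    by (auto simp: complex_eq_iff add scaleC_add_right scaleC_scaleC) (subst c, simp add: algebra_simps)+
qed

locale quadrant_cone =
  fixes C R :: "'a::complex_banach set"
  assumes closed_convex: "closed_convex_cone R"
    and C1: "cond_C1 C R"
begin

text \<open>
  The functionals whose values on \<open>R\<close> lie in the closed first quadrant. Their real and imaginary
  parts are nonnegative on \<open>R - \<i> R\<close> and on \<open>R + \<i> R\<close>, respectively. They are
  algebraic functionals, since all that follows takes place in planes spanned by two vectors.
\<close>

definition dual :: "('a \<Rightarrow> complex) set"
  where "dual = {m. complex_linear m \<and> (\<forall>r\<in>R. 0 \<le> Re (m r) \<and> 0 \<le> Im (m r))}"

lemma dualD: "m \<in> dual \<Longrightarrow> complex_linear m" and dual_Re: "m \<in> dual \<Longrightarrow> r \<in> R \<Longrightarrow> 0 \<le> Re (m r)"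
  and dual_Im: "m \<in> dual \<Longrightarrow> r \<in> R \<Longrightarrow> 0 \<le> Im (m r)"
  by (auto simp: dual_def)

lemma dual_add: "m \<in> dual \<Longrightarrow> l \<in> dual \<Longrightarrow> (\<lambda>x. m x + l x) \<in> dual"
  by (auto simp: dual_def complex_linear_def algebra_simps)

lemma dual_scale: "m \<in> dual \<Longrightarrow> 0 \<le> t \<Longrightarrow> (\<lambda>x. of_real t * m x) \<in> dual"
  by (auto simp: dual_def complex_linear_def algebra_simps)

lemma R_add: "x \<in> R \<Longrightarrow> y \<in> R \<Longrightarrow> x + y \<in> R"
  and R_scale: "0 < t \<Longrightarrow> x \<in> R \<Longrightarrow> t *\<^sub>R x \<in> R"
  using closed_convex by (auto simp: closed_convex_cone_def)

lemma zero_in_R: "0 \<in> R"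
proof -
  obtain r where r: "r \<in> R" using closed_convex by (auto simp: closed_convex_cone_def)
  have "(\<lambda>n. (1 / real (Suc n)) *\<^sub>R r) \<longlonglongrightarrow> 0 *\<^sub>R r"
    by (intro tendsto_intros LIMSEQ_Suc lim_1_over_n)
  then show ?thesis
    using closed_convex r R_scale[of _ r] unfolding closed_convex_cone_def closed_sequential_limits
    by (metis (no_types, lifting) divide_pos_pos of_nat_0_less_iff scale_zero_left zero_less_Suc zero_less_one)
qed

lemma closure_cone_separation:
  assumes v: "v \<notin> closure {r + c *\<^sub>C s |r s. r \<in> R \<and> s \<in> R}"
  shows "\<exists>f :: 'a \<Rightarrow> real. linear f \<and> (\<forall>r\<in>R. 0 \<le> f r) \<and> (\<forall>r\<in>R. 0 \<le> f (c *\<^sub>C r)) \<and> f v < 0"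
proof -
  define K where "K = {r + c *\<^sub>C s |r s. r \<in> R \<and> s \<in> R}"
  have Kadd: "x + y \<in> K" if xy: "x \<in> K" "y \<in> K" for x y
  proof -
    obtain r s r' s' where "x = r + c *\<^sub>C s" "y = r' + c *\<^sub>C s'" "r \<in> R" "s \<in> R" "r' \<in> R" "s' \<in> R"
      using xy unfolding K_def by blast
    then have "x + y = (r + r') + c *\<^sub>C (s + s')" "r + r' \<in> R" "s + s' \<in> R"
      by (auto simp: scaleC_add_right R_add)
    then show ?thesis unfolding K_def by blast
  qed
  have Kscale: "t *\<^sub>R x \<in> K" if x: "x \<in> K" and t: "0 < t" for t x
  proof -
    obtain r s where "x = r + c *\<^sub>C s" "r \<in> R" "s \<in> R" using x unfolding K_def by blast
    moreover have "t *\<^sub>R (c *\<^sub>C s) = c *\<^sub>C (t *\<^sub>R s)"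
      by (simp add: scaleC_scaleC mult.commute flip: scaleC_of_real)
    ultimately have "t *\<^sub>R x = t *\<^sub>R r + c *\<^sub>C (t *\<^sub>R s)" "t *\<^sub>R r \<in> R" "t *\<^sub>R s \<in> R"
      using t by (auto simp: scaleR_add_right R_scale)
    then show ?thesis unfolding K_def by blast
  qed
  have inK: "r \<in> K" "c *\<^sub>C r \<in> K" if "r \<in> R" for r
    using that zero_in_R unfolding K_def by (force intro: exI[of _ 0])+
  have "closure K \<noteq> {}" using inK(1)[OF zero_in_R] by auto
  moreover have "x + y \<in> closure K" if xy: "x \<in> closure K" "y \<in> closure K" for x y
  proof -
    obtain a b where "\<And>n. a n \<in> K" "a \<longlonglongrightarrow> x" "\<And>n. b n \<in> K" "b \<longlonglongrightarrow> y"
      using xy unfolding closure_sequential by blast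
    then have "\<And>n. a n + b n \<in> K" "(\<lambda>n. a n + b n) \<longlonglongrightarrow> x + y"
      by (auto intro: Kadd tendsto_add)
    then show ?thesis unfolding closure_sequential by (intro exI[of _ "\<lambda>n. a n + b n"]) auto
  qed
  moreover have "t *\<^sub>R x \<in> closure K" if t: "0 < t" and x: "x \<in> closure K" for t x
  proof -
    obtain a where "\<And>n. a n \<in> K" "a \<longlonglongrightarrow> x"
      using x unfolding closure_sequential by blast
    then have "\<And>n. t *\<^sub>R a n \<in> K" "(\<lambda>n. t *\<^sub>R a n) \<longlonglongrightarrow> t *\<^sub>R x"
      using t by (auto intro: Kscale tendsto_scaleR)
    then show ?thesis unfolding closure_sequential by (intro exI[of _ "\<lambda>n. t *\<^sub>R a n"]) auto
  qed
  moreover have "v \<notin> closure K" using v by (simp add: K_def)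
  ultimately obtain f :: "'a \<Rightarrow> real" where f: "linear f" "\<And>x. x \<in> closure K \<Longrightarrow> 0 \<le> f x" "f v < 0"
    using closed_cone_separation[OF closed_closure, of K v] by metis
  have "0 \<le> f x" if "x \<in> K" for x using f(2) closure_subset that by blast
  then show ?thesis using f inK by blast
qed

text \<open>
  The bipolar theorem for \<open>R\<close>. A vector outside \<open>R\<close> is outside one of the two closed cones in
  (C1). A real functional that separates it from this cone is the real or the imaginary part of a
  member of \<open>dual\<close>.
\<close>

lemma R_iff: "v \<in> R \<longleftrightarrow> (\<forall>m\<in>dual. 0 \<le> Re (m v) \<and> 0 \<le> Im (m v))"
proof
  assume "\<forall>m\<in>dual. 0 \<le> Re (m v) \<and> 0 \<le> Im (m v)"
  then have all: "0 \<le> Re (m v)" "0 \<le> Im (m v)" if "m \<in> dual" for m using that by auto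
  have eq: "closure {r + \<i> *\<^sub>C s |r s. r \<in> R \<and> s \<in> R} \<inter> closure {r + (-\<i>) *\<^sub>C s |r s. r \<in> R \<and> s \<in> R} = R"
    using C1 by (simp add: cond_C1_def scaleC_minus_left)
  have "v \<in> closure {r + \<i> *\<^sub>C s |r s. r \<in> R \<and> s \<in> R}"
  proof (rule ccontr)
    assume "v \<notin> closure {r + \<i> *\<^sub>C s |r s. r \<in> R \<and> s \<in> R}"
    then obtain f :: "'a \<Rightarrow> real" where f: "linear f" "\<forall>r\<in>R. 0 \<le> f r"
        "\<forall>r\<in>R. 0 \<le> f (\<i> *\<^sub>C r)" "f v < 0"
      using closure_cone_separation by meson
    let ?m = "\<lambda>x. \<i> * Complex (f x) (- f (\<i> *\<^sub>C x))"
    have "?m \<in> dual"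
      using complex_linear_of_real_part[OF f(1)] f(2,3) by (auto simp: dual_def complex_linear_def algebra_simps)
    from all(2)[OF this] show False using f(4) by simp
  qed
  moreover have "v \<in> closure {r + (-\<i>) *\<^sub>C s |r s. r \<in> R \<and> s \<in> R}"
  proof (rule ccontr)
    assume "v \<notin> closure {r + (-\<i>) *\<^sub>C s |r s. r \<in> R \<and> s \<in> R}"
    then obtain f :: "'a \<Rightarrow> real" where f: "linear f" "\<forall>r\<in>R. 0 \<le> f r"
        "\<forall>r\<in>R. 0 \<le> f ((-\<i>) *\<^sub>C r)" "f v < 0"
      using closure_cone_separation by meson
    let ?m = "\<lambda>x. Complex (f x) (- f (\<i> *\<^sub>C x))"
    have "0 \<le> - f (\<i> *\<^sub>C r)" if "r \<in> R" for r
      using bspec[OF f(3) that] linear_neg[OF f(1)] by (simp add: scaleC_minus_left)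
    then have "?m \<in> dual"
      using complex_linear_of_real_part[OF f(1)] f(2) by (auto simp: dual_def)
    from all(1)[OF this] show False using f(4) by simp
  qed
  ultimately show "v \<in> R" using eq by blast
qed (auto simp: dual_def)

lemma in_C_iff: "v \<in> C \<longleftrightarrow> (\<exists>c r. v = c *\<^sub>C r \<and> c \<noteq> 0 \<and> r \<in> R)"
  using C1 unfolding cond_C1_def by blast

lemma C_obtain:
  assumes "v \<in> C"
  obtains c where "c \<noteq> 0" "c *\<^sub>C v \<in> R"
proof -
  obtain c r where "v = c *\<^sub>C r" "c \<noteq> 0" "r \<in> R" using assms in_C_iff by blast
  then show thesis by (intro that[of "inverse c"]) (auto simp: scaleC_scaleC scaleC_one)
qed

lemma C_scale: "c *\<^sub>C v \<in> C" if vc: "v \<in> C" "c \<noteq> 0"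
proof -
  obtain d r where "v = d *\<^sub>C r" "d \<noteq> 0" "r \<in> R" using vc in_C_iff by blast
  then have "c *\<^sub>C v = (c * d) *\<^sub>C r" "c * d \<noteq> 0" using vc by (auto simp: scaleC_scaleC)
  then show ?thesis using \<open>r \<in> R\<close> in_C_iff by blast
qed

lemma R_subset_C: "R \<subseteq> C"
  using in_C_iff scaleC_one by (metis one_neq_zero subsetI)

lemma zero_in_C: "0 \<in> C" using zero_in_R R_subset_C by auto

lemma C_scale_iff: "c *\<^sub>C v \<in> C \<longleftrightarrow> v \<in> C" if "c \<noteq> 0"
  using C_scale[of v c] C_scale[of "c *\<^sub>C v" "inverse c"] that by (auto simp: scaleC_scaleC scaleC_one)

end

text \<open>
  Directions that differ pairwise by at most a right angle fit into one quadrant: measured from one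
  of them, their arguments lie in a half-plane, so they can be compared as real numbers, and the
  infimum of the arguments is rotated to \<open>0\<close>.
\<close>

lemma rotate_into_quadrant:
  fixes Z :: "complex set"
  assumes acute: "\<And>z w. z \<in> Z \<Longrightarrow> w \<in> Z \<Longrightarrow> 0 \<le> Re (z * cnj w)"
  shows "\<exists>c. c \<noteq> 0 \<and> (\<forall>z\<in>Z. 0 \<le> Re (c * z) \<and> 0 \<le> Im (c * z))"
proof (cases "Z \<subseteq> {0}")
  case True then show ?thesis by (intro exI[of _ 1]) auto
next
  case False
  then obtain z0 where z0: "z0 \<in> Z" "z0 \<noteq> 0" by auto
  define A where "A = (\<lambda>z. Arg (z / z0)) ` (Z - {0})"
  have half: "Arg (z / z0) \<in> {-(pi/2)..pi/2}" if "z \<in> Z - {0}" for z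
  proof -
    have "0 \<le> Re (z / z0)"
      using acute[of z z0] z0 that by (simp add: complex_div_cnj[of z z0] flip: of_real_power)
    then have "\<bar>Arg (z / z0)\<bar> \<le> pi / 2" by (simp only: Arg_Re_nonneg)
    then show ?thesis unfolding abs_le_iff atLeastAtMost_iff by linarith
  qed
  have le: "a \<le> b + pi / 2" if ab: "a \<in> A" "b \<in> A" for a b
  proof (rule ccontr)
    assume gt: "\<not> a \<le> b + pi / 2"
    obtain z w where z: "z \<in> Z - {0}" "a = Arg (z / z0)" and w: "w \<in> Z - {0}" "b = Arg (w / z0)"
      using ab unfolding A_def by auto
    have "a - b \<le> pi" using half[OF z(1)] half[OF w(1)] z w by auto
    then have "cos (a - b) < 0" using gt pi_gt_zero by (intro cos_lt_zero_pi) linarith+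
    moreover have "0 \<le> Re ((z / z0) * cnj (w / z0))"
    proof -
      have "(z / z0) * cnj (w / z0) = (z * cnj w) / of_real ((cmod z0)\<^sup>2)"
        unfolding complex_norm_square by simp
      then show ?thesis using acute[of z w] z w by (simp only: Re_divide_of_real) auto
    qed
    moreover have "(z / z0) * cnj (w / z0) = rcis (cmod (z / z0) * cmod (w / z0)) (a - b)"
      unfolding z w using rcis_cmod_Arg[of "z / z0"] rcis_cmod_Arg[of "w / z0"]
      by (metis cis_cnj complex_cnj_complex_of_real complex_cnj_mult diff_conv_add_uminus rcis_def rcis_mult)
    ultimately have "0 \<le> cmod (z / z0) * cmod (w / z0) * cos (a - b)" "cos (a - b) < 0" by (auto simp: Re_rcis)
    moreover have "0 < cmod (z / z0) * cmod (w / z0)" using z w z0 by simp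
    ultimately show False by (metis mult_pos_neg not_less)
  qed
  have A: "A \<noteq> {}" using z0 unfolding A_def by auto
  have bdd: "bdd_below A" using half unfolding A_def by (intro bdd_belowI2[of _ "-(pi/2)"]) auto
  define \<phi> where "\<phi> = Inf A"
  have low: "\<phi> \<le> a" if "a \<in> A" for a unfolding \<phi>_def by (rule cInf_lower[OF that bdd])
  have up: "a \<le> \<phi> + pi / 2" if "a \<in> A" for a
  proof -
    have "a - pi / 2 \<le> \<phi>" unfolding \<phi>_def using le[OF that] by (intro cInf_greatest[OF A]) (smt (verit))
    then show ?thesis by simp
  qed
  show ?thesis
  proof (intro exI[of _ "cis (- \<phi>) / z0"] conjI ballI)
    show "cis (- \<phi>) / z0 \<noteq> 0" using z0 by simp
    fix z assume z: "z \<in> Z"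
    have "0 \<le> Re (cis (- \<phi>) / z0 * z) \<and> 0 \<le> Im (cis (- \<phi>) / z0 * z)"
    proof (cases "z = 0")
      case False
      then have a: "Arg (z / z0) \<in> A" using z unfolding A_def by auto
      have "cis (- \<phi>) / z0 * z = rcis (cmod (z / z0)) (Arg (z / z0) - \<phi>)"
        using rcis_cmod_Arg[of "z / z0"]
        by (metis (no_types, lifting) add.commute cis_rcis_eq mult.commute mult_1 rcis_mult times_divide_eq_left times_divide_eq_right uminus_add_conv_diff)
      moreover have "0 \<le> Arg (z / z0) - \<phi>" "Arg (z / z0) - \<phi> \<le> pi / 2" using low[OF a] up[OF a] by auto
      then have "0 \<le> cos (Arg (z / z0) - \<phi>)" "0 \<le> sin (Arg (z / z0) - \<phi>)"
        by (auto intro!: cos_ge_zero sin_ge_zero)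
      ultimately show ?thesis by (simp add: Re_rcis Im_rcis)
    qed simp
    then show "0 \<le> Re (cis (- \<phi>) / z0 * z)" "0 \<le> Im (cis (- \<phi>) / z0 * z)" by auto
  qed
qed

text \<open>
  The polar form of \<open>form m l\<close>, see \<open>form_combination\<close>. For \<open>w = m / l\<close> it is, up to the factor
  \<open>l X * cnj (l Y)\<close>, the sum \<open>w X + cnj (w Y)\<close>, which measures the distance of \<open>w X\<close> and \<open>w Y\<close> in
  the right half-plane.
\<close>

definition cross :: "('a \<Rightarrow> complex) \<Rightarrow> ('a \<Rightarrow> complex) \<Rightarrow> 'a \<Rightarrow> 'a \<Rightarrow> complex"
  where "cross m l X Y = m X * cnj (l Y) + l X * cnj (m Y)"

definition form :: "('a \<Rightarrow> complex) \<Rightarrow> ('a \<Rightarrow> complex) \<Rightarrow> 'a \<Rightarrow> real"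
  where "form m l v = Re (m v * cnj (l v))"

lemma form_combination:
  assumes "complex_linear m" "complex_linear l"
  shows "form m l (a *\<^sub>C X + b *\<^sub>C Y)
    = (cmod a)\<^sup>2 * form m l X + (cmod b)\<^sup>2 * form m l Y + Re (a * cnj b * cross m l X Y)"
  unfolding form_def cross_def complex_linear_add[OF assms(1)] complex_linear_add[OF assms(2)]
    complex_linear_scale[OF assms(1)] complex_linear_scale[OF assms(2)] cmod_power2
  by (simp add: power2_eq_square algebra_simps)

context quadrant_cone begin

text \<open>
  By \<open>rotate_into_quadrant\<close>, the pairwise conditions on the values \<open>m v\<close> amount to a common
  rotation that moves all of them into the first quadrant, and hence moves \<open>v\<close> into \<open>R\<close>.
\<close>

lemma in_C_iff_form: "v \<in> C \<longleftrightarrow> (\<forall>m\<in>dual. \<forall>l\<in>dual. 0 \<le> form m l v)"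
  unfolding form_def
proof
  assume "v \<in> C"
  then obtain c where c: "c \<noteq> 0" "c *\<^sub>C v \<in> R" by (rule C_obtain)
  show "\<forall>m\<in>dual. \<forall>l\<in>dual. 0 \<le> Re (m v * cnj (l v))"
  proof (intro ballI)
    fix m l assume m: "m \<in> dual" and l: "l \<in> dual"
    have "0 \<le> Re (m (c *\<^sub>C v) * cnj (l (c *\<^sub>C v)))"
      using dual_Re[OF m c(2)] dual_Re[OF l c(2)] dual_Im[OF m c(2)] dual_Im[OF l c(2)] by simp
    also have "m (c *\<^sub>C v) * cnj (l (c *\<^sub>C v)) = of_real ((cmod c)\<^sup>2) * (m v * cnj (l v))"
      unfolding complex_norm_square by (simp add: complex_linear_scale dualD m l)
    finally show "0 \<le> Re (m v * cnj (l v))" using c(1) by (simp only: Re_complex_of_real times_complex.sel Im_complex_of_real) (simp add: zero_le_mult_iff)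
  qed
next
  assume a: "\<forall>m\<in>dual. \<forall>l\<in>dual. 0 \<le> Re (m v * cnj (l v))"
  have "\<exists>c. c \<noteq> 0 \<and> (\<forall>z\<in>(\<lambda>m. m v) ` dual. 0 \<le> Re (c * z) \<and> 0 \<le> Im (c * z))"
    using a by (intro rotate_into_quadrant) auto
  then obtain c where c: "c \<noteq> 0" "\<And>m. m \<in> dual \<Longrightarrow> 0 \<le> Re (c * m v) \<and> 0 \<le> Im (c * m v)" by auto
  have "c *\<^sub>C v \<in> R" unfolding R_iff using c(2) by (auto simp: complex_linear_scale[OF dualD])
  then show "v \<in> C" using R_subset_C C_scale_iff[OF c(1)] by auto
qed

end


section \<open>Planar slices of a cone are simply connected\<close>

lemma connected_if_joined:
  assumes "\<And>a b. a \<in> A \<Longrightarrow> b \<in> A \<Longrightarrow> \<exists>S. S \<subseteq> A \<and> connected S \<and> a \<in> S \<and> b \<in> S"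
  shows "connected A"
proof (rule iffD2[OF connected_iff_connected_component], intro ballI)
  fix a b assume ab: "a \<in> A" "b \<in> A"
  obtain S where "S \<subseteq> A" "connected S" "a \<in> S" "b \<in> S" using assms[OF ab] by blast
  then show "connected_component A a b" unfolding connected_component_def by blast
qed

lemma inversion_interior:
  fixes S T :: "complex set"
  assumes eq: "\<And>w. w \<noteq> 0 \<Longrightarrow> w \<in> S \<longleftrightarrow> 1 / w \<in> T" and w: "w \<noteq> 0"
  shows "w \<in> interior S \<longleftrightarrow> 1 / w \<in> interior T"
proof -
  have imp: "1 / w \<in> interior T" if eq: "\<And>w. w \<noteq> 0 \<Longrightarrow> w \<in> S \<longleftrightarrow> 1 / w \<in> T" and w: "w \<noteq> 0" "w \<in> interior S"
    for S T :: "complex set" and w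
  proof -
    define U where "U = (\<lambda>z. 1 / z) -` interior S \<inter> (- {0})"
    have "continuous_on (- {0}) (\<lambda>z::complex. 1 / z)" by (intro continuous_intros) auto
    then have "open U" unfolding U_def
      using continuous_on_open_vimage[of "- {0}" "\<lambda>z::complex. 1 / z"] by auto
    moreover have "U \<subseteq> T"
    proof
      fix z assume "z \<in> U"
      then have "1 / z \<in> S" "z \<noteq> 0" using interior_subset unfolding U_def by auto
      then show "z \<in> T" using eq[of "1 / z"] by simp
    qed
    moreover have "1 / w \<in> U" using w by (simp add: U_def)
    ultimately show ?thesis by (meson interior_maximal subsetD)
  qed
  have "1 / w \<in> interior T \<Longrightarrow> w \<in> interior S"
    using imp[of T S "1 / w"] eq w by (metis div_by_1 divide_divide_eq_right divide_eq_0_iff mult_1 one_neq_zero)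
  then show ?thesis using imp[of S T w] eq w by blast
qed

context quadrant_cone begin

lemma form_nonneg: "v \<in> C \<Longrightarrow> m \<in> dual \<Longrightarrow> l \<in> dual \<Longrightarrow> 0 \<le> form m l v"
  by (simp add: in_C_iff_form)

lemma cross_nonneg:
  assumes "X \<in> R" "Y \<in> R" "m \<in> dual" "l \<in> dual"
  shows "0 \<le> Re (cross m l X Y)"
  using assms dual_Re dual_Im by (auto simp: cross_def intro!: add_nonneg_nonneg)

text \<open>
  The projective line through \<open>x\<close> and \<open>e\<close> in the chart in which \<open>e\<close> is the point at infinity. For
  \<open>e = p x - y\<close> and \<open>w = 1 / (z - p)\<close> the vectors \<open>x + w e\<close> and \<open>z x - y\<close> are proportional. If
  \<open>e \<notin> C\<close>, the slice is a bounded set of the plane, and \<open>w = 0\<close> corresponds to \<open>z = \<infinity>\<close>.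
\<close>

definition slice :: "'a \<Rightarrow> 'a \<Rightarrow> complex set"
  where "slice x e = {w. x + w *\<^sub>C e \<in> C}"

lemma form_line:
  assumes "m \<in> dual" "l \<in> dual"
  shows "form m l (x + w *\<^sub>C e) = (cmod w)\<^sup>2 * form m l e + form m l x + Re (w * cross m l e x)"
  using form_combination[OF dualD dualD, OF assms, of w e 1 x] by (simp add: scaleC_one add.commute)

lemma form_line':
  assumes "m \<in> dual" "l \<in> dual"
  shows "form m l (z *\<^sub>C x + e) = (cmod z)\<^sup>2 * form m l x + form m l e + Re (z * cross m l x e)"
  using form_combination[OF dualD dualD, OF assms, of z x 1 e] by (simp add: scaleC_one)

text \<open>
  Near a zero of \<open>l\<close> that is not a zero of another functional \<open>k\<close>, the quotient \<open>k / l\<close> takes all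
  directions, among them some with \<open>form k l < 0\<close>. Such a \<open>k\<close> exists: if the two functionals
  that show \<open>e \<notin> C\<close> both vanished at that point, then their \<open>form\<close> would be negative all around it.
\<close>

lemma interior_slice_nonvanishing:
  assumes e: "e \<notin> C" and w: "w \<in> interior (slice x e)" and l: "l \<in> dual" and zero: "l (x + w *\<^sub>C e) = 0"
  shows "l e = 0"
proof (rule ccontr)
  assume le: "l e \<noteq> 0"
  define v where "v = x + w *\<^sub>C e"
  obtain \<epsilon> where \<epsilon>: "0 < \<epsilon>" "ball w \<epsilon> \<subseteq> slice x e" using w by (meson mem_interior)
  have near: "v + h *\<^sub>C e \<in> C" if "cmod h < \<epsilon>" for h
  proof -
    have "w + h \<in> slice x e" using that by (intro subsetD[OF \<epsilon>(2)]) (simp add: dist_norm)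
    then show ?thesis by (simp add: slice_def v_def scaleC_add_left add.assoc)
  qed
  obtain m0 l0 where ml: "m0 \<in> dual" "l0 \<in> dual" "form m0 l0 e < 0"
    using e unfolding in_C_iff_form by (meson not_le)
  have "m0 v \<noteq> 0 \<or> l0 v \<noteq> 0"
  proof (rule ccontr)
    assume "\<not> (m0 v \<noteq> 0 \<or> l0 v \<noteq> 0)"
    then have z: "m0 v = 0" "l0 v = 0" by auto
    define h where "h = complex_of_real (\<epsilon> / 2)"
    have "form m0 l0 (v + h *\<^sub>C e) = (cmod h)\<^sup>2 * form m0 l0 e"
      unfolding form_line[OF ml(1,2)] by (simp add: z form_def cross_def)
    also have "\<dots> < 0" using ml(3) \<epsilon>(1) by (auto simp: h_def mult_less_0_iff)
    finally show False using form_nonneg[OF near ml(1,2), of h] \<epsilon>(1) by (simp add: h_def)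
  qed
  then obtain k where k: "k \<in> dual" "k v \<noteq> 0" using ml by auto
  define A where "A = (cmod (k v))\<^sup>2"
  define B where "B = Re (k v / l e * k e * cnj (k v))"
  have A: "0 < A" using k by (simp add: A_def)
  \<comment> \<open>Small enough to stay in the slice and for the term linear in \<open>t\<close> to dominate the quadratic one.\<close>
  define t where "t = min (\<epsilon> / (2 * (1 + cmod (k v / l e)))) (A / (2 * (1 + \<bar>B\<bar>)))"
  have pos: "0 < 1 + cmod (k v / l e)" "0 < 1 + \<bar>B\<bar>" by (simp_all add: add_pos_nonneg)
  have t: "0 < t" unfolding t_def using \<epsilon>(1) A pos by simp
  define h where "h = - of_real t * (k v / l e)"
  have "cmod h = t * cmod (k v / l e)" using t by (simp add: h_def norm_mult norm_divide)
  also have "\<dots> \<le> \<epsilon> / (2 * (1 + cmod (k v / l e))) * cmod (k v / l e)"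
    unfolding t_def by (intro mult_right_mono) auto
  also have "\<dots> < \<epsilon>" using \<epsilon>(1) pos by (simp add: field_simps add_strict_increasing)
  finally have "0 \<le> form k l (v + h *\<^sub>C e)" using near k(1) l by (intro form_nonneg) auto
  also have "form k l (v + h *\<^sub>C e) = - t * A + t\<^sup>2 * B"
  proof -
    have lv: "l (v + h *\<^sub>C e) = h * l e"
      using zero by (simp add: complex_linear_add complex_linear_scale dualD l v_def)
    have kv: "k (v + h *\<^sub>C e) = k v + h * k e" by (simp add: complex_linear_add complex_linear_scale dualD k)
    have "h * l e = - of_real t * k v" using le by (simp add: h_def)
    then have "form k l (v + h *\<^sub>C e) = Re ((k v + h * k e) * cnj (- of_real t * k v))"
      unfolding form_def lv kv by simp
    also have "(k v + h * k e) * cnj (- of_real t * k v)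
      = - of_real t * of_real A + of_real (t\<^sup>2) * (k v / l e * k e * cnj (k v))"
      unfolding A_def complex_norm_square by (simp add: h_def algebra_simps power2_eq_square)
    finally show ?thesis by (simp only: B_def plus_complex.sel minus_complex.sel Re_complex_of_real Im_complex_of_real times_complex.sel uminus_complex.sel)
  qed
  finally have "t * A \<le> t * (t * B)" by (simp add: power2_eq_square algebra_simps)
  then have "A \<le> t * B" using t by simp
  also have "\<dots> \<le> t * (1 + \<bar>B\<bar>)" using t by (intro mult_left_mono) auto
  also have "\<dots> \<le> A / (2 * (1 + \<bar>B\<bar>)) * (1 + \<bar>B\<bar>)" unfolding t_def using pos by (intro mult_right_mono) auto
  also have "\<dots> = A / 2"
  proof -
    have "A / (2 * b) * b = A / 2" if "0 < b" for b :: real using that by simp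
    then show ?thesis using pos(2) .
  qed
  finally show False using A by simp
qed

lemma bounded_slice:
  assumes e: "e \<notin> C"
  shows "bounded (slice x e)"
proof -
  obtain m l where ml: "m \<in> dual" "l \<in> dual" "form m l e < 0"
    using e unfolding in_C_iff_form by (meson not_le)
  define K where "K = max 1 ((cmod (cross m l e x) + \<bar>form m l x\<bar>) / (- form m l e))"
  have "cmod w \<le> K" if w: "w \<in> slice x e" for w
  proof (rule ccontr)
    assume "\<not> cmod w \<le> K"
    then have w1: "1 < cmod w" and w2: "(cmod (cross m l e x) + \<bar>form m l x\<bar>) / (- form m l e) < cmod w"
      unfolding K_def by auto
    have w3: "cmod (cross m l e x) + \<bar>form m l x\<bar> < cmod w * (- form m l e)"
      using w2 ml(3) by (simp only: pos_divide_less_eq[of "- form m l e"] neg_0_less_iff_less)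
    have "form m l (x + w *\<^sub>C e) \<le> (cmod w)\<^sup>2 * form m l e + cmod w * \<bar>form m l x\<bar> + cmod w * cmod (cross m l e x)"
      unfolding form_line[OF ml(1,2)]
    proof (intro add_mono order.refl)
      show "form m l x \<le> cmod w * \<bar>form m l x\<bar>" using w1 mult_right_mono[of 1 "cmod w" "\<bar>form m l x\<bar>"] by auto
      show "Re (w * cross m l e x) \<le> cmod w * cmod (cross m l e x)"
        using complex_Re_le_cmod[of "w * cross m l e x"] by (simp add: norm_mult)
    qed
    also have "\<dots> = cmod w * (cmod (cross m l e x) + \<bar>form m l x\<bar> - cmod w * (- form m l e))"
      by (simp add: power2_eq_square algebra_simps)
    also have "\<dots> < 0" using w1 w3 by (intro mult_pos_neg) auto
    finally show False using form_nonneg[of "x + w *\<^sub>C e", OF _ ml(1,2)] w by (auto simp: slice_def)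
  qed
  then show ?thesis by (auto simp: bounded_iff)
qed

text \<open>
  A linear family of vectors of \<open>C\<close> whose parameter varies in an open set traces an open set in the
  slice, since its chart is an injective Moebius map.
\<close>

lemma Moebius_curve_in_interior:
  fixes a0 a1 b0 b1 :: complex
  assumes e: "e \<notin> C" and V: "open V" and det: "a0 * b1 \<noteq> a1 * b0"
    and inC: "\<And>s. s \<in> V \<Longrightarrow> (a0 + a1 * s) *\<^sub>C x + (b0 + b1 * s) *\<^sub>C e \<in> C"
  shows "\<And>s. s \<in> V \<Longrightarrow> a0 + a1 * s \<noteq> 0"
    and "(\<lambda>s. (b0 + b1 * s) / (a0 + a1 * s)) holomorphic_on V"
    and "(\<lambda>s. (b0 + b1 * s) / (a0 + a1 * s)) ` V \<subseteq> interior (slice x e)"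
proof -
  show nz: "a0 + a1 * s \<noteq> 0" if s: "s \<in> V" for s
  proof
    assume a: "a0 + a1 * s = 0"
    have "b0 + b1 * s \<noteq> 0"
    proof
      assume b: "b0 + b1 * s = 0"
      have "a0 * b1 - a1 * b0 = (a0 + a1 * s) * b1 - a1 * (b0 + b1 * s)" by (simp add: algebra_simps)
      then show False using a b det by simp
    qed
    then show False using inC[OF s] a e C_scale_iff by simp
  qed
  show hol: "(\<lambda>s. (b0 + b1 * s) / (a0 + a1 * s)) holomorphic_on V"
    using nz by (intro holomorphic_intros) auto
  have "inj_on (\<lambda>s. (b0 + b1 * s) / (a0 + a1 * s)) V"
  proof (rule inj_onI)
    fix s t assume st: "s \<in> V" "t \<in> V" "(b0 + b1 * s) / (a0 + a1 * s) = (b0 + b1 * t) / (a0 + a1 * t)"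
    then have "(b0 + b1 * s) * (a0 + a1 * t) = (b0 + b1 * t) * (a0 + a1 * s)"
      using nz by (simp add: frac_eq_eq)
    then have "(a0 * b1 - a1 * b0) * (s - t) = 0" by (simp add: algebra_simps)
    then show "s = t" using det by simp
  qed
  from open_mapping_thm3[OF hol V this]
  have op: "open ((\<lambda>s. (b0 + b1 * s) / (a0 + a1 * s)) ` V)" .
  have "(\<lambda>s. (b0 + b1 * s) / (a0 + a1 * s)) ` V \<subseteq> slice x e"
  proof clarify
    fix s assume s: "s \<in> V"
    have "(1 / (a0 + a1 * s)) *\<^sub>C ((a0 + a1 * s) *\<^sub>C x + (b0 + b1 * s) *\<^sub>C e) \<in> C"
      using inC[OF s] nz[OF s] by (subst C_scale_iff) auto
    then show "(b0 + b1 * s) / (a0 + a1 * s) \<in> slice x e"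
      using nz[OF s] by (simp add: slice_def scaleC_add_right scaleC_scaleC scaleC_one)
  qed
  then show "(\<lambda>s. (b0 + b1 * s) / (a0 + a1 * s)) ` V \<subseteq> interior (slice x e)"
    using op by (rule interior_maximal)
qed

text \<open>
  Openness of the slice at \<open>w2\<close>, seen on the vector of \<open>w2\<close> under perturbations by that of \<open>w1\<close>.
\<close>

lemma interior_slice_nbhd:
  assumes e: "e \<notin> C" and w: "w2 \<in> interior (slice x e)" and c: "c2 \<noteq> 0"
  obtains a where "0 < a" "\<And>z. cmod z \<le> a \<Longrightarrow> c2 *\<^sub>C (x + w2 *\<^sub>C e) + z *\<^sub>C (c1 *\<^sub>C (x + w1 *\<^sub>C e)) \<in> C"
proof -
  define g where "g = (\<lambda>z. (c2 * w2 + z * c1 * w1) / (c2 + z * c1))"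
  have "((\<lambda>z. g z) \<longlongrightarrow> g 0) (at 0)" unfolding g_def using c by (intro tendsto_intros) auto
  then have 1: "\<forall>\<^sub>F z in at 0. g z \<in> interior (slice x e)"
    using w c by (intro topological_tendstoD) (auto simp: g_def)
  have "((\<lambda>z. c2 + z * c1) \<longlongrightarrow> c2 + 0 * c1) (at 0)" by (intro tendsto_intros)
  then have 2: "\<forall>\<^sub>F z in at 0. c2 + z * c1 \<noteq> 0" using c by (intro tendsto_imp_eventually_ne) auto
  obtain d where d: "0 < d" "\<And>z. z \<noteq> 0 \<Longrightarrow> dist z 0 < d \<Longrightarrow> g z \<in> interior (slice x e) \<and> c2 + z * c1 \<noteq> 0"
    using eventually_conj[OF 1 2] unfolding eventually_at by auto
  show thesis
  proof (rule that[of "d / 2"])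
    fix z assume z: "cmod z \<le> d / 2"
    have gz: "g z \<in> interior (slice x e) \<and> c2 + z * c1 \<noteq> 0"
    proof (cases "z = 0")
      case True then show ?thesis using w c by (simp add: g_def)
    next
      case False then show ?thesis using d z by auto
    qed
    then have "x + g z *\<^sub>C e \<in> C" using interior_subset by (auto simp: slice_def)
    then have "(c2 + z * c1) *\<^sub>C (x + g z *\<^sub>C e) \<in> C" using gz by (simp add: C_scale_iff)
    also have "(c2 + z * c1) *\<^sub>C (x + g z *\<^sub>C e) = (c2 + z * c1) *\<^sub>C x + (c2 * w2 + z * c1 * w1) *\<^sub>C e"
      using gz by (simp add: scaleC_add_right scaleC_scaleC g_def)
    also have "\<dots> = c2 *\<^sub>C (x + w2 *\<^sub>C e) + z *\<^sub>C (c1 *\<^sub>C (x + w1 *\<^sub>C e))"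
      by (simp add: scaleC_add_right scaleC_scaleC scaleC_add_left algebra_simps)
    finally show "c2 *\<^sub>C (x + w2 *\<^sub>C e) + z *\<^sub>C (c1 *\<^sub>C (x + w1 *\<^sub>C e)) \<in> C" .
  qed (use d in auto)
qed

text \<open>
  Rotate the vectors of two interior points into \<open>R\<close>. The segment between them lies in \<open>R\<close>, and
  the curve of its points in the slice joins the two given points. The curve stays in the interior because
  complex parameters \<open>\<tau>\<close> close to the segment also yield vectors of \<open>C\<close>: the polar form enters
  with a nonnegative real part on the segment, and away from it the error is at most
  \<open>|Im \<tau>| * cmod (cross m l X Y)\<close>, where the interior point \<open>w2\<close> bounds \<open>cross\<close> by the two
  values of \<open>form\<close>, uniformly in \<open>m\<close> and \<open>l\<close>.
\<close>

lemma connected_interior_slice: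
  assumes e: "e \<notin> C"
  shows "connected (interior (slice x e))"
proof -
  have "\<exists>S. S \<subseteq> interior (slice x e) \<and> connected S \<and> w1 \<in> S \<and> w2 \<in> S"
    if w1: "w1 \<in> interior (slice x e)" and w2: "w2 \<in> interior (slice x e)" for w1 w2
  proof (cases "w1 = w2")
    case True then show ?thesis using w1 by (intro exI[of _ "{w1}"]) auto
  next
    case False
    have inC: "x + w1 *\<^sub>C e \<in> C" "x + w2 *\<^sub>C e \<in> C" using w1 w2 interior_subset by (auto simp: slice_def)
    obtain c1 where c1: "c1 \<noteq> 0" "c1 *\<^sub>C (x + w1 *\<^sub>C e) \<in> R" using C_obtain[OF inC(1)] by metis
    obtain c2 where c2: "c2 \<noteq> 0" "c2 *\<^sub>C (x + w2 *\<^sub>C e) \<in> R" using C_obtain[OF inC(2)] by metis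
    define X where "X = c1 *\<^sub>C (x + w1 *\<^sub>C e)"
    define Y where "Y = c2 *\<^sub>C (x + w2 *\<^sub>C e)"
    obtain a where a: "0 < a" "\<And>z. cmod z \<le> a \<Longrightarrow> Y + z *\<^sub>C X \<in> C"
      using interior_slice_nbhd[OF e w2 c2(1), of c1 w1] unfolding X_def Y_def by metis
    have XC: "X \<in> C" "Y \<in> C" using R_subset_C c1 c2 by (auto simp: X_def Y_def)
    have N: "a * cmod (cross m l X Y) \<le> a\<^sup>2 * form m l X + form m l Y" if m: "m \<in> dual" and l: "l \<in> dual" for m l
    proof -
      \<comment> \<open>The direction in which the polar form is most negative.\<close>
      define z where "z = - of_real a * cnj (sgn (cross m l X Y))"
      have za: "cmod z \<le> a" using a(1) by (simp add: z_def norm_mult norm_sgn)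
      have "0 \<le> form m l (Y + z *\<^sub>C X)" by (rule form_nonneg[OF a(2)[OF za] m l])
      also have "\<dots> = (cmod z)\<^sup>2 * form m l X + form m l Y + Re (z * cross m l X Y)"
        using form_line'[OF m l, of z X Y] by (simp add: add.commute)
      also have "z * cross m l X Y = - of_real (a * cmod (cross m l X Y))"
      proof -
        have "cnj (sgn u) * u = of_real (cmod u)" for u :: complex
          by (cases "u = 0") (auto simp: sgn_eq complex_norm_square[symmetric] mult.commute[of _ u] power2_eq_square)
        then show ?thesis by (simp add: z_def)
      qed
      also have "(cmod z)\<^sup>2 * form m l X \<le> a\<^sup>2 * form m l X"
        using za form_nonneg[OF XC(1) m l] by (intro mult_right_mono power_mono) auto
      finally show ?thesis by simp
    qed
    \<comment> \<open>The conditions are open and hold for real \<open>\<tau>\<close> strictly between \<open>0\<close> and \<open>1\<close>.\<close>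
    define V where "V = {\<tau>. (cmod \<tau>)\<^sup>2 < Re \<tau> \<and> \<bar>Im \<tau>\<bar> * a < (cmod (1 - \<tau>))\<^sup>2 \<and> \<bar>Im \<tau>\<bar> < a * (cmod \<tau>)\<^sup>2}"
    have "open V" unfolding V_def by (intro open_Collect_conj open_Collect_less continuous_intros)
    have VC: "(1 - \<tau>) *\<^sub>C X + \<tau> *\<^sub>C Y \<in> C" if \<tau>: "\<tau> \<in> V" for \<tau>
      unfolding in_C_iff_form
    proof (intro ballI)
      fix m l assume m: "m \<in> dual" and l: "l \<in> dual"
      define N where "N = cross m l X Y"
      have PX: "0 \<le> form m l X" and PY: "0 \<le> form m l Y" using XC m l by (auto intro: form_nonneg)
      have ReN: "0 \<le> Re N" unfolding N_def using c1 c2 m l by (intro cross_nonneg) (auto simp: X_def Y_def)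
      have "Re ((1 - \<tau>) * cnj \<tau> * N) = (Re \<tau> - (cmod \<tau>)\<^sup>2) * Re N + Im \<tau> * Im N"
        unfolding cmod_power2 by (simp add: algebra_simps power2_eq_square)
      moreover have "0 \<le> (Re \<tau> - (cmod \<tau>)\<^sup>2) * Re N" using \<tau> ReN by (simp add: V_def)
      moreover have "- (\<bar>Im \<tau>\<bar> * cmod N) \<le> Im \<tau> * Im N"
      proof -
        have "\<bar>Im \<tau> * Im N\<bar> \<le> \<bar>Im \<tau>\<bar> * cmod N" unfolding abs_mult by (intro mult_left_mono abs_Im_le_cmod) auto
        then show ?thesis by linarith
      qed
      moreover have "\<bar>Im \<tau>\<bar> * cmod N \<le> (cmod (1 - \<tau>))\<^sup>2 * form m l X + (cmod \<tau>)\<^sup>2 * form m l Y"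
      proof -
        have "a * (\<bar>Im \<tau>\<bar> * cmod N) \<le> \<bar>Im \<tau>\<bar> * (a\<^sup>2 * form m l X + form m l Y)"
          using mult_left_mono[OF N[OF m l], of "\<bar>Im \<tau>\<bar>"] by (simp add: N_def mult.left_commute)
        also have "\<dots> = a * ((\<bar>Im \<tau>\<bar> * a) * form m l X) + \<bar>Im \<tau>\<bar> * form m l Y"
          by (simp add: algebra_simps power2_eq_square)
        also have "\<dots> \<le> a * ((cmod (1 - \<tau>))\<^sup>2 * form m l X) + (a * (cmod \<tau>)\<^sup>2) * form m l Y"
          using \<tau> PX PY a(1) by (intro add_mono mult_left_mono mult_right_mono) (auto simp: V_def)
        also have "\<dots> = a * ((cmod (1 - \<tau>))\<^sup>2 * form m l X + (cmod \<tau>)\<^sup>2 * form m l Y)"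
          by (simp add: algebra_simps)
        finally show ?thesis using a(1) by simp
      qed
      ultimately show "0 \<le> form m l ((1 - \<tau>) *\<^sub>C X + \<tau> *\<^sub>C Y)"
        unfolding form_combination[OF dualD[OF m] dualD[OF l]] N_def[symmetric] by linarith
    qed
    define A where "A = (\<lambda>\<tau>. c1 + (c2 - c1) * \<tau>)"
    define B where "B = (\<lambda>\<tau>. c1 * w1 + (c2 * w2 - c1 * w1) * \<tau>)"
    have AB: "A \<tau> *\<^sub>C x + B \<tau> *\<^sub>C e = (1 - \<tau>) *\<^sub>C X + \<tau> *\<^sub>C Y" for \<tau>
      by (simp add: A_def B_def X_def Y_def scaleC_add_right scaleC_add_left scaleC_diff_left scaleC_scaleC algebra_simps)
    have det: "c1 * (c2 * w2 - c1 * w1) \<noteq> (c2 - c1) * (c1 * w1)"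
    proof
      assume "c1 * (c2 * w2 - c1 * w1) = (c2 - c1) * (c1 * w1)"
      then have "c1 * c2 * (w2 - w1) = 0" by (simp add: algebra_simps)
      then show False using c1 c2 False by simp
    qed
    have lineC: "(c1 + (c2 - c1) * s) *\<^sub>C x + (c1 * w1 + (c2 * w2 - c1 * w1) * s) *\<^sub>C e \<in> C" if "s \<in> V" for s
      using VC[OF that] AB[of s] by (simp add: A_def B_def)
    have curve_nz: "A s \<noteq> 0" if "s \<in> V" for s
      unfolding A_def by (rule Moebius_curve_in_interior(1)[OF e \<open>open V\<close> det lineC that])
    have curve_in: "B s / A s \<in> interior (slice x e)" if "s \<in> V" for s
      unfolding A_def B_def using Moebius_curve_in_interior(3)[OF e \<open>open V\<close> det lineC] that by blast
    have real: "of_real t \<in> V" if "0 < t" "t < 1" for t :: real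
    proof -
      have "t\<^sup>2 < t" using that by (simp add: power2_eq_square)
      moreover have "complex_of_real t \<noteq> 1" using that by (metis less_irrefl of_real_eq_1_iff)
      ultimately show ?thesis using that a(1) by (auto simp: V_def)
    qed
    have A0: "A (of_real t) \<noteq> 0" if "0 \<le> t" "t \<le> 1" for t :: real
    proof -
      consider "t = 0" | "t = 1" | "0 < t" "t < 1" using \<open>0 \<le> t\<close> \<open>t \<le> 1\<close> by linarith
      then show ?thesis
      proof cases
        case 1 then show ?thesis using c1 by (simp add: A_def)
      next
        case 2 then show ?thesis using c2 by (simp add: A_def)
      next
        case 3 then show ?thesis using curve_nz[OF real] by blast
      qed
    qed
    define S where "S = (\<lambda>t. B (of_real t) / A (of_real t)) ` {0..1::real}"
    have "connected S" unfolding S_def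
      using A0 by (intro connected_continuous_image continuous_on_divide)
        (auto simp: A_def B_def intro!: continuous_intros)
    moreover have e0: "B (of_real 0) / A (of_real 0) = w1" "B (of_real 1) / A (of_real 1) = w2"
      using c1 c2 by (simp_all add: A_def B_def)
    moreover have "S \<subseteq> interior (slice x e)" unfolding S_def
    proof clarify
      fix t :: real assume t: "t \<in> {0..1}"
      consider "t = 0" | "t = 1" | "0 < t" "t < 1" using t by fastforce
      then show "B (of_real t) / A (of_real t) \<in> interior (slice x e)"
      proof cases
        case 3 then show ?thesis using curve_in real by blast
      qed (use e0 w1 w2 in auto)
    qed
    moreover have "w1 \<in> S" unfolding S_def by (rule image_eqI[of _ _ 0]) (simp_all only: e0, simp)
    moreover have "w2 \<in> S" unfolding S_def by (rule image_eqI[of _ _ 1]) (simp_all only: e0, simp)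
    ultimately show ?thesis by blast
  qed
  then show ?thesis by (rule connected_if_joined)
qed

end


lemma connected_delete_interior_point:
  fixes p :: complex
  assumes F: "connected F" and p: "p \<in> interior F"
  shows "connected (F - {p})"
proof (rule ccontr)
  assume "\<not> connected (F - {p})"
  then obtain A B where AB: "open A" "open B" "F - {p} \<subseteq> A \<union> B" "A \<inter> B \<inter> (F - {p}) = {}"
      "A \<inter> (F - {p}) \<noteq> {}" "B \<inter> (F - {p}) \<noteq> {}"
    unfolding connected_def by blast
  obtain r where r: "0 < r" "ball p r \<subseteq> F" using p by (meson mem_interior)
  have no: False if AB: "open A" "open B" "F - {p} \<subseteq> A \<union> B" "A \<inter> B \<inter> (F - {p}) = {}"
      "A \<inter> (F - {p}) \<noteq> {}" "B \<inter> (F - {p}) \<noteq> {}" and disj: "B \<inter> (ball p r - {p}) = {}" for A B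
  proof -
    have "F \<subseteq> (A \<union> ball p r) \<union> (B - {p})" using AB(3) r(1) by auto
    moreover have "(A \<union> ball p r) \<inter> (B - {p}) \<inter> F = {}" using AB(4) disj by auto
    moreover have "(A \<union> ball p r) \<inter> F \<noteq> {}" "(B - {p}) \<inter> F \<noteq> {}" using AB(5,6) by auto
    moreover have "open (A \<union> ball p r)" "open (B - {p})" using AB(1,2) by (auto intro: open_delete)
    ultimately show False using F unfolding connected_def by blast
  qed
  have con: "connected (ball p r - {p})" by (rule connected_punctured_ball) auto
  have "A \<inter> (ball p r - {p}) = {} \<or> B \<inter> (ball p r - {p}) = {}"
    using connectedD[OF con AB(1,2)] AB(3,4) r(2) by blast
  then show False
  proof
    assume "B \<inter> (ball p r - {p}) = {}" then show False using no[OF AB] by simp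
  next
    assume "A \<inter> (ball p r - {p}) = {}" then show False using no[of B A] AB by blast
  qed
qed

context quadrant_cone begin

text \<open>
  After a rotation of \<open>v\<close> into \<open>R\<close>, two points of the first quadrant are added.
\<close>

lemma dual_sum_nonzero:
  assumes v: "v \<in> C" and g: "g1 \<in> dual" "g2 \<in> dual" and nz: "g1 v \<noteq> 0"
  shows "g1 v + g2 v \<noteq> 0"
proof
  assume z: "g1 v + g2 v = 0"
  obtain c where c: "c \<noteq> 0" "c *\<^sub>C v \<in> R" using C_obtain[OF v] by metis
  have "g1 (c *\<^sub>C v) + g2 (c *\<^sub>C v) = c * (g1 v + g2 v)"
    using g by (simp add: complex_linear_scale dualD algebra_simps)
  then have "g1 (c *\<^sub>C v) + g2 (c *\<^sub>C v) = 0" using z by simp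
  then have "Re (g1 (c *\<^sub>C v)) + Re (g2 (c *\<^sub>C v)) = 0" "Im (g1 (c *\<^sub>C v)) + Im (g2 (c *\<^sub>C v)) = 0"
    by (simp_all add: complex_eq_iff)
  then have "g1 (c *\<^sub>C v) = 0"
    using dual_Re[OF g(1) c(2)] dual_Re[OF g(2) c(2)] dual_Im[OF g(1) c(2)] dual_Im[OF g(2) c(2)]
    by (simp add: complex_eq_iff)
  then show False using c nz g by (simp add: complex_linear_scale dualD)
qed

text \<open>
  Invert the plane, so that the slice becomes a neighbourhood of infinity and \<open>0\<close> stands for \<open>e\<close>.
  The inverted complement of the slice is a union \<open>E\<close> of sets \<open>D m l\<close>, which are convex since
  \<open>form m l x \<ge> 0\<close>. Let \<open>\<alpha> g\<close> denote the zero of \<open>g\<close>. A nonempty \<open>D m l\<close> contains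
  \<open>\<alpha> (m + l)\<close>, where the quotient \<open>m / l\<close> is \<open>-1\<close>. The set \<open>A\<close> of all zeros is connected because
  \<open>dual\<close> is convex, and it lies in the closure of \<open>E\<close> by \<open>interior_slice_nonvanishing\<close>. So this
  closure is connected, also without its interior point \<open>0\<close>, and it remains to invert again.
\<close>

lemma connected_complement_interior_slice:
  assumes e: "e \<notin> C" and x: "0 \<in> interior (slice x e)"
  shows "connected (- interior (slice x e))"
proof -
  define D where "D = (\<lambda>m l. {z. form m l (z *\<^sub>C x + e) < 0})"
  define E where "E = {z. z *\<^sub>C x + e \<notin> C}"
  define \<alpha> where "\<alpha> = (\<lambda>g :: 'a \<Rightarrow> complex. - g e / g x)"
  define A where "A = \<alpha> ` {g \<in> dual. g x \<noteq> 0}"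
  have xC: "x \<in> C" using x interior_subset by (force simp: slice_def)
  have E_eq: "E = (\<Union>(m, l)\<in>dual \<times> dual. D m l)"
    unfolding E_def D_def in_C_iff_form by (auto simp: not_le)
  have Dform: "D m l = {z. (cmod z)\<^sup>2 * form m l x + form m l e + Re (z * cross m l x e) < 0}"
    if "m \<in> dual" "l \<in> dual" for m l
    unfolding D_def form_line'[OF that] ..
  have D_open: "open (D m l)" if "m \<in> dual" "l \<in> dual" for m l
    unfolding Dform[OF that] by (intro open_Collect_less continuous_intros)
  have D_conn: "connected (D m l)" if ml: "m \<in> dual" "l \<in> dual" for m l
  proof (rule convex_connected, unfold convex_alt, clarify)
    fix z1 z2 and u :: real assume z: "z1 \<in> D m l" "z2 \<in> D m l" and u: "0 \<le> u" "u \<le> 1"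
    define f where "f = (\<lambda>z. (cmod z)\<^sup>2 * form m l x + form m l e + Re (z * cross m l x e))"
    have fz: "f z1 < 0" "f z2 < 0" using z unfolding Dform[OF ml] f_def by auto
    have "f ((1 - u) *\<^sub>R z1 + u *\<^sub>R z2)
      = (1 - u) * f z1 + u * f z2 - u * (1 - u) * (cmod (z1 - z2))\<^sup>2 * form m l x"
      unfolding f_def cmod_power2 by (simp add: power2_eq_square algebra_simps)
    also have "\<dots> \<le> (1 - u) * f z1 + u * f z2" using u form_nonneg[OF xC ml] by simp
    also have "\<dots> < 0"
    proof (cases "u = 0")
      case False
      then have "(1 - u) * f z1 \<le> 0" "u * f z2 < 0" using u fz by (auto simp: mult_nonneg_nonpos mult_pos_neg)
      then show ?thesis by linarith
    qed (use fz in simp)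
    finally show "(1 - u) *\<^sub>R z1 + u *\<^sub>R z2 \<in> D m l" unfolding Dform[OF ml] f_def by simp
  qed
  have van: "g e = 0" if g: "g \<in> dual" "g x = 0" for g
    using interior_slice_nonvanishing[OF e x g(1)] g(2) by simp
  have A_conn: "connected A"
  proof -
    have "\<exists>S. S \<subseteq> A \<and> connected S \<and> a \<in> S \<and> b \<in> S" if ab: "a \<in> A" "b \<in> A" for a b
    proof -
      obtain g1 g2 where g: "g1 \<in> dual" "g1 x \<noteq> 0" "a = \<alpha> g1" "g2 \<in> dual" "g2 x \<noteq> 0" "b = \<alpha> g2"
        using ab unfolding A_def by auto
      define G where "G = (\<lambda>s::real. \<lambda>v. of_real (1 - s) * g1 v + of_real s * g2 v)"
      have Gd: "G s \<in> dual" if "0 \<le> s" "s \<le> 1" for s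
        unfolding G_def using that g by (intro dual_add dual_scale) auto
      have Gx: "G s x \<noteq> 0" if s: "0 \<le> s" "s \<le> 1" for s
      proof (cases "s = 1")
        case True then show ?thesis using g by (simp add: G_def)
      next
        case False
        then have "complex_of_real (1 - s) * g1 x \<noteq> 0" using g by (simp del: of_real_diff)
        then show ?thesis unfolding G_def
          using s dual_sum_nonzero[OF xC dual_scale[OF g(1), of "1 - s"] dual_scale[OF g(4), of s]] by simp
      qed
      have "continuous_on {0..1} (\<lambda>s. - G s e)" "continuous_on {0..1} (\<lambda>s. G s x)"
        unfolding G_def by (intro continuous_intros)+
      then have "continuous_on {0..1} (\<lambda>s. \<alpha> (G s))"
        unfolding \<alpha>_def by (rule continuous_on_divide) (use Gx in simp)
      then have "connected ((\<lambda>s. \<alpha> (G s)) ` {0..1})"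
        by (rule connected_continuous_image) simp
      moreover have "(\<lambda>s. \<alpha> (G s)) ` {0..1} \<subseteq> A" unfolding A_def using Gd Gx by auto
      moreover have "a \<in> (\<lambda>s. \<alpha> (G s)) ` {0..1}"
        by (rule image_eqI[of _ _ 0]) (use g in \<open>simp_all add: G_def\<close>)
      moreover have "b \<in> (\<lambda>s. \<alpha> (G s)) ` {0..1}"
        by (rule image_eqI[of _ _ 1]) (use g in \<open>simp_all add: G_def\<close>)
      ultimately show ?thesis by blast
    qed
    then show ?thesis by (rule connected_if_joined)
  qed
  have meet: "\<alpha> (\<lambda>v. m v + l v) \<in> D m l \<inter> A" if ml: "m \<in> dual" "l \<in> dual" and ne: "D m l \<noteq> {}" for m l
  proof -
    obtain z where z: "form m l (z *\<^sub>C x + e) < 0" using ne by (auto simp: D_def)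
    have lin: "m (a *\<^sub>C x + e) = a * m x + m e" "l (a *\<^sub>C x + e) = a * l x + l e" for a
      using ml by (simp_all add: complex_linear_add complex_linear_scale dualD)
    have "m x \<noteq> 0"
    proof
      assume "m x = 0"
      then have "m (z *\<^sub>C x + e) = 0" using van[OF ml(1)] by (simp add: lin)
      then show False using z by (simp add: form_def)
    qed
    then have nz: "m x + l x \<noteq> 0" using dual_sum_nonzero[OF xC ml] by simp
    define a where "a = \<alpha> (\<lambda>v. m v + l v)"
    define v where "v = a *\<^sub>C x + e"
    have a: "a * (m x + l x) = - (m e + l e)" using nz by (simp add: a_def \<alpha>_def)
    have mv: "m v = - l v" unfolding v_def lin using a by (simp add: algebra_simps eq_neg_iff_add_eq_0)
    have "l v \<noteq> 0"
    proof
      assume lv: "l v = 0"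
      have "z *\<^sub>C x + e = (z - a) *\<^sub>C x + 1 *\<^sub>C v"
        by (simp add: v_def scaleC_diff_left scaleC_one)
      then have "form m l (z *\<^sub>C x + e) = (cmod (z - a))\<^sup>2 * form m l x"
        using form_combination[OF dualD dualD, OF ml, of "z - a" x 1 v] mv lv by (simp add: form_def cross_def)
      also have "\<dots> \<ge> 0" using form_nonneg[OF xC ml] by simp
      finally show False using z by simp
    qed
    moreover have "form m l v = - (cmod (l v))\<^sup>2"
      unfolding form_def mv by (simp add: complex_norm_square[symmetric] flip: of_real_power)
    ultimately have "form m l v < 0" by simp
    then have "a \<in> D m l" by (simp add: D_def v_def)
    moreover have "a \<in> A" unfolding A_def a_def using dual_add[OF ml] nz by auto
    ultimately show ?thesis by (simp add: a_def)
  qed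
  have zeroE: "0 \<in> E" using e by (simp add: E_def)
  have AE_conn: "connected (A \<union> E)"
  proof -
    define \<U> where "\<U> = {A \<union> D m l |m l. m \<in> dual \<and> l \<in> dual \<and> D m l \<noteq> {}}"
    obtain m0 l0 where 0: "m0 \<in> dual" "l0 \<in> dual" "0 \<in> D m0 l0" using zeroE E_eq by auto
    then obtain a where a: "a \<in> A" using meet by blast
    have "connected (\<Union>\<U>)"
    proof (rule connected_Union)
      show "connected S" if "S \<in> \<U>" for S
        using that meet unfolding \<U>_def by (auto intro!: connected_Un A_conn D_conn)
      show "\<Inter>\<U> \<noteq> {}" using a unfolding \<U>_def by auto
    qed
    moreover have "\<Union>\<U> = A \<union> E" unfolding \<U>_def E_eq using 0 by auto
    ultimately show ?thesis by simp
  qed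
  have inv: "w \<in> interior (slice x e) \<longleftrightarrow> 1 / w \<in> interior (- E)" if "w \<noteq> 0" for w
  proof (rule inversion_interior[OF _ that])
    fix w :: complex assume w: "w \<noteq> 0"
    have "x + w *\<^sub>C e = w *\<^sub>C ((1 / w) *\<^sub>C x + e)" using w by (simp add: scaleC_add_right scaleC_scaleC scaleC_one)
    then show "w \<in> slice x e \<longleftrightarrow> 1 / w \<in> - E" using C_scale_iff[OF w] by (simp add: slice_def E_def)
  qed
  have A_sub: "A \<subseteq> closure E"
  proof
    fix a assume "a \<in> A"
    then obtain g where g: "g \<in> dual" "g x \<noteq> 0" "a = - g e / g x" unfolding A_def \<alpha>_def by auto
    show "a \<in> closure E"
    proof (rule ccontr)
      assume na: "a \<notin> closure E"
      then have a0: "a \<noteq> 0" using zeroE closure_subset by auto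
      then have "1 / a \<in> interior (slice x e)" using inv[of "1 / a"] na by (simp add: interior_complement)
      moreover have "g (x + (1 / a) *\<^sub>C e) = 0"
        using g a0 by (auto simp: complex_linear_add complex_linear_scale dualD)
      ultimately have "g e = 0" using interior_slice_nonvanishing[OF e _ g(1)] by blast
      then show False using a0 g by simp
    qed
  qed
  have F: "connected (closure E)"
    by (rule connected_intermediate_closure[OF AE_conn]) (use A_sub closure_subset in \<open>auto intro: closure_mono[THEN subsetD]\<close>)
  have "open E" unfolding E_eq using D_open by auto
  then have "0 \<in> interior (closure E)" using zeroE closure_subset interior_maximal by blast
  from connected_delete_interior_point[OF F this]
  have "connected ((\<lambda>z. 1 / z) ` (closure E - {0}))"
    by (intro connected_continuous_image continuous_intros) auto
  also have "(\<lambda>z. 1 / z) ` (closure E - {0}) = - interior (slice x e)"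
  proof (intro equalityI subsetI)
    fix w assume "w \<in> (\<lambda>z. 1 / z) ` (closure E - {0})"
    then show "w \<in> - interior (slice x e)" using inv[of w] by (auto simp: interior_complement)
  next
    fix w assume w: "w \<in> - interior (slice x e)"
    then have "w \<noteq> 0" using x by auto
    moreover from this have "1 / w \<in> closure E" using inv[of w] w by (auto simp: interior_complement)
    ultimately show "w \<in> (\<lambda>z. 1 / z) ` (closure E - {0})" by (intro image_eqI[of _ _ "1 / w"]) auto
  qed
  finally show ?thesis .
qed

text \<open>
  The interior of the slice is bounded and it is connected together with its complement, so it is
  simply connected.
\<close>

lemma slice_Riemann_map:
  assumes e: "e \<notin> C" and x: "0 \<in> interior (slice x e)"
  obtains f g where "f holomorphic_on interior (slice x e)" "g holomorphic_on ball 0 1"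
    "\<And>w. w \<in> interior (slice x e) \<Longrightarrow> f w \<in> ball 0 1" "\<And>w. w \<in> interior (slice x e) \<Longrightarrow> g (f w) = w"
    "\<And>z. z \<in> ball 0 1 \<Longrightarrow> g z \<in> interior (slice x e)" "\<And>z. z \<in> ball 0 1 \<Longrightarrow> f (g z) = z"
proof -
  have bd: "bounded (interior (slice x e))" using bounded_slice[OF e] interior_subset bounded_subset by blast
  have "simply_connected (interior (slice x e))"
    using simply_connected_iff_simple[OF open_interior bd] connected_interior_slice[OF e]
      connected_complement_interior_slice[OF e x] by blast
  moreover have "interior (slice x e) \<noteq> UNIV" using bd by (metis not_bounded_UNIV)
  ultimately show thesis
    using x that simply_connected_eq_biholomorphic_to_disc[of "interior (slice x e)"] by (metis empty_iff open_interior)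
qed

end

section \<open>Slices and the Riemann sphere\<close>

text \<open>
  The coordinate \<open>w = 1 / (z - p)\<close> of the sphere without the point \<open>p\<close>, in which \<open>\<infinity>\<close> is \<open>0\<close>. At
  \<open>p\<close> itself the value is \<open>1 / 0 = 0\<close>, so this point has to be excluded separately.
\<close>

definition chart :: "complex \<Rightarrow> complex option \<Rightarrow> complex"
  where "chart p q = (case q of None \<Rightarrow> 0 | Some z \<Rightarrow> 1 / (z - p))"

definition inv_chart :: "complex \<Rightarrow> complex \<Rightarrow> complex option"
  where "inv_chart p w = (if w = 0 then None else Some (p + 1 / w))"

lemma inv_chart_chart: "q \<noteq> Some p \<Longrightarrow> inv_chart p (chart p q) = q"
  by (auto simp: inv_chart_def chart_def split: option.splits)

lemma chart_inv_chart: "chart p (inv_chart p w) = w"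
  by (auto simp: inv_chart_def chart_def)

lemma inv_chart_avoids: "inv_chart p w \<noteq> Some p"
  by (auto simp: inv_chart_def)

lemma chart_holomorphic:
  assumes F: "sphere_holomorphic_on F S" and p: "\<And>\<xi>. \<xi> \<in> S \<Longrightarrow> F \<xi> \<noteq> Some p"
  shows "(\<lambda>\<xi>. chart p (F \<xi>)) holomorphic_on S"
  unfolding holomorphic_on_def
proof
  fix \<xi> assume "\<xi> \<in> S"
  then obtain U g where U: "open U" "\<xi> \<in> U" "U \<subseteq> S" and g: "g holomorphic_on U"
    and alt: "(\<forall>w\<in>U. F w = Some (g w)) \<or> (\<forall>w\<in>U. F w = sphere_inverse (g w))"
    using F unfolding sphere_holomorphic_on_def by metis
  have "(\<lambda>\<xi>. chart p (F \<xi>)) holomorphic_on U"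
    using alt
  proof
    assume a: "\<forall>w\<in>U. F w = Some (g w)"
    have "g w - p \<noteq> 0" if "w \<in> U" for w using p[of w] a that U(3) by auto
    then have "(\<lambda>w. 1 / (g w - p)) holomorphic_on U" using g by (intro holomorphic_intros) auto
    then show ?thesis by (rule holomorphic_transform) (use a in \<open>simp add: chart_def\<close>)
  next
    assume a: "\<forall>w\<in>U. F w = sphere_inverse (g w)"
    have nz: "1 - p * g w \<noteq> 0" if w: "w \<in> U" for w
    proof
      assume z: "1 - p * g w = 0"
      then have "g w \<noteq> 0" by auto
      then have "1 / g w = p" using z by (simp add: field_simps)
      then show False using p[of w] a w U(3) \<open>g w \<noteq> 0\<close> by (auto simp: sphere_inverse_def)
    qed
    then have "(\<lambda>w. g w / (1 - p * g w)) holomorphic_on U" using g by (intro holomorphic_intros) auto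
    then show ?thesis
    proof (rule holomorphic_transform)
      fix w assume w: "w \<in> U"
      show "g w / (1 - p * g w) = chart p (F w)"
        using a w nz[OF w] by (auto simp: chart_def sphere_inverse_def field_simps)
    qed
  qed
  then show "(\<lambda>\<xi>. chart p (F \<xi>)) field_differentiable at \<xi> within S"
    using holomorphic_on_imp_differentiable_at U field_differentiable_at_within by blast
qed

lemma inv_chart_holomorphic:
  assumes g: "g holomorphic_on S" and S: "open S"
  shows "sphere_holomorphic_on (\<lambda>\<xi>. inv_chart p (g \<xi>)) S"
  unfolding sphere_holomorphic_on_def
proof
  fix \<xi> assume \<xi>: "\<xi> \<in> S"
  have cont: "continuous_on S g" by (rule holomorphic_on_imp_continuous_on[OF g])
  have op: "open {w \<in> S. h w \<noteq> 0}" if "continuous_on S h" for h :: "complex \<Rightarrow> complex"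
  proof -
    have "open (h -` (- {0}) \<inter> S)" using that S continuous_on_open_vimage by blast
    also have "h -` (- {0}) \<inter> S = {w \<in> S. h w \<noteq> 0}" by auto
    finally show ?thesis .
  qed
  show "\<exists>U G. open U \<and> \<xi> \<in> U \<and> U \<subseteq> S \<and> G holomorphic_on U \<and>
    ((\<forall>w\<in>U. inv_chart p (g w) = Some (G w)) \<or> (\<forall>w\<in>U. inv_chart p (g w) = sphere_inverse (G w)))"
  proof (cases "g \<xi> = 0")
    case False
    have "(\<lambda>w. p + 1 / g w) holomorphic_on {w \<in> S. g w \<noteq> 0}"
      using g by (intro holomorphic_intros) (auto intro: holomorphic_on_subset)
    then show ?thesis using False \<xi> op[OF cont]
      by (intro exI[of _ "{w \<in> S. g w \<noteq> 0}"] exI[of _ "\<lambda>w. p + 1 / g w"]) (auto simp: inv_chart_def)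
  next
    case True
    have "(\<lambda>w. g w / (1 + p * g w)) holomorphic_on {w \<in> S. 1 + p * g w \<noteq> 0}"
      using g by (intro holomorphic_intros) (auto intro: holomorphic_on_subset)
    moreover have "open {w \<in> S. 1 + p * g w \<noteq> 0}" using cont by (intro op continuous_intros)
    moreover have "inv_chart p (g w) = sphere_inverse (g w / (1 + p * g w))" if "1 + p * g w \<noteq> 0" for w
      using that by (auto simp: inv_chart_def sphere_inverse_def field_simps)
    ultimately show ?thesis using True \<xi>
      by (intro exI[of _ "{w \<in> S. 1 + p * g w \<noteq> 0}"] exI[of _ "\<lambda>w. g w / (1 + p * g w)"]) auto
  qed
qed

lemma cone_L_interior_mono:
  assumes "\<And>z. z *\<^sub>C x - y \<in> C \<Longrightarrow> z *\<^sub>C x' - y' \<in> C'"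
  shows "cone_L_interior C x y \<subseteq> cone_L_interior C' x' y'"
  unfolding cone_L_interior_def cone_L_def using assms by (intro interior_of_mono) auto

context quadrant_cone begin

lemma Some_in_cone_L_interior: "Some z \<in> cone_L_interior C x y \<longleftrightarrow> z \<in> interior {z. z *\<^sub>C x - y \<in> C}"
proof
  assume "Some z \<in> cone_L_interior C x y"
  then obtain T where T: "openin riemann_sphere T" "Some z \<in> T" "T \<subseteq> cone_L C x y"
    unfolding cone_L_interior_def interior_of_def by auto
  from T(1) consider U where "open U" "T = Some ` U" | K where "closed K" "T = insert None (Some ` (- K))"
    unfolding openin_Alexandroff_compactification by (auto simp: Compl_eq_Diff_UNIV)
  then show "z \<in> interior {z. z *\<^sub>C x - y \<in> C}"
  proof cases
    case 1 then show ?thesis using T by (intro interiorI[of U]) (auto simp: cone_L_def)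
  next
    case 2 then show ?thesis using T by (intro interiorI[of "- K"]) (auto simp: cone_L_def)
  qed
next
  assume z: "z \<in> interior {z. z *\<^sub>C x - y \<in> C}"
  have "openin riemann_sphere (Some ` interior {z. z *\<^sub>C x - y \<in> C})" by simp
  moreover have "Some ` interior {z. z *\<^sub>C x - y \<in> C} \<subseteq> cone_L C x y"
    unfolding cone_L_def using interior_subset[of "{z. z *\<^sub>C x - y \<in> C}"] by auto
  ultimately show "Some z \<in> cone_L_interior C x y"
    unfolding cone_L_interior_def interior_of_def using z by blast
qed

lemma None_in_cone_L_interior:
  "None \<in> cone_L_interior C x y \<longleftrightarrow> (\<exists>r. \<forall>z. r < cmod z \<longrightarrow> z *\<^sub>C x - y \<in> C)"
proof
  assume "None \<in> cone_L_interior C x y"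
  then obtain T where T: "openin riemann_sphere T" "None \<in> T" "T \<subseteq> cone_L C x y"
    unfolding cone_L_interior_def interior_of_def by auto
  then obtain K where K: "compact K" "T = insert None (Some ` (- K))"
    unfolding openin_Alexandroff_compactification by (auto simp: Compl_eq_Diff_UNIV)
  obtain r where r: "\<And>z. z \<in> K \<Longrightarrow> cmod z \<le> r" using compact_imp_bounded[OF K(1)] by (auto simp: bounded_iff)
  have "z *\<^sub>C x - y \<in> C" if "r < cmod z" for z
  proof -
    have "z \<notin> K" using r[of z] that by auto
    then have "Some z \<in> T" using K(2) by auto
    then show ?thesis using T(3) by (auto simp: cone_L_def)
  qed
  then show "\<exists>r. \<forall>z. r < cmod z \<longrightarrow> z *\<^sub>C x - y \<in> C" by blast
next
  assume "\<exists>r. \<forall>z. r < cmod z \<longrightarrow> z *\<^sub>C x - y \<in> C"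
  then obtain r where r: "\<And>z. r < cmod z \<Longrightarrow> z *\<^sub>C x - y \<in> C" by auto
  have "openin riemann_sphere (insert None (Some ` (topspace euclidean - cball 0 r)))"
    unfolding openin_Alexandroff_compactification by (metis closed_cball closed_closedin compact_cball compactin_euclidean_iff)
  moreover have "insert None (Some ` (topspace euclidean - cball 0 r)) \<subseteq> cone_L C x y"
    using r by (auto simp: cone_L_def not_le)
  ultimately show "None \<in> cone_L_interior C x y"
    unfolding cone_L_interior_def interior_of_def by blast
qed

lemma cone_L_interior_iff:
  assumes e: "p *\<^sub>C x - y \<notin> C" and x: "x \<in> C"
  shows "q \<in> cone_L_interior C x y \<longleftrightarrow> q \<noteq> Some p \<and> chart p q \<in> interior (slice x (p *\<^sub>C x - y))"
proof -
  define e where "e = p *\<^sub>C x - y"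
  have shift: "z *\<^sub>C x - y = (z - p) *\<^sub>C x + e" for z by (simp add: e_def scaleC_diff_left)
  have inv: "w \<in> slice x e \<longleftrightarrow> (1 / w) *\<^sub>C x + e \<in> C" if "w \<noteq> 0" for w
  proof -
    have "x + w *\<^sub>C e = w *\<^sub>C ((1 / w) *\<^sub>C x + e)" using that by (simp add: scaleC_add_right scaleC_scaleC scaleC_one)
    then show ?thesis using C_scale_iff[OF that] by (simp add: slice_def)
  qed
  show ?thesis
  proof (cases q)
    case (Some z)
    have "{z. z *\<^sub>C x - y \<in> C} = (\<lambda>u. p + u) ` {u. u *\<^sub>C x + e \<in> C}"
      unfolding shift by (auto intro: image_eqI[of _ _ "_ - p"])
    then have "z \<in> interior {z. z *\<^sub>C x - y \<in> C} \<longleftrightarrow> z - p \<in> interior {u. u *\<^sub>C x + e \<in> C}"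
      by (simp only: interior_translation) (auto intro: image_eqI[of _ _ "z - p"])
    also have "\<dots> \<longleftrightarrow> z \<noteq> p \<and> 1 / (z - p) \<in> interior (slice x e)"
    proof (cases "z = p")
      case True
      then show ?thesis using assms(1) interior_subset[of "{u. u *\<^sub>C x + e \<in> C}"] by (auto simp: e_def)
    next
      case False
      have "1 / (z - p) \<in> interior (slice x e) \<longleftrightarrow> 1 / (1 / (z - p)) \<in> interior {u. u *\<^sub>C x + e \<in> C}"
        using False inv by (intro inversion_interior) auto
      then show ?thesis using False by simp
    qed
    finally show ?thesis unfolding Some Some_in_cone_L_interior by (simp add: chart_def e_def)
  next
    case None
    have "(\<exists>r. \<forall>z. r < cmod z \<longrightarrow> z *\<^sub>C x - y \<in> C) \<longleftrightarrow> 0 \<in> interior (slice x e)"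
    proof
      assume "\<exists>r. \<forall>z. r < cmod z \<longrightarrow> z *\<^sub>C x - y \<in> C"
      then obtain r where r: "\<And>z. r < cmod z \<Longrightarrow> z *\<^sub>C x - y \<in> C" by auto
      define B where "B = \<bar>r\<bar> + cmod p + 1"
      have B: "0 < B" unfolding B_def using norm_ge_zero[of p] by linarith
      have "ball 0 (1 / B) \<subseteq> slice x e"
      proof
        fix w :: complex assume w: "w \<in> ball 0 (1 / B)"
        show "w \<in> slice x e"
        proof (cases "w = 0")
          case False
          have "B < cmod (1 / w)" using w False B by (simp add: norm_divide field_simps)
          also have "cmod (1 / w) \<le> cmod (1 / w + p) + cmod p" using norm_triangle_ineq4[of "1 / w + p" p] by simp
          finally have "r < cmod (1 / w + p)" unfolding B_def by linarith
          then show ?thesis using r[of "1 / w + p"] inv[OF False] by (simp add: shift)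
        qed (use x in \<open>simp add: slice_def\<close>)
      qed
      then show "0 \<in> interior (slice x e)" using B by (auto simp: mem_interior intro!: exI[of _ "1 / B"])
    next
      assume "0 \<in> interior (slice x e)"
      then obtain \<epsilon> where \<epsilon>: "0 < \<epsilon>" "ball 0 \<epsilon> \<subseteq> slice x e" by (meson mem_interior)
      have "z *\<^sub>C x - y \<in> C" if z: "1 / \<epsilon> + cmod p < cmod z" for z
      proof -
        have "cmod z \<le> cmod (z - p) + cmod p" using norm_triangle_ineq[of "z - p" p] by simp
        then have gt: "1 / \<epsilon> < cmod (z - p)" using z by linarith
        moreover have "0 < 1 / \<epsilon>" using \<epsilon> by simp
        ultimately have nz: "z - p \<noteq> 0" by auto
        have "cmod (1 / (z - p)) < \<epsilon>" using gt nz \<epsilon>(1) by (simp add: norm_divide field_simps)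
        then have "1 / (z - p) \<in> slice x e" using \<epsilon>(2) by auto
        then show ?thesis using inv[of "1 / (z - p)"] nz by (simp add: shift)
      qed
      then show "\<exists>r. \<forall>z. r < cmod z \<longrightarrow> z *\<^sub>C x - y \<in> C" by blast
    qed
    then show ?thesis unfolding None None_in_cone_L_interior by (simp add: chart_def e_def)
  qed
qed

end


section \<open>A lens between two points of the cone\<close>

text \<open>
  The hypothesis says that \<open>a\<close> and \<open>b\<close> have distance at most \<open>2 * ln G\<close> in the right half-plane,
  where neither the logarithm of the real part nor that of the modulus changes faster than the
  distance.
\<close>

lemma half_plane_ratio:
  fixes a b :: complex
  assumes a: "0 < Re a" and b: "0 < Re b" and G: "1 < G"
    and le: "(cmod (a + cnj b))\<^sup>2 \<le> (G + 1 / G)\<^sup>2 * (Re a * Re b)"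
  shows "Re b \<le> G\<^sup>2 * Re a" and "cmod b \<le> G\<^sup>2 * cmod a"
proof -
  have fin: "y \<le> G\<^sup>2 * x" if x: "0 < x" and xy: "(x + y)\<^sup>2 \<le> (G + 1 / G)\<^sup>2 * (x * y)" for x y :: real
  proof (rule ccontr)
    assume "\<not> y \<le> G\<^sup>2 * x"
    then have 1: "0 < y - G\<^sup>2 * x" by simp
    have "1 / G\<^sup>2 \<le> 1" "1 \<le> G\<^sup>2" using G by (simp_all add: one_le_power)
    then have "1 / G\<^sup>2 \<le> G\<^sup>2" by linarith
    then have "1 / G\<^sup>2 * x \<le> G\<^sup>2 * x" using x by (intro mult_right_mono) auto
    then have "0 < (y - G\<^sup>2 * x) * (y - 1 / G\<^sup>2 * x)" using 1 by (intro mult_pos_pos) auto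
    also have "\<dots> = (x + y)\<^sup>2 - (G + 1 / G)\<^sup>2 * (x * y)"
      using G by (simp add: power2_eq_square field_simps)
    finally show False using xy by simp
  qed
  have "(Re a + Re b)\<^sup>2 \<le> (cmod (a + cnj b))\<^sup>2" by (simp add: cmod_power2)
  then show "Re b \<le> G\<^sup>2 * Re a" using le by (intro fin[OF a]) linarith
  define \<alpha> \<beta> p q where "\<alpha> = cmod a" and "\<beta> = cmod b" and "p = Re a * Re b" and "q = Im a * Im b"
  have \<alpha>: "0 < \<alpha>" and \<beta>: "0 < \<beta>" and p: "0 < p" using a b by (auto simp: \<alpha>_def \<beta>_def p_def)
  have pq: "p + q \<le> \<alpha> * \<beta>"
  proof -
    have "p + q = Re (a * cnj b)" by (simp add: p_def q_def)
    also have "\<dots> \<le> cmod (a * cnj b)" by (rule complex_Re_le_cmod)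
    finally show ?thesis by (simp add: \<alpha>_def \<beta>_def norm_mult)
  qed
  have p': "p \<le> \<alpha> * \<beta>" unfolding p_def \<alpha>_def \<beta>_def
    using a b by (intro mult_mono complex_Re_le_cmod) auto
  have eq: "(cmod (a + cnj b))\<^sup>2 = \<alpha>\<^sup>2 + \<beta>\<^sup>2 + 2 * p - 2 * q"
    unfolding \<alpha>_def \<beta>_def p_def q_def cmod_power2 by (simp add: power2_eq_square algebra_simps)
  have "(\<alpha>\<^sup>2 + \<beta>\<^sup>2 + 2 * p - 2 * q) * (\<alpha> * \<beta>) - (\<alpha> + \<beta>)\<^sup>2 * p
      = (\<alpha> - \<beta>)\<^sup>2 * (\<alpha> * \<beta> - p) + 2 * (\<alpha> * \<beta>) * (\<alpha> * \<beta> - (p + q))"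
    by (simp add: power2_eq_square algebra_simps)
  moreover have "0 \<le> (\<alpha> - \<beta>)\<^sup>2 * (\<alpha> * \<beta> - p)" "0 \<le> 2 * (\<alpha> * \<beta>) * (\<alpha> * \<beta> - (p + q))"
    using p' pq \<alpha> \<beta> by simp_all
  ultimately have "(\<alpha> + \<beta>)\<^sup>2 * p \<le> (cmod (a + cnj b))\<^sup>2 * (\<alpha> * \<beta>)" unfolding eq by linarith
  also have "\<dots> \<le> (G + 1 / G)\<^sup>2 * p * (\<alpha> * \<beta>)"
    using le \<alpha> \<beta> unfolding p_def by (intro mult_right_mono) auto
  finally have "p * (\<alpha> + \<beta>)\<^sup>2 \<le> p * ((G + 1 / G)\<^sup>2 * (\<alpha> * \<beta>))" by (simp add: mult.commute mult.left_commute)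
  then have "(\<alpha> + \<beta>)\<^sup>2 \<le> (G + 1 / G)\<^sup>2 * (\<alpha> * \<beta>)" using p by simp
  then show "cmod b \<le> G\<^sup>2 * cmod a" using fin[OF \<alpha>] by (simp add: \<alpha>_def \<beta>_def)
qed

text \<open>
  The expression is \<open>form m l (\<zeta> X - Y)\<close> with \<open>P\<close> and \<open>Q\<close> the values of \<open>form m l\<close> at \<open>X\<close> and
  \<open>Y\<close> and \<open>N\<close> their polar form. If \<open>|\<zeta>|\<close> is small or large, one of the first two summands
  dominates. The remaining condition describes a sector around the negative axis with half-angle
  \<open>2 * arctan (1 / G)\<close>. On the axis all summands are nonnegative since \<open>Re N \<ge> 0\<close>, and the angle is such that
  the contribution of \<open>Im N\<close> is at most twice the geometric mean of the first two summands.
\<close>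

lemma lens_form_nonneg:
  fixes N \<zeta> :: complex and P Q G :: real
  assumes G: "1 < G" and PQ: "0 \<le> P" "0 \<le> Q" and ReN: "0 \<le> Re N"
    and N: "(cmod N)\<^sup>2 \<le> (G + 1 / G)\<^sup>2 * (P * Q)"
    and bal: "0 < P \<Longrightarrow> 0 < Q \<Longrightarrow> P \<le> G ^ 4 * Q \<and> Q \<le> G ^ 4 * P"
    and \<zeta>: "cmod \<zeta> \<le> 1 / G ^ 3 \<or> G ^ 3 \<le> cmod \<zeta> \<or> G * \<bar>Im \<zeta>\<bar> < cmod \<zeta> - Re \<zeta>"
  shows "0 \<le> (cmod \<zeta>)\<^sup>2 * P + Q - Re (\<zeta> * N)"
proof (cases "P = 0 \<or> Q = 0")
  case True
  then have "N = 0" using N by auto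
  then show ?thesis using PQ by simp
next
  case False
  define a b \<rho> where "a = sqrt P" and "b = sqrt Q" and "\<rho> = cmod \<zeta>"
  have pos: "0 < P" "0 < Q" using False PQ by auto
  have ab: "0 < a" "0 < b" "P = a\<^sup>2" "Q = b\<^sup>2" using pos by (simp_all add: a_def b_def)
  have \<rho>0: "0 \<le> \<rho>" by (simp add: \<rho>_def)
  have Nle: "cmod N \<le> (G + 1 / G) * (a * b)"
  proof (rule power2_le_imp_le)
    show "(cmod N)\<^sup>2 \<le> ((G + 1 / G) * (a * b))\<^sup>2" using N by (simp add: ab power_mult_distrib)
    show "0 \<le> (G + 1 / G) * (a * b)" using G ab by simp
  qed
  have bal': "a \<le> G\<^sup>2 * b" "b \<le> G\<^sup>2 * a"
  proof -
    have "a\<^sup>2 \<le> (G\<^sup>2 * b)\<^sup>2" "b\<^sup>2 \<le> (G\<^sup>2 * a)\<^sup>2" using bal[OF pos] by (simp_all add: ab power_mult_distrib flip: power_mult)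
    then show "a \<le> G\<^sup>2 * b" "b \<le> G\<^sup>2 * a" using G ab by (auto intro: power2_le_imp_le)
  qed
  have ReLN: "Re (\<zeta> * N) \<le> \<rho> * ((G + 1 / G) * (a * b))"
  proof -
    have "Re (\<zeta> * N) \<le> \<rho> * cmod N" using complex_Re_le_cmod[of "\<zeta> * N"] by (simp add: \<rho>_def norm_mult)
    also have "\<dots> \<le> \<rho> * ((G + 1 / G) * (a * b))" using Nle \<rho>0 by (intro mult_left_mono)
    finally show ?thesis .
  qed
  have factor: "\<rho>\<^sup>2 * P + Q - \<rho> * ((G + 1 / G) * (a * b)) = (\<rho> * a - b / G) * (\<rho> * a - b * G)"
    using G by (simp add: ab power2_eq_square field_simps)
  show ?thesis using \<zeta>
  proof (elim disjE)
    assume "cmod \<zeta> \<le> 1 / G ^ 3"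
    then have "\<rho> * a \<le> 1 / G ^ 3 * (G\<^sup>2 * b)" unfolding \<rho>_def[symmetric]
      using bal' ab G \<rho>0 by (intro mult_mono) auto
    also have "\<dots> = b / G" using G by (simp add: power2_eq_square power3_eq_cube field_simps)
    finally have 1: "\<rho> * a - b / G \<le> 0" by simp
    have "b / G \<le> b * G" using G ab by (simp add: field_simps mult_ge1_I)
    then have "0 \<le> (\<rho> * a - b / G) * (\<rho> * a - b * G)" using 1 by (intro mult_nonpos_nonpos) auto
    then show ?thesis using ReLN factor by (simp add: \<rho>_def)
  next
    assume r: "G ^ 3 \<le> cmod \<zeta>"
    have "b * G \<le> (G\<^sup>2 * a) * G" using bal' G by (intro mult_right_mono) auto
    also have "\<dots> = G ^ 3 * a" by (simp add: power2_eq_square power3_eq_cube)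
    also have "\<dots> \<le> \<rho> * a" using r ab by (simp add: \<rho>_def)
    finally have 1: "0 \<le> \<rho> * a - b * G" by simp
    have "b / G \<le> b * G" using G ab by (simp add: field_simps mult_ge1_I)
    then have "0 \<le> (\<rho> * a - b / G) * (\<rho> * a - b * G)" using 1 by (intro mult_nonneg_nonneg) auto
    then show ?thesis using ReLN factor by (simp add: \<rho>_def)
  next
    assume w: "G * \<bar>Im \<zeta>\<bar> < cmod \<zeta> - Re \<zeta>"
    define k where "k = \<rho> - Re \<zeta>"
    have k: "G * \<bar>Im \<zeta>\<bar> \<le> k" using w by (simp add: k_def \<rho>_def)
    have k0: "0 \<le> k" using complex_Re_le_cmod[of \<zeta>] by (simp add: k_def \<rho>_def)
    have im: "(Im \<zeta>)\<^sup>2 = k * (\<rho> + Re \<zeta>)"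
      unfolding k_def \<rho>_def using cmod_power2[of \<zeta>] by (simp add: power2_eq_square algebra_simps)
    have "(G * \<bar>Im \<zeta>\<bar>)\<^sup>2 \<le> k\<^sup>2" using k G by (intro power_mono) auto
    moreover have "(G * \<bar>Im \<zeta>\<bar>)\<^sup>2 = k * (G\<^sup>2 * (\<rho> + Re \<zeta>))"
      unfolding power_mult_distrib power2_abs im by (simp only: mult.left_commute)
    ultimately have 1: "k * (G\<^sup>2 * (\<rho> + Re \<zeta>)) \<le> k * k" by (simp only: power2_eq_square[of k])
    have sum0: "0 \<le> \<rho> + Re \<zeta>" using abs_Re_le_cmod[of \<zeta>] by (simp add: \<rho>_def)
    have "0 < k" using w G by (simp add: k_def \<rho>_def) (smt (verit) abs_ge_zero mult_nonneg_nonneg)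
    then have ineq: "G\<^sup>2 * (\<rho> + Re \<zeta>) \<le> \<rho> - Re \<zeta>"
      using 1 by (simp add: k_def)
      have Re: "Re \<zeta> \<le> 0"
      proof -
        have "\<rho> + Re \<zeta> \<le> G\<^sup>2 * (\<rho> + Re \<zeta>)" using mult_right_mono[of 1 "G\<^sup>2" "\<rho> + Re \<zeta>"] G sum0 by (simp add: one_le_power)
        then show ?thesis using ineq by linarith
      qed
      have "(G\<^sup>2 + 1) * \<bar>Im \<zeta>\<bar> \<le> 2 * G * \<rho>"
      proof (rule power2_le_imp_le)
        have "(\<rho> * (G\<^sup>2 - 1))\<^sup>2 \<le> ((G\<^sup>2 + 1) * (- Re \<zeta>))\<^sup>2"
          using ineq \<rho>0 G mult_left_mono[of 1 "G\<^sup>2" \<rho>] by (intro power_mono) (auto simp: algebra_simps one_le_power)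
        then have "(G\<^sup>2 - 1)\<^sup>2 * \<rho>\<^sup>2 \<le> (G\<^sup>2 + 1)\<^sup>2 * (Re \<zeta>)\<^sup>2"
          by (simp only: power_mult_distrib power2_minus mult.commute)
        moreover have "(G\<^sup>2 + 1)\<^sup>2 * (Im \<zeta>)\<^sup>2 = (G\<^sup>2 + 1)\<^sup>2 * \<rho>\<^sup>2 - (G\<^sup>2 + 1)\<^sup>2 * (Re \<zeta>)\<^sup>2"
          unfolding \<rho>_def cmod_power2 by (simp add: algebra_simps)
        moreover have "(G\<^sup>2 + 1)\<^sup>2 * \<rho>\<^sup>2 = (2 * G * \<rho>)\<^sup>2 + (G\<^sup>2 - 1)\<^sup>2 * \<rho>\<^sup>2"
          by (simp add: power2_eq_square algebra_simps)
        ultimately show "((G\<^sup>2 + 1) * \<bar>Im \<zeta>\<bar>)\<^sup>2 \<le> (2 * G * \<rho>)\<^sup>2"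
          unfolding power_mult_distrib[of "G\<^sup>2 + 1"] power2_abs by linarith
        show "0 \<le> 2 * G * \<rho>" using G \<rho>0 by simp
      qed
      then have Im: "(G + 1 / G) * \<bar>Im \<zeta>\<bar> \<le> 2 * \<rho>"
        using G by (simp add: field_simps power2_eq_square)
      have "Re (\<zeta> * N) = Re \<zeta> * Re N - Im \<zeta> * Im N" by simp
      also have "\<dots> \<le> \<bar>Im \<zeta>\<bar> * cmod N"
      proof -
        have "\<bar>Im \<zeta> * Im N\<bar> \<le> \<bar>Im \<zeta>\<bar> * cmod N" unfolding abs_mult by (intro mult_left_mono abs_Im_le_cmod) auto
        moreover have "Re \<zeta> * Re N \<le> 0" using Re ReN by (simp add: mult_nonpos_nonneg)
        ultimately show ?thesis by linarith
      qed
      also have "\<dots> \<le> \<bar>Im \<zeta>\<bar> * ((G + 1 / G) * (a * b))" using Nle by (intro mult_left_mono) auto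
      also have "\<dots> = ((G + 1 / G) * \<bar>Im \<zeta>\<bar>) * (a * b)" by (simp only: mult.commute mult.left_commute)
      also have "\<dots> \<le> 2 * \<rho> * (a * b)" using Im ab by (intro mult_right_mono) auto
      also have "\<dots> \<le> \<rho>\<^sup>2 * P + Q"
        using zero_le_power2[of "\<rho> * a - b"] by (simp add: ab power2_eq_square algebra_simps)
      finally show ?thesis by (simp add: \<rho>_def)
  qed
qed

text \<open>
  The Moebius map that takes \<open>r\<close> to \<open>0\<close> and \<open>1 / r\<close> to \<open>\<infinity>\<close> sends \<open>\<zeta>\<close> to \<open>s\<close> and the negative axis
  into the positive one. The wedge around the positive axis, seen in the coordinate \<open>\<zeta>\<close>, is a lens
  with corners \<open>r\<close> and \<open>1 / r\<close> around the negative axis, \<open>0\<close> and \<open>\<infinity>\<close>. The opening of the wedge is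
  such that, between the circles \<open>|\<zeta>| = r\<close> and \<open>|\<zeta>| = 1 / r\<close>, the lens lies in the sector of \<open>lens_form_nonneg\<close>.
\<close>

lemma lens_region:
  fixes s \<zeta> :: complex and r G :: real
  assumes r: "0 < r" "r < 1" and G: "0 < G" and \<zeta>: "\<zeta> * (1 - s) = of_real r - s / of_real r"
    and s: "\<bar>Im s\<bar> < (1 - r\<^sup>2) / ((1 + r\<^sup>2) * G) * Re s"
  shows "cmod \<zeta> \<le> r \<or> 1 / r \<le> cmod \<zeta> \<or> G * \<bar>Im \<zeta>\<bar> < cmod \<zeta> - Re \<zeta>"
proof (rule ccontr)
  assume "\<not> ?thesis"
  then have \<rho>: "r < cmod \<zeta>" "cmod \<zeta> < 1 / r" and no: "cmod \<zeta> - Re \<zeta> \<le> G * \<bar>Im \<zeta>\<bar>" by auto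
  define M where "M = (cmod (\<zeta> - of_real (1 / r)))\<^sup>2"
  have "\<zeta> \<noteq> of_real (1 / r)" using \<rho> r by (metis abs_of_pos norm_of_real order_less_irrefl zero_less_divide_1_iff)
  then have M: "0 < M" by (simp add: M_def)
  have "s * (\<zeta> - of_real (1 / r)) = \<zeta> - of_real r" using \<zeta> by (simp add: algebra_simps)
  then have "s * of_real M = (\<zeta> - of_real r) * cnj (\<zeta> - of_real (1 / r))"
    unfolding M_def complex_norm_square by (simp only: mult.assoc[symmetric])
  then have "Re (s * of_real M) = Re ((\<zeta> - of_real r) * cnj (\<zeta> - of_real (1 / r)))"
      "Im (s * of_real M) = Im ((\<zeta> - of_real r) * cnj (\<zeta> - of_real (1 / r)))" by (simp_all only:)
  then have Re: "Re s * M = (cmod \<zeta>)\<^sup>2 + 1 - (r + 1 / r) * Re \<zeta>" and Im: "Im s * M = - (1 / r - r) * Im \<zeta>"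
    using r unfolding cmod_power2 by (simp_all add: power2_eq_square algebra_simps diff_divide_distrib)
  have rr: "0 < 1 / r - r" using r by (simp add: field_simps power2_eq_square[symmetric] power_less_one_iff mult_less_cancel_right)
  have "0 \<le> (cmod \<zeta> - r) * (1 / r - cmod \<zeta>)" using \<rho> by (intro mult_nonneg_nonneg) auto
  then have "(cmod \<zeta>)\<^sup>2 + 1 \<le> (r + 1 / r) * cmod \<zeta>" using r by (simp add: power2_eq_square field_simps)
  then have ReM: "Re s * M \<le> (r + 1 / r) * (cmod \<zeta> - Re \<zeta>)" unfolding Re by (simp add: algebra_simps)
  have co: "0 < (1 - r\<^sup>2) / ((1 + r\<^sup>2) * G)" using r G by (simp add: power_less_one_iff add_pos_nonneg)
  have "(1 / r - r) * \<bar>Im \<zeta>\<bar> = \<bar>Im s\<bar> * M"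
    using arg_cong[OF Im, of abs] rr M by (simp add: abs_mult)
  also have "\<dots> < (1 - r\<^sup>2) / ((1 + r\<^sup>2) * G) * Re s * M" using s M by (intro mult_strict_right_mono)
  also have "\<dots> \<le> (1 - r\<^sup>2) / ((1 + r\<^sup>2) * G) * ((r + 1 / r) * (cmod \<zeta> - Re \<zeta>))"
    unfolding mult.assoc using ReM co by (intro mult_left_mono) auto
  also have "\<dots> = (1 / r - r) * ((cmod \<zeta> - Re \<zeta>) / G)"
  proof -
    have "(1 - r\<^sup>2) / ((1 + r\<^sup>2) * G) * (r + 1 / r) = (1 / r - r) / G"
    proof -
      have "1 + r\<^sup>2 \<noteq> 0" by (smt (verit) zero_le_power2)
      moreover have "r + 1 / r = (1 + r\<^sup>2) / r" "1 / r - r = (1 - r\<^sup>2) / r" using r by (simp_all add: field_simps power2_eq_square)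
      ultimately show ?thesis by simp
    qed
    then show ?thesis by (simp add: mult.assoc[symmetric])
  qed
  finally have "\<bar>Im \<zeta>\<bar> < (cmod \<zeta> - Re \<zeta>) / G"
    by (rule mult_left_less_imp_less) (use rr in simp)
  then show False using no G by (simp add: field_simps)
qed

text \<open>
  The margin is moderate, so the exponentials are replaced by a Taylor polynomial of degree \<open>4\<close> and
  by \<open>exp (- L) \<le> 1 / (1 + L)\<close>. The resulting polynomial inequality is a sum of nonnegative terms.
\<close>

lemma exp_bound:
  fixes L :: real
  assumes L: "0 \<le> L"
  shows "1 + 9 / 4 * L\<^sup>2 * (1 + exp (- L)) \<le> 2 * exp L"
proof -
  have e1: "1 + L \<le> exp L" by (rule exp_ge_add_one_self)
  have e4: "1 + L + L^2 / 2 + L^3 / 6 + L^4 / 24 \<le> exp L"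
  proof -
    have "(\<Sum>k<5. L ^ k / fact k) \<le> exp L"
      using L sum_le_suminf[OF summable_exp_generic[of L], of "{..<5}"]
      by (simp add: exp_def scaleR_conv_of_real divide_inverse mult.commute)
    also have "(\<Sum>k<5. L ^ k / fact k) = 1 + L + L^2 / 2 + L^3 / 6 + L^4 / 24"
      by (simp add: eval_nat_numeral fact_numeral)
    finally show ?thesis .
  qed
  have "exp (- L) \<le> 1 / (1 + L)" using e1 L by (simp add: exp_minus field_simps)
  then have "1 + 9 / 4 * L\<^sup>2 * (1 + exp (- L)) \<le> 1 + 9 / 4 * L\<^sup>2 * (1 + 1 / (1 + L))"
    by (intro add_mono mult_left_mono) auto
  also have "\<dots> \<le> 2 * (1 + L + L^2 / 2 + L^3 / 6 + L^4 / 24)"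
  proof -
    have "0 \<le> 5 * L\<^sup>2 * (L - 11 / 10)\<^sup>2" by simp
    moreover have "0 \<le> L\<^sup>2 * ((L - 2)\<^sup>2 * (L + 4))" using L by simp
    \<comment> \<open>These squares complete \<open>5 * L ^ 4 - 11 * L ^ 3\<close>, \<open>L ^ 3 - 12 * L + 16\<close> and a quadratic polynomial.\<close>
    moreover have "0 \<le> L * (12 * (L - 267 / 160)\<^sup>2)" using L by simp
    moreover have "(1 + L) * (24 + 24 * L + 12 * L\<^sup>2 + 4 * L ^ 3 + L ^ 4) - 12 * (1 + L) - 27 * L\<^sup>2 * (2 + L)
      = 5 * L\<^sup>2 * (L - 11 / 10)\<^sup>2 + L\<^sup>2 * ((L - 2)\<^sup>2 * (L + 4)) + L * (12 * (L - 267 / 160)\<^sup>2)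
        + L * (36 - 12 * (267 / 160)\<^sup>2) + 12"
      by (simp add: power2_eq_square power3_eq_cube power4_eq_xxxx algebra_simps)
    moreover have "0 \<le> L * (36 - 12 * (267 / 160)\<^sup>2)" using L by (intro mult_nonneg_nonneg) (auto simp: power2_eq_square)
    ultimately have "12 * (1 + L) + 27 * L\<^sup>2 * (2 + L) \<le> (1 + L) * (24 + 24 * L + 12 * L\<^sup>2 + 4 * L ^ 3 + L ^ 4)"
      by linarith
    then have "(12 * (1 + L) + 27 * L\<^sup>2 * (2 + L)) / (12 * (1 + L))
        \<le> ((1 + L) * (24 + 24 * L + 12 * L\<^sup>2 + 4 * L ^ 3 + L ^ 4)) / (12 * (1 + L))"
      using L by (intro divide_right_mono) auto
    also have "\<dots> = (24 + 24 * L + 12 * L\<^sup>2 + 4 * L ^ 3 + L ^ 4) / 12"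
    proof -
      have cancel: "a * B / (12 * a) = B / 12" if "a \<noteq> 0" for a B :: real using that by simp
      show ?thesis using L by (intro cancel) simp
    qed
    finally have "(12 * (1 + L) + 27 * L\<^sup>2 * (2 + L)) / (12 * (1 + L)) \<le> (24 + 24 * L + 12 * L\<^sup>2 + 4 * L ^ 3 + L ^ 4) / 12" .
    also have "(12 * (1 + L) + 27 * L\<^sup>2 * (2 + L)) / (12 * (1 + L)) = 1 + 9 / 4 * L\<^sup>2 * (1 + 1 / (1 + L))"
      using L by (simp add: field_simps)
    also have "(24 + 24 * L + 12 * L\<^sup>2 + 4 * L ^ 3 + L ^ 4) / 12 = 2 * (1 + L + L^2 / 2 + L^3 / 6 + L^4 / 24)"
      by (simp add: add_divide_distrib distrib_left)
    finally show ?thesis .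
  qed
  also have "\<dots> \<le> 2 * exp L" using e4 by simp
  finally show ?thesis .
qed

text \<open>
  With \<open>y = 3 * ln G\<close> the argument of \<open>arctan\<close> is \<open>u = tanh y / G\<close>. The estimates
  \<open>sin t \<le> t\<close> for \<open>t = arctan u\<close> and \<open>y \<le> sinh y\<close> reduce the claim to \<open>exp_bound\<close> at \<open>2 * ln G\<close>.
\<close>

lemma lens_width_bound:
  fixes G r :: real
  assumes G: "1 < G" and r: "r = 1 / G ^ 3"
  shows "3 * ln G \<le> sqrt 2 * G\<^sup>2 * arctan ((1 - r\<^sup>2) / ((1 + r\<^sup>2) * G))"
proof -
  define y where "y = 3 * ln G"
  have y: "0 < y" using G by (simp add: y_def)
  have "exp y = G ^ 3" using G by (simp add: y_def exp_of_nat_mult[of 3, simplified] flip: exp_of_nat_mult)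
  then have rexp: "r = exp (- y)" by (simp add: r exp_minus field_simps)
  have th: "(1 - r\<^sup>2) / (1 + r\<^sup>2) = tanh y"
    unfolding tanh_real_altdef rexp by (simp add: power2_eq_square flip: exp_add)
  define u where "u = tanh y / G"
  have u: "0 < u" using y G by (simp add: u_def)
  have ueq: "(1 - r\<^sup>2) / ((1 + r\<^sup>2) * G) = u" using th by (simp add: u_def divide_divide_eq_left[symmetric] del: divide_divide_eq_left)
  have "u / sqrt (1 + u\<^sup>2) = sin (arctan u)" by (simp add: sin_arctan)
  also have "\<dots> \<le> arctan u" using u by (intro sin_x_le_x) simp
  finally have low: "u / sqrt (1 + u\<^sup>2) \<le> arctan u" .
  have G2: "G\<^sup>2 = exp (2 * ln G)" using G by (simp add: exp_double)
  have t: "0 < tanh y" "tanh y < 1" using y by (simp_all add: tanh_real_lt_1)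
  have sinh: "y \<le> sinh y"
  proof -
    have "sinh 0 - 0 \<le> sinh y - y"
    proof (rule DERIV_nonneg_imp_nondecreasing[OF less_imp_le[OF y]])
      fix x :: real
      have "((\<lambda>x. sinh x - x) has_real_derivative cosh x - 1) (at x)" by (auto intro!: derivative_eq_intros)
      then show "\<exists>d. ((\<lambda>x. sinh x - x) has_real_derivative d) (at x) \<and> 0 \<le> d" using cosh_real_ge_1[of x] by auto
    qed
    then show ?thesis by simp
  qed
  have coth: "y\<^sup>2 \<le> (1 + y\<^sup>2) * (tanh y)\<^sup>2"
  proof -
    have s0: "0 < sinh y" using y by simp
    have "y\<^sup>2 \<le> (sinh y)\<^sup>2" using sinh y by (intro power_mono) auto
    then have "y\<^sup>2 * (1 + (sinh y)\<^sup>2) \<le> (1 + y\<^sup>2) * (sinh y)\<^sup>2" by (simp add: algebra_simps)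
    then show ?thesis using s0 unfolding tanh_def
      by (simp add: power_divide cosh_square_eq divide_simps add_pos_nonneg add.commute)
  qed
  have "(y * sqrt (1 + u\<^sup>2))\<^sup>2 = y\<^sup>2 + y\<^sup>2 * u\<^sup>2" by (simp add: power_mult_distrib algebra_simps)
  also have "\<dots> \<le> (1 + y\<^sup>2) * (tanh y)\<^sup>2 + y\<^sup>2 * u\<^sup>2" using coth by simp
  also have "\<dots> = (1 + y\<^sup>2 * (1 + 1 / G\<^sup>2)) * (tanh y)\<^sup>2" by (simp add: u_def power_divide algebra_simps)
  also have "\<dots> \<le> (2 * G\<^sup>2) * (tanh y)\<^sup>2"
  proof -
    have "y\<^sup>2 = 9 / 4 * (2 * ln G)\<^sup>2" by (simp add: y_def power_mult_distrib)
    moreover have "1 / G\<^sup>2 = exp (- (2 * ln G))" unfolding G2 by (simp add: exp_minus divide_inverse)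
    ultimately have "1 + y\<^sup>2 * (1 + 1 / G\<^sup>2) \<le> 2 * G\<^sup>2"
      using exp_bound[of "2 * ln G"] G by (simp add: G2)
    then show ?thesis by (intro mult_right_mono) auto
  qed
  also have "\<dots> = (sqrt 2 * G\<^sup>2 * u)\<^sup>2"
  proof -
    have e: "sqrt 2 * G\<^sup>2 * u = sqrt 2 * (G * tanh y)" using G by (simp add: u_def power2_eq_square)
    show ?thesis unfolding e by (simp add: power_mult_distrib)
  qed
  finally have sq: "(y * sqrt (1 + u\<^sup>2))\<^sup>2 \<le> (sqrt 2 * G\<^sup>2 * u)\<^sup>2" .
  have "y * sqrt (1 + u\<^sup>2) \<le> sqrt 2 * G\<^sup>2 * u"
    by (rule power2_le_imp_le[OF sq]) (use u in simp)
  moreover have "0 < sqrt (1 + u\<^sup>2)" by (simp add: add_pos_nonneg)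
  ultimately have "y \<le> sqrt 2 * G\<^sup>2 * (u / sqrt (1 + u\<^sup>2))"
    by (simp only: times_divide_eq_right pos_le_divide_eq)
  also have "\<dots> \<le> sqrt 2 * G\<^sup>2 * arctan u" using low by (intro mult_left_mono) auto
  finally show ?thesis unfolding ueq y_def .
qed

text \<open>
  A power of the Cayley transform maps the disk to a wedge with half-angle \<open>\<psi>\<close>. The distance from
  \<open>1\<close> to \<open>r\<^sup>2\<close> in the wedge is the logarithmic distance times \<open>pi / (2 * \<psi>)\<close>.
\<close>

lemma wedge_map:
  fixes \<psi> r :: real
  assumes \<psi>: "0 < \<psi>" "\<psi> < pi / 2" and r: "0 < r" "r < 1"
  obtains \<sigma> \<tau> where "\<sigma> holomorphic_on ball 0 1"
    "\<And>\<xi>. cmod \<xi> < 1 \<Longrightarrow> 0 < Re (\<sigma> \<xi>) \<and> \<bar>Im (\<sigma> \<xi>)\<bar> < tan \<psi> * Re (\<sigma> \<xi>)"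
    "cmod \<tau> < 1" "\<sigma> 0 = 1" "\<sigma> \<tau> = of_real (r\<^sup>2)" "disk_dist 0 \<tau> = - (pi / \<psi>) * ln r"
proof -
  define \<sigma> where "\<sigma> = (\<lambda>\<xi>. exp (of_real (2 * \<psi> / pi) * Ln ((1 + \<xi>) / (1 - \<xi>))))"
  define t where "t = - (pi / (2 * \<psi>)) * ln r"
  define \<tau> where "\<tau> = complex_of_real (- tanh t)"
  have t: "0 < t" unfolding t_def using \<psi> r by (intro mult_neg_neg) auto
  have half: "0 < Re ((1 + \<xi>) / (1 - \<xi>))" if \<xi>: "cmod \<xi> < 1" for \<xi>
  proof -
    have nz: "1 - \<xi> \<noteq> 0" using \<xi> by auto
    have "(1 + \<xi>) / (1 - \<xi>) = ((1 + \<xi>) * cnj (1 - \<xi>)) / of_real ((cmod (1 - \<xi>))\<^sup>2)"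
      unfolding complex_norm_square using nz by simp
    moreover have "Re ((1 + \<xi>) * cnj (1 - \<xi>)) = 1 - (cmod \<xi>)\<^sup>2"
      unfolding cmod_power2 by (simp add: power2_eq_square algebra_simps)
    moreover have "(cmod \<xi>)\<^sup>2 < 1" using \<xi> by (simp add: power_less_one_iff)
    ultimately show ?thesis using nz by (simp only: Re_divide_of_real) auto
  qed
  show thesis
  proof (rule that[of \<sigma> \<tau>])
    show "\<sigma> holomorphic_on ball 0 1"
    proof -
      have "(1 + z) / (1 - z) \<notin> \<real>\<^sub>\<le>\<^sub>0" "1 - z \<noteq> 0" if "z \<in> ball 0 1" for z :: complex
      proof -
        have z: "cmod z < 1" using that by simp
        show "(1 + z) / (1 - z) \<notin> \<real>\<^sub>\<le>\<^sub>0" using half[OF z] unfolding complex_nonpos_Reals_iff by linarith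
        show "1 - z \<noteq> 0" using z by auto
      qed
      then show ?thesis unfolding \<sigma>_def by (intro holomorphic_intros)
    qed
    show "0 < Re (\<sigma> \<xi>) \<and> \<bar>Im (\<sigma> \<xi>)\<bar> < tan \<psi> * Re (\<sigma> \<xi>)" if \<xi>: "cmod \<xi> < 1" for \<xi>
    proof -
      define w where "w = Ln ((1 + \<xi>) / (1 - \<xi>))"
      have "\<bar>Im w\<bar> < pi / 2" unfolding w_def using half[OF \<xi>] by (intro Re_Ln_pos_lt_imp)
      define \<theta> where "\<theta> = 2 * \<psi> / pi * Im w"
      have "\<bar>\<theta>\<bar> = 2 * \<psi> / pi * \<bar>Im w\<bar>" using \<psi> by (simp add: \<theta>_def abs_mult)
      also have "\<dots> < 2 * \<psi> / pi * (pi / 2)" using \<psi> \<open>\<bar>Im w\<bar> < pi / 2\<close> by (intro mult_strict_left_mono) auto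
      also have "\<dots> = \<psi>" by simp
      finally have \<theta>: "\<bar>\<theta>\<bar> < \<psi>" .
      define E where "E = exp (2 * \<psi> / pi * Re w)"
      have E: "Re (\<sigma> \<xi>) = E * cos \<theta>" "Im (\<sigma> \<xi>) = E * sin \<theta>" "0 < E"
        by (simp_all add: \<sigma>_def w_def[symmetric] Re_exp Im_exp \<theta>_def E_def)
      have c: "0 < cos \<theta>" using \<theta> \<psi> by (intro cos_gt_zero_pi) auto
      have "tan \<bar>\<theta>\<bar> < tan \<psi>" using \<theta> \<psi> by (intro tan_monotone) auto
      then have "\<bar>sin \<theta>\<bar> < tan \<psi> * cos \<theta>"
      proof -
        have "0 \<le> sin \<bar>\<theta>\<bar>" using \<theta> \<psi> by (intro sin_ge_zero) auto
        then have "sin \<bar>\<theta>\<bar> = \<bar>sin \<theta>\<bar>" by (auto simp: abs_if split: if_splits)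
        moreover have "cos \<bar>\<theta>\<bar> = cos \<theta>" by (simp add: abs_if)
        ultimately have "tan \<bar>\<theta>\<bar> = \<bar>sin \<theta>\<bar> / cos \<theta>" by (simp add: tan_def)
        then show ?thesis using \<open>tan \<bar>\<theta>\<bar> < tan \<psi>\<close> c by (simp add: divide_less_eq)
      qed
      then have "E * \<bar>sin \<theta>\<bar> < E * (tan \<psi> * cos \<theta>)" using E(3) by simp
      then show ?thesis using c E by (simp add: abs_mult mult.left_commute)
    qed
    have tt: "\<bar>tanh t\<bar> < 1" using tanh_real_bounds[of t] by auto
    then show "cmod \<tau> < 1" by (simp add: \<tau>_def)
    show "\<sigma> 0 = 1" by (simp add: \<sigma>_def)
    have "(1 + \<tau>) / (1 - \<tau>) = of_real ((1 - tanh t) / (1 + tanh t))" by (simp add: \<tau>_def)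
    also have "(1 - tanh t) / (1 + tanh t) = exp (- 2 * t)"
    proof -
      have "0 < 1 + exp (- 2 * t)" by (simp add: add_pos_pos)
      then show ?thesis unfolding tanh_real_altdef by (simp add: field_simps)
    qed
    finally have "Ln ((1 + \<tau>) / (1 - \<tau>)) = of_real (- 2 * t)" by (simp add: Ln_of_real)
    then have "\<sigma> \<tau> = of_real (exp (2 * \<psi> / pi * (- 2 * t)))"
      by (simp add: \<sigma>_def flip: exp_of_real)
    also have "2 * \<psi> / pi * (- 2 * t) = 2 * ln r" using \<psi> by (simp add: t_def)
    also have "exp (2 * ln r) = r\<^sup>2" using r by (simp add: exp_double)
    finally show "\<sigma> \<tau> = of_real (r\<^sup>2)" .
    have "disk_dist 0 \<tau> = 2 * artanh \<bar>tanh t\<bar>"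
      by (simp add: disk_dist_def Moebius_function_simple \<tau>_def)
    also have "\<dots> = 2 * t" using t by (simp add: artanh_tanh_real)
    finally show "disk_dist 0 \<tau> = - (pi / \<psi>) * ln r" by (simp add: t_def)
  qed
qed


section \<open>A lower bound for the chain distance\<close>

lemma clin_indep_iff:
  "clin_indep x y \<longleftrightarrow> (\<forall>a b. a *\<^sub>C x + b *\<^sub>C y = 0 \<longrightarrow> a = 0 \<and> b = 0)"
proof -
  interpret V: vector_space "scaleC :: complex \<Rightarrow> 'a \<Rightarrow> 'a" by (rule vector_space_scaleC)
  have "clin_indep x y \<longleftrightarrow> x \<noteq> y \<and> y \<noteq> 0 \<and> x \<notin> range (\<lambda>k. k *\<^sub>C y)"
    unfolding clin_indep_def
    by (auto simp: V.independent_insert V.span_singleton V.dependent_single)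
  also have "\<dots> \<longleftrightarrow> (\<forall>a b. a *\<^sub>C x + b *\<^sub>C y = 0 \<longrightarrow> a = 0 \<and> b = 0)"
  proof (intro iffI allI impI)
    fix a b assume i: "x \<noteq> y \<and> y \<noteq> 0 \<and> x \<notin> range (\<lambda>k. k *\<^sub>C y)" and ab: "a *\<^sub>C x + b *\<^sub>C y = 0"
    have a: "a = 0"
    proof (rule ccontr)
      assume a: "a \<noteq> 0"
      have "x = (1 / a) *\<^sub>C (a *\<^sub>C x)" using a by (simp add: scaleC_scaleC scaleC_one)
      also have "a *\<^sub>C x = (- b) *\<^sub>C y" using ab by (simp add: scaleC_minus_left eq_neg_iff_add_eq_0)
      finally have "x = (1 / a * (- b)) *\<^sub>C y" by (simp only: scaleC_scaleC)
      then show False using i by blast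
    qed
    then have "b *\<^sub>C y = 0" using ab by simp
    then show "a = 0 \<and> b = 0" using a i by simp
  next
    assume h: "\<forall>a b. a *\<^sub>C x + b *\<^sub>C y = 0 \<longrightarrow> a = 0 \<and> b = 0"
    have "y \<noteq> 0" using h[rule_format, of 0 1] by auto
    moreover have "x \<noteq> k *\<^sub>C y" for k using h[rule_format, of 1 "- k"] by (auto simp: scaleC_one scaleC_minus_left)
    moreover from this[of 1] have "x \<noteq> y" by (simp add: scaleC_one)
    ultimately show "x \<noteq> y \<and> y \<noteq> 0 \<and> x \<notin> range (\<lambda>k. k *\<^sub>C y)" by auto
  qed
  finally show ?thesis .
qed

lemma proper_cone_obtains_outside:
  assumes proper: "proper_cone C" and xy: "clin_indep x y"
  obtains a b where "a *\<^sub>C x + b *\<^sub>C y \<notin> C"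
proof -
  interpret V: vector_space "scaleC :: complex \<Rightarrow> 'a \<Rightarrow> 'a" by (rule vector_space_scaleC)
  define W where "W = V.span {x, y}"
  have "V.subspace W" unfolding W_def by (rule V.subspace_span)
  moreover have "V.dim W = 2"
    using xy unfolding W_def clin_indep_def by (simp add: V.dim_eq_card_independent)
  ultimately have "\<not> W \<subseteq> closure C" using proper unfolding proper_cone_def by blast
  then obtain v where v: "v \<in> W" "v \<notin> C" using closure_subset by blast
  from v(1) obtain a where "v - a *\<^sub>C x \<in> V.span {y}" unfolding W_def V.span_insert by auto
  then obtain b where "v - a *\<^sub>C x = b *\<^sub>C y" unfolding V.span_singleton by auto
  then have "v = a *\<^sub>C x + b *\<^sub>C y" by (simp add: algebra_simps)
  then show thesis using that v(2) by blast
qed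

lemma limit_from_below_at_1:
  fixes f g :: "real \<Rightarrow> real"
  assumes f: "continuous_on UNIV f" and g: "continuous_on UNIV g"
    and le: "\<And>\<delta>. 0 < \<delta> \<Longrightarrow> \<delta> < 1 \<Longrightarrow> f \<delta> \<le> g \<delta>"
  shows "f 1 \<le> g 1"
proof -
  have "(f \<longlongrightarrow> f 1) (at_left 1)" "(g \<longlongrightarrow> g 1) (at_left 1)"
    using f g unfolding continuous_on_def by (auto intro: tendsto_within_subset)
  moreover have "\<forall>\<^sub>F \<delta> in at_left 1. f \<delta> \<le> g \<delta>"
    unfolding eventually_at_left_field using le by (intro exI[of _ 0]) auto
  ultimately show ?thesis by (intro tendsto_le[of "at_left 1" g "g 1" f "f 1"]) auto
qed

text \<open>
  Properness provides, for independent \<open>x\<close> and \<open>y\<close>, a pole \<open>p\<close> with \<open>p x - y \<notin> C\<close>.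
\<close>

locale proper_quadrant_cone = quadrant_cone +
  assumes proper: "proper_cone C"
begin

lemma obtains_pole:
  assumes x: "x \<in> C" and xy: "clin_indep x y"
  obtains p where "p *\<^sub>C x - y \<notin> C"
proof -
  obtain a b where ab: "a *\<^sub>C x + b *\<^sub>C y \<notin> C" using proper_cone_obtains_outside[OF proper xy] .
  have "b \<noteq> 0" using ab x C_scale zero_in_C by (cases "a = 0") auto
  have "(- b) *\<^sub>C ((- a / b) *\<^sub>C x - y) = a *\<^sub>C x + b *\<^sub>C y"
    using \<open>b \<noteq> 0\<close> by (simp add: scaleC_diff_right scaleC_scaleC scaleC_minus_left scaleC_minus_right)
  then have "(- a / b) *\<^sub>C x - y \<notin> C" using ab C_scale_iff[of "- b"] \<open>b \<noteq> 0\<close> by (metis neg_equal_0_iff_equal)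
  then show thesis by (rule that)
qed

text \<open>
  The Cayley transform of \<open>m / l\<close>. It maps \<open>C\<close> to the closed unit disk and, unlike the quotient
  itself, is undefined only where both functionals vanish.
\<close>

definition ratio :: "('a \<Rightarrow> complex) \<Rightarrow> ('a \<Rightarrow> complex) \<Rightarrow> 'a \<Rightarrow> complex"
  where "ratio m l v = (m v - l v) / (m v + l v)"

lemma cmod_ratio_le_1:
  assumes "v \<in> C" "m \<in> dual" "l \<in> dual"
  shows "cmod (ratio m l v) \<le> 1"
proof -
  have "(cmod (m v - l v))\<^sup>2 = (cmod (m v + l v))\<^sup>2 - 4 * form m l v"
    unfolding cmod_power2 form_def by (simp add: power2_eq_square algebra_simps)
  then have "(cmod (m v - l v))\<^sup>2 \<le> (cmod (m v + l v))\<^sup>2" using form_nonneg[OF assms] by simp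
  then have "cmod (m v - l v) \<le> cmod (m v + l v)" by (rule power2_le_imp_le) simp
  then show ?thesis by (simp add: ratio_def norm_divide divide_le_eq_1)
qed

lemma ratio_scale: "c \<noteq> 0 \<Longrightarrow> m \<in> dual \<Longrightarrow> l \<in> dual \<Longrightarrow> ratio m l (c *\<^sub>C v) = ratio m l v"
  by (simp add: ratio_def complex_linear_scale dualD flip: right_diff_distrib distrib_left)

text \<open>
  Schwarz-Pick for \<open>ratio m l\<close> on the domain of \<open>x, y\<close>. The factor \<open>\<delta> < 1\<close> keeps the values in the
  open disk. Whether \<open>m + l\<close> vanishes is the same at \<open>x\<close> and \<open>y\<close>, because a zero in the interior
  of a slice spreads to the whole plane.
\<close>

lemma gauge_step:
  assumes x: "x \<in> C - {0}" and y: "y \<in> C - {0}" and fin: "gauge_dist C x y < \<infinity>"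
    and ml: "m \<in> dual" "l \<in> dual" and \<delta>: "0 < \<delta>" "\<delta> < 1"
  shows "(m x + l x = 0 \<longleftrightarrow> m y + l y = 0) \<and> (m x + l x \<noteq> 0 \<longrightarrow>
    ennreal (disk_dist (of_real \<delta> * ratio m l x) (of_real \<delta> * ratio m l y)) \<le> gauge_dist C x y)"
proof (cases "clin_indep x y")
  case False
  then obtain a b where ab: "a *\<^sub>C x + b *\<^sub>C y = 0" "a \<noteq> 0 \<or> b \<noteq> 0" unfolding clin_indep_iff by blast
  have "b \<noteq> 0"
  proof
    assume "b = 0"
    then have "a *\<^sub>C x = 0" "a \<noteq> 0" using ab by auto
    then have "(1 / a) *\<^sub>C (a *\<^sub>C x) = 0" by simp
    then show False using x \<open>a \<noteq> 0\<close> by (simp add: scaleC_scaleC scaleC_one)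
  qed
  have "b *\<^sub>C y = (- a) *\<^sub>C x" using ab(1) by (simp add: scaleC_minus_left eq_neg_iff_add_eq_0 add.commute)
  then have "(1 / b) *\<^sub>C (b *\<^sub>C y) = (1 / b) *\<^sub>C ((- a) *\<^sub>C x)" by simp
  then have yx: "y = (- a / b) *\<^sub>C x" using \<open>b \<noteq> 0\<close> by (simp add: scaleC_scaleC scaleC_one)
  then have nz: "- a / b \<noteq> 0" using y by auto
  have "m y + l y = (- a / b) * (m x + l x)"
    unfolding yx using ml by (simp add: complex_linear_scale dualD distrib_left add_divide_distrib)
  moreover have "ratio m l y = ratio m l x" unfolding yx by (rule ratio_scale[OF nz ml])
  ultimately show ?thesis using nz by (simp add: disk_dist_self)
next
  case True
  then have int: "Some 0 \<in> cone_L_interior C x y" "None \<in> cone_L_interior C x y"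
    and gauge: "gauge_dist C x y = poincare_dist (cone_L_interior C x y) (Some 0) None"
    using fin by (auto simp: gauge_dist_def split: if_splits)
  have xC: "x \<in> C" "y \<in> C" using x y by auto
  obtain p where p: "p *\<^sub>C x - y \<notin> C" using obtains_pole[OF xC(1) True] .
  define e where "e = p *\<^sub>C x - y"
  have eC: "e \<notin> C" using p by (simp add: e_def)
  note iff = cone_L_interior_iff[OF p xC(1), folded e_def]
  have p0: "p \<noteq> 0" using p xC(2) C_scale[of y "-1"] by (auto simp: scaleC_minus_left scaleC_one)
  have O0: "0 \<in> interior (slice x e)" using int(2) iff[of None] by (simp add: chart_def)
  have Op: "- 1 / p \<in> interior (slice x e)" using int(1) iff[of "Some 0"] p0 by (simp add: chart_def)
  have xpe: "x + (- 1 / p) *\<^sub>C e = (1 / p) *\<^sub>C y"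
    using p0 by (simp add: e_def scaleC_diff_right scaleC_scaleC scaleC_minus_left scaleC_one)
  \<comment> \<open>The denominator of \<open>ratio m l\<close>; it is itself a member of \<open>dual\<close>.\<close>
  define g where "g = (\<lambda>v. m v + l v)"
  have g: "g \<in> dual" unfolding g_def by (rule dual_add[OF ml])
  have glin: "g (x + w *\<^sub>C e) = g x + w * g e" for w
    using g by (simp add: complex_linear_add complex_linear_scale dualD)
  have van: "g x + w * g e = 0 \<Longrightarrow> g e = 0" if "w \<in> interior (slice x e)" for w
    using interior_slice_nonvanishing[OF eC that g] glin by simp
  have gy: "g y = p * (g x + (- 1 / p) * g e)"
  proof -
    have "g y = g (p *\<^sub>C (x + (- 1 / p) *\<^sub>C e))" unfolding xpe using p0 by (simp add: scaleC_scaleC scaleC_one)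
    also have "\<dots> = p * g (x + (- 1 / p) *\<^sub>C e)" by (rule complex_linear_scale[OF dualD[OF g]])
    finally show ?thesis unfolding glin .
  qed
  have gxy: "g x = 0 \<longleftrightarrow> g y = 0"
  proof
    assume "g x = 0" then show "g y = 0" using van[OF O0] gy by simp
  next
    assume "g y = 0"
    then have "g x + (- 1 / p) * g e = 0" using gy p0 by simp
    then show "g x = 0" using van[OF Op] by auto
  qed
  have "ennreal (disk_dist (of_real \<delta> * ratio m l x) (of_real \<delta> * ratio m l y)) \<le> gauge_dist C x y"
    if gx: "g x \<noteq> 0"
  proof -
    define \<beta> where "\<beta> = (\<lambda>w. of_real \<delta> * ratio m l (x + w *\<^sub>C e))"
    have nz: "g x + w * g e \<noteq> 0" if "w \<in> interior (slice x e)" for w using van[OF that] gx by auto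
    have lin: "m (x + w *\<^sub>C e) = m x + w * m e" "l (x + w *\<^sub>C e) = l x + w * l e" for w
      using ml by (simp_all add: complex_linear_add complex_linear_scale dualD)
    have \<beta>eq: "\<beta> w = of_real \<delta> * ((m x + w * m e - (l x + w * l e)) / (g x + w * g e))" for w
      unfolding \<beta>_def ratio_def lin g_def by (simp add: algebra_simps)
    have \<beta>hol: "\<beta> holomorphic_on interior (slice x e)"
      unfolding \<beta>eq using nz by (intro holomorphic_intros) auto
    have \<beta>in: "cmod (\<beta> w) < 1" if w: "w \<in> interior (slice x e)" for w
    proof -
      have "x + w *\<^sub>C e \<in> C" using w interior_subset by (auto simp: slice_def)
      then have "cmod (\<beta> w) \<le> \<delta> * 1" unfolding \<beta>_def norm_mult
        using \<delta> cmod_ratio_le_1[OF _ ml] by (intro mult_mono) auto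
      then show ?thesis using \<delta> by simp
    qed
    have b0: "\<beta> 0 = of_real \<delta> * ratio m l x" by (simp add: \<beta>_def)
    have bp: "\<beta> (- 1 / p) = of_real \<delta> * ratio m l y"
      unfolding \<beta>_def xpe using p0 ml by (subst ratio_scale) auto
    show ?thesis
      unfolding gauge poincare_dist_def
    proof (rule Inf_greatest, clarify)
      fix f a b
      assume f: "sphere_holomorphic_on f (ball 0 1)" "bij_betw f (ball 0 1) (cone_L_interior C x y)"
        and ab: "a \<in> ball 0 1" "b \<in> ball 0 1" "f a = Some 0" "f b = None"
      have fin: "f \<xi> \<noteq> Some p" "chart p (f \<xi>) \<in> interior (slice x e)" if "\<xi> \<in> ball 0 1" for \<xi>
        using bij_betwE[OF f(2)] that iff by blast+
      define h where "h = (\<lambda>\<xi>. \<beta> (chart p (f \<xi>)))"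
      have "h holomorphic_on ball 0 1"
        unfolding h_def using fin by (intro holomorphic_on_comp[OF _ \<beta>hol] chart_holomorphic f(1)) auto
      moreover have "h ` ball 0 1 \<subseteq> ball 0 1" unfolding h_def using fin \<beta>in by auto
      ultimately have "disk_dist (h a) (h b) \<le> disk_dist a b" using ab by (intro Schwarz_Pick) auto
      moreover have "h a = of_real \<delta> * ratio m l y" "h b = of_real \<delta> * ratio m l x"
        using ab b0 bp by (simp_all add: h_def chart_def)
      ultimately show "ennreal (disk_dist (of_real \<delta> * ratio m l x) (of_real \<delta> * ratio m l y)) \<le> ennreal (disk_dist a b)"
        by (intro ennreal_leI) (simp add: disk_dist_commute)
    qed
  qed
  then show ?thesis using gxy by (simp add: g_def)
qed

lemma gauge_chain:
  assumes X: "\<And>k. k \<le> n \<Longrightarrow> X k \<in> C - {0}" and fin: "(\<Sum>k<n. gauge_dist C (X k) (X (Suc k))) < \<infinity>"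
    and ml: "m \<in> dual" "l \<in> dual" and \<delta>: "0 < \<delta>" "\<delta> < 1"
  shows "(m (X 0) + l (X 0) = 0 \<longleftrightarrow> m (X n) + l (X n) = 0) \<and> (m (X 0) + l (X 0) \<noteq> 0 \<longrightarrow>
    ennreal (disk_dist (of_real \<delta> * ratio m l (X 0)) (of_real \<delta> * ratio m l (X n)))
      \<le> (\<Sum>k<n. gauge_dist C (X k) (X (Suc k))))"
  using X fin
proof (induction n)
  case 0
  then show ?case by (simp add: disk_dist_self)
next
  case (Suc n)
  define S where "S = (\<Sum>k<n. gauge_dist C (X k) (X (Suc k)))"
  have sum: "(\<Sum>k<Suc n. gauge_dist C (X k) (X (Suc k))) = S + gauge_dist C (X n) (X (Suc n))"
    by (simp add: S_def)
  then have fin: "S < \<infinity>" "gauge_dist C (X n) (X (Suc n)) < \<infinity>"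
    using Suc.prems(2) by (auto simp: less_top[symmetric])
  have X': "X k \<in> C - {0}" if "k \<le> n" for k using Suc.prems(1) that by simp
  note IH = Suc.IH[OF X' fin(1)[unfolded S_def]]
  have step: "(m (X n) + l (X n) = 0 \<longleftrightarrow> m (X (Suc n)) + l (X (Suc n)) = 0) \<and> (m (X n) + l (X n) \<noteq> 0 \<longrightarrow>
      ennreal (disk_dist (of_real \<delta> * ratio m l (X n)) (of_real \<delta> * ratio m l (X (Suc n))))
        \<le> gauge_dist C (X n) (X (Suc n)))"
    by (rule gauge_step[OF Suc.prems(1) Suc.prems(1) fin(2) ml \<delta>]) simp_all
  define d where "d = (\<lambda>i j. disk_dist (of_real \<delta> * ratio m l (X i)) (of_real \<delta> * ratio m l (X j)))"
  have in1: "cmod (of_real \<delta> * ratio m l (X k)) < 1" if "k \<le> Suc n" for k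
  proof -
    have "cmod (of_real \<delta> * ratio m l (X k)) \<le> \<delta> * 1" unfolding norm_mult
      using \<delta> cmod_ratio_le_1[OF _ ml] Suc.prems(1)[OF that] by (intro mult_mono) auto
    then show ?thesis using \<delta> by simp
  qed
  have "ennreal (d 0 (Suc n)) \<le> ennreal (d 0 n + d n (Suc n))"
    unfolding d_def by (intro ennreal_leI disk_dist_triangle in1) auto
  also have "\<dots> = ennreal (d 0 n) + ennreal (d n (Suc n))"
    unfolding d_def by (intro ennreal_plus disk_dist_nonneg in1) auto
  finally have "ennreal (d 0 (Suc n)) \<le> ennreal (d 0 n) + ennreal (d n (Suc n))" .
  then have tri: "ennreal (d 0 (Suc n)) \<le> S + gauge_dist C (X n) (X (Suc n))"
    if "ennreal (d 0 n) \<le> S" "ennreal (d n (Suc n)) \<le> gauge_dist C (X n) (X (Suc n))"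
    using add_mono[OF that] by (rule order_trans)
  show ?case unfolding sum
  proof (intro conjI impI)
    show "m (X 0) + l (X 0) = 0 \<longleftrightarrow> m (X (Suc n)) + l (X (Suc n)) = 0" using IH step by simp
    assume nz: "m (X 0) + l (X 0) \<noteq> 0"
    have "ennreal (d 0 n) \<le> S" using conjunct2[OF IH] nz unfolding d_def S_def by (rule mp)
    moreover have "m (X n) + l (X n) \<noteq> 0" using conjunct1[OF IH] nz by simp
    then have "ennreal (d n (Suc n)) \<le> gauge_dist C (X n) (X (Suc n))"
      using conjunct2[OF step] unfolding d_def by (rule rev_mp)
    ultimately show "ennreal (disk_dist (of_real \<delta> * ratio m l (X 0)) (of_real \<delta> * ratio m l (X (Suc n))))
        \<le> S + gauge_dist C (X n) (X (Suc n))"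
      using tri unfolding d_def by simp
  qed
qed

text \<open>
  The conclusion says that \<open>m / l\<close> takes values of half-plane distance at most \<open>D\<close> at \<open>x\<close> and \<open>y\<close>,
  in a form that remains meaningful if \<open>l\<close> vanishes or values lie on the boundary of the half-plane. It
  is the limit \<open>\<delta> \<rightarrow> 1\<close> of the distance estimate along a chain of total length less than \<open>D\<close>.
\<close>

lemma cross_bound:
  assumes x: "x \<in> C - {0}" and y: "y \<in> C - {0}" and D: "chain_dist C x y < ennreal D"
    and ml: "m \<in> dual" "l \<in> dual"
  shows "(cmod (cross m l x y))\<^sup>2 \<le> (exp (D / 2) + 1 / exp (D / 2))\<^sup>2 * (form m l x * form m l y)"
proof -
  obtain n X where X: "X 0 = x" "X n = y" "\<And>k. k \<le> n \<Longrightarrow> X k \<in> C - {0}"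
    and sum: "(\<Sum>k<n. gauge_dist C (X k) (X (Suc k))) < ennreal D"
    using D unfolding chain_dist_def Inf_less_iff by auto
  have fin: "(\<Sum>k<n. gauge_dist C (X k) (X (Suc k))) < \<infinity>"
    using sum by (metis ennreal_less_top infinity_ennreal_def less_trans)
  have xC: "x \<in> C" "y \<in> C" using x y by auto
  have chain: "(m x + l x = 0 \<longleftrightarrow> m y + l y = 0) \<and> (m x + l x \<noteq> 0 \<longrightarrow>
      ennreal (disk_dist (of_real \<delta> * ratio m l x) (of_real \<delta> * ratio m l y)) \<le> (\<Sum>k<n. gauge_dist C (X k) (X (Suc k))))"
    if "0 < \<delta>" "\<delta> < 1" for \<delta>
    using gauge_chain[of n X, OF X(3) fin ml that] unfolding X(1,2) by simp
  show ?thesis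
  proof (cases "m x + l x = 0")
    case True
    have both: "m v = 0 \<and> l v = 0" if "v \<in> C" "m v + l v = 0" for v
      using dual_sum_nonzero[OF that(1) ml] that(2) by (metis add.left_neutral)
    have "m y + l y = 0" using chain[of "1/2"] True by simp
    then have "cross m l x y = 0" "form m l x = 0"
      using both[OF xC(1) True] both[OF xC(2)] by (auto simp: cross_def form_def)
    then show ?thesis by simp
  next
    case False
    have ny: "m y + l y \<noteq> 0" using chain[of "1/2"] False by simp
    define a b where "a = ratio m l x" and "b = ratio m l y"
    have ab: "cmod a \<le> 1" "cmod b \<le> 1" unfolding a_def b_def using xC ml by (auto intro: cmod_ratio_le_1)
    have D0: "0 < D" using D by (metis ennreal_neg not_less not_less_zero)
    define K where "K = (cosh (D / 2))\<^sup>2"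
    have K: "0 < K" by (simp add: K_def)
    have dle: "disk_dist (of_real \<delta> * a) (of_real \<delta> * b) \<le> D" if \<delta>: "0 < \<delta>" "\<delta> < 1" for \<delta>
    proof -
      have "ennreal (disk_dist (of_real \<delta> * a) (of_real \<delta> * b)) \<le> ennreal D"
        using chain[OF \<delta>] False sum unfolding a_def b_def by (meson less_imp_le order_trans)
      then show ?thesis using D0 by (simp add: ennreal_le_iff)
    qed
    have "(cmod (1 - of_real (1\<^sup>2) * (cnj a * b)))\<^sup>2 \<le> K * ((1 - 1\<^sup>2 * (cmod a)\<^sup>2) * (1 - 1\<^sup>2 * (cmod b)\<^sup>2))"
    proof (rule limit_from_below_at_1[where f = "\<lambda>\<delta>. (cmod (1 - of_real (\<delta>\<^sup>2) * (cnj a * b)))\<^sup>2" and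
          g = "\<lambda>\<delta>. K * ((1 - \<delta>\<^sup>2 * (cmod a)\<^sup>2) * (1 - \<delta>\<^sup>2 * (cmod b)\<^sup>2))"])
      fix \<delta> :: real assume \<delta>: "0 < \<delta>" "\<delta> < 1"
      define a' b' where "a' = of_real \<delta> * a" and "b' = of_real \<delta> * b"
      have in1: "cmod a' < 1" "cmod b' < 1"
      proof -
        have "\<delta> * cmod a \<le> \<delta>" "\<delta> * cmod b \<le> \<delta>" using \<delta> ab by (simp_all add: mult_left_le)
        then have "\<delta> * cmod a < 1" "\<delta> * cmod b < 1" using \<delta>(2) by linarith+
        then show "cmod a' < 1" "cmod b' < 1" using \<delta> by (simp_all add: a'_def b'_def norm_mult)
      qed
      have "cmod (Moebius_function 0 a' b') \<le> tanh (D / 2)"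
        unfolding cmod_Moebius_eq_tanh[OF in1] using dle[OF \<delta>] by (simp add: a'_def b'_def)
      then have "(cmod (Moebius_function 0 a' b'))\<^sup>2 \<le> (tanh (D / 2))\<^sup>2" by (intro power_mono) auto
      moreover have "1 - (tanh (D / 2))\<^sup>2 = 1 / K"
      proof -
        have "(cosh (D / 2))\<^sup>2 \<noteq> 0" by simp
        then show ?thesis unfolding K_def tanh_def power_divide
          by (metis diff_divide_distrib divide_self hyperbolic_pythagoras)
      qed
      ultimately have "1 / K \<le> (1 - (cmod a')\<^sup>2) * (1 - (cmod b')\<^sup>2) / (cmod (1 - cnj a' * b'))\<^sup>2"
        using Moebius_complement[OF in1] by linarith
      moreover have "0 < (cmod (1 - cnj a' * b'))\<^sup>2" using Moebius_denominator_nonzero[OF in1] by simp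
      ultimately have "(cmod (1 - cnj a' * b'))\<^sup>2 \<le> K * ((1 - (cmod a')\<^sup>2) * (1 - (cmod b')\<^sup>2))"
        using K by (simp add: field_simps)
      then show "(cmod (1 - of_real (\<delta>\<^sup>2) * (cnj a * b)))\<^sup>2 \<le> K * ((1 - \<delta>\<^sup>2 * (cmod a)\<^sup>2) * (1 - \<delta>\<^sup>2 * (cmod b)\<^sup>2))"
        using \<delta> by (simp add: a'_def b'_def norm_mult power_mult_distrib) (simp add: power2_eq_square mult_ac)
    qed (intro continuous_intros)+
    then have main: "(cmod (1 - cnj a * b))\<^sup>2 \<le> K * ((1 - (cmod a)\<^sup>2) * (1 - (cmod b)\<^sup>2))" by simp
    define g h where "g = m x + l x" and "h = m y + l y"
    have gh: "g \<noteq> 0" "h \<noteq> 0" using False ny by (auto simp: g_def h_def)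
    have e1: "2 * cmod (cross m l x y) = cmod g * cmod h * cmod (1 - cnj a * b)"
    proof -
      have "cnj g * h * (1 - cnj a * b) = cnj g * h - cnj (a * g) * (b * h)" by (simp add: algebra_simps)
      also have "a * g = m x - l x" using gh by (simp add: a_def ratio_def g_def)
      also have "b * h = m y - l y" using gh by (simp add: b_def ratio_def h_def)
      finally have "cnj g * h * (1 - cnj a * b) = 2 * cnj (cross m l x y)"
        by (simp add: g_def h_def cross_def algebra_simps)
      from arg_cong[OF this, of cmod] show ?thesis by (simp add: norm_mult)
    qed
    have e2: "(cmod g)\<^sup>2 * (1 - (cmod a)\<^sup>2) = 4 * form m l x"
    proof -
      have "(cmod g)\<^sup>2 * (1 - (cmod a)\<^sup>2) = (cmod g)\<^sup>2 - (cmod (a * g))\<^sup>2" by (simp add: norm_mult power_mult_distrib algebra_simps)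
      also have "a * g = m x - l x" using gh by (simp add: a_def ratio_def g_def)
      finally show ?thesis unfolding cmod_power2 g_def form_def by (simp add: power2_eq_square algebra_simps)
    qed
    have e3: "(cmod h)\<^sup>2 * (1 - (cmod b)\<^sup>2) = 4 * form m l y"
    proof -
      have "(cmod h)\<^sup>2 * (1 - (cmod b)\<^sup>2) = (cmod h)\<^sup>2 - (cmod (b * h))\<^sup>2" by (simp add: norm_mult power_mult_distrib algebra_simps)
      also have "b * h = m y - l y" using gh by (simp add: b_def ratio_def h_def)
      finally show ?thesis unfolding cmod_power2 h_def form_def by (simp add: power2_eq_square algebra_simps)
    qed
    have "(2 * cmod (cross m l x y))\<^sup>2 = ((cmod g)\<^sup>2 * (cmod h)\<^sup>2) * (cmod (1 - cnj a * b))\<^sup>2"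
      unfolding e1 by (simp add: power_mult_distrib)
    also have "\<dots> \<le> ((cmod g)\<^sup>2 * (cmod h)\<^sup>2) * (K * ((1 - (cmod a)\<^sup>2) * (1 - (cmod b)\<^sup>2)))"
      using main by (intro mult_left_mono) auto
    also have "\<dots> = K * (((cmod g)\<^sup>2 * (1 - (cmod a)\<^sup>2)) * ((cmod h)\<^sup>2 * (1 - (cmod b)\<^sup>2)))"
      by (simp only: mult_ac)
    also have "\<dots> = 4 * ((2 * cosh (D / 2))\<^sup>2 * (form m l x * form m l y))"
      unfolding e2 e3 by (simp add: K_def power_mult_distrib)
    finally have "(cmod (cross m l x y))\<^sup>2 \<le> (2 * cosh (D / 2))\<^sup>2 * (form m l x * form m l y)"
      by (simp add: power_mult_distrib mult_ac)
    also have "2 * cosh (D / 2) = exp (D / 2) + 1 / exp (D / 2)"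
      unfolding cosh_field_def by (simp add: exp_minus inverse_eq_divide)
    finally show ?thesis .
  qed
qed

end


section \<open>An upper bound for the distance in a slice\<close>

context quadrant_cone begin

lemma form_scale: "m \<in> dual \<Longrightarrow> l \<in> dual \<Longrightarrow> form m l (c *\<^sub>C v) = (cmod c)\<^sup>2 * form m l v"
  using form_combination[OF dualD dualD, of m l c v 0 v] by simp

lemma cross_scale: "m \<in> dual \<Longrightarrow> l \<in> dual \<Longrightarrow> cross m l (c *\<^sub>C X) (d *\<^sub>C Y) = c * cnj d * cross m l X Y"
  by (simp add: cross_def complex_linear_scale dualD algebra_simps)

text \<open>
  The values of \<open>m / l\<close> at \<open>X\<close> and \<open>Y\<close> have half-plane distance at most \<open>2 * ln G\<close>, for all \<open>m\<close> and
  \<open>l\<close>.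
\<close>

definition cross_bounded :: "real \<Rightarrow> 'a \<Rightarrow> 'a \<Rightarrow> bool"
  where "cross_bounded G X Y \<longleftrightarrow> (\<forall>m\<in>dual. \<forall>l\<in>dual.
    (cmod (cross m l X Y))\<^sup>2 \<le> (G + 1 / G)\<^sup>2 * (form m l X * form m l Y))"

lemma cross_bounded_scale:
  assumes "cross_bounded G X Y"
  shows "cross_bounded G (c *\<^sub>C X) (d *\<^sub>C Y)"
  unfolding cross_bounded_def
proof (intro ballI)
  fix m l assume ml: "m \<in> dual" "l \<in> dual"
  have "(cmod (c * cnj d * cross m l X Y))\<^sup>2 = ((cmod c)\<^sup>2 * (cmod d)\<^sup>2) * (cmod (cross m l X Y))\<^sup>2"
    by (simp add: norm_mult power_mult_distrib)
  also have "\<dots> \<le> ((cmod c)\<^sup>2 * (cmod d)\<^sup>2) * ((G + 1 / G)\<^sup>2 * (form m l X * form m l Y))"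
    using assms ml unfolding cross_bounded_def by (intro mult_left_mono) auto
  finally show "(cmod (cross m l (c *\<^sub>C X) (d *\<^sub>C Y)))\<^sup>2
      \<le> (G + 1 / G)\<^sup>2 * (form m l (c *\<^sub>C X) * form m l (d *\<^sub>C Y))"
    by (simp only: cross_scale[OF ml] form_scale[OF ml] mult_ac)
qed

text \<open>
  \<open>half_plane_ratio\<close> for the values of \<open>m / l\<close>, without denominators.
\<close>

lemma cross_quotient:
  fixes m l :: "'a \<Rightarrow> complex"
  assumes X: "X \<in> C" and Y: "Y \<in> C" and ml: "m \<in> dual" "l \<in> dual" and G: "1 < G"
    and cb: "cross_bounded G X Y" and l: "l X \<noteq> 0" "l Y \<noteq> 0"
  shows "0 < form m l X \<Longrightarrow> 0 < form m l Y \<Longrightarrow> form m l Y * (cmod (l X))\<^sup>2 \<le> G\<^sup>2 * (form m l X * (cmod (l Y))\<^sup>2)"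
    and "0 < form m l X \<Longrightarrow> 0 < form m l Y \<Longrightarrow> form m l X * (cmod (l Y))\<^sup>2 \<le> G\<^sup>2 * (form m l Y * (cmod (l X))\<^sup>2)"
    and "cmod (m Y) * cmod (l X) \<le> G\<^sup>2 * (cmod (m X) * cmod (l Y))"
proof -
  define a b where "a = m X / l X" and "b = m Y / l Y"
  define u v where "u = (cmod (l X))\<^sup>2" and "v = (cmod (l Y))\<^sup>2"
  have u: "0 < u" "0 < v" using l by (auto simp: u_def v_def)
  have mX: "m X = a * l X" and mY: "m Y = b * l Y" using l by (simp_all add: a_def b_def)
  have fX: "form m l X = Re a * u" and fY: "form m l Y = Re b * v"
    unfolding form_def mX mY u_def v_def mult.assoc complex_norm_square[symmetric] by simp_all
  have cr: "cross m l X Y = (a + cnj b) * (l X * cnj (l Y))" by (simp add: cross_def mX mY algebra_simps)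
  have "(cmod (a + cnj b))\<^sup>2 * (u * v) \<le> ((G + 1 / G)\<^sup>2 * (Re a * Re b)) * (u * v)"
  proof -
    have "(cmod (cross m l X Y))\<^sup>2 \<le> (G + 1 / G)\<^sup>2 * (form m l X * form m l Y)"
      using cb ml unfolding cross_bounded_def by blast
    then show ?thesis by (simp add: cr fX fY norm_mult power_mult_distrib u_def v_def mult_ac)
  qed
  then have le: "(cmod (a + cnj b))\<^sup>2 \<le> (G + 1 / G)\<^sup>2 * (Re a * Re b)"
    by (rule mult_right_le_imp_le) (use u in simp)
  have "a + cnj b = cnj (b + cnj a)" by simp
  then have "cmod (a + cnj b) = cmod (b + cnj a)" by (simp only: complex_mod_cnj)
  then have le': "(cmod (b + cnj a))\<^sup>2 \<le> (G + 1 / G)\<^sup>2 * (Re b * Re a)" using le by (simp only: mult.commute)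
  have main: "Re b \<le> G\<^sup>2 * Re a" "Re a \<le> G\<^sup>2 * Re b" "cmod b \<le> G\<^sup>2 * cmod a" if "0 < Re a" "0 < Re b"
    using half_plane_ratio[OF that G le] half_plane_ratio[OF that(2,1) G le'] by auto
  {
    assume "0 < form m l X" "0 < form m l Y"
    then have pos: "0 < Re a" "0 < Re b" using u by (auto simp: fX fY zero_less_mult_iff)
    have "Re b * (u * v) \<le> (G\<^sup>2 * Re a) * (u * v)" "Re a * (u * v) \<le> (G\<^sup>2 * Re b) * (u * v)"
      using main(1,2)[OF pos] u by (auto intro!: mult_right_mono)
    then show "form m l Y * (cmod (l X))\<^sup>2 \<le> G\<^sup>2 * (form m l X * (cmod (l Y))\<^sup>2)"
        "form m l X * (cmod (l Y))\<^sup>2 \<le> G\<^sup>2 * (form m l Y * (cmod (l X))\<^sup>2)"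
      unfolding fX fY u_def[symmetric] v_def[symmetric] by (simp_all only: mult_ac)
  }
  have ba: "cmod b \<le> G\<^sup>2 * cmod a"
  proof (cases "0 < Re a \<and> 0 < Re b")
    case True then show ?thesis using main(3) by blast
  next
    case False
    have "0 \<le> Re a" "0 \<le> Re b"
      using form_nonneg[OF X ml] form_nonneg[OF Y ml] u by (auto simp: fX fY zero_le_mult_iff)
    then have "Re a * Re b = 0" using False by auto
    then have "(cmod (a + cnj b))\<^sup>2 \<le> 0" using le by (simp only: mult_zero_right)
    then have "a + cnj b = 0" by simp
    then have "cmod a = cmod b" by (metis add_eq_0_iff complex_mod_cnj norm_minus_cancel)
    then show ?thesis using G mult_right_mono[of 1 "G\<^sup>2" "cmod a"] by (simp add: one_le_power)
  qed
  have "cmod (m Y) * cmod (l X) = cmod b * (cmod (l X) * cmod (l Y))" by (simp add: mY norm_mult mult_ac)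
  also have "\<dots> \<le> (G\<^sup>2 * cmod a) * (cmod (l X) * cmod (l Y))" using ba by (intro mult_right_mono) auto
  also have "\<dots> = G\<^sup>2 * (cmod (m X) * cmod (l Y))" by (simp add: mX norm_mult mult_ac)
  finally show "cmod (m Y) * cmod (l X) \<le> G\<^sup>2 * (cmod (m X) * cmod (l Y))" .
qed

text \<open>
  Compare \<open>form m l\<close> with \<open>form l l\<close>, then \<open>form l l\<close> with \<open>form l' l'\<close>, and then that with
  \<open>form m' l'\<close>. The three steps cost the factors \<open>G\<^sup>2\<close>, \<open>G ^ 4\<close> and \<open>G\<^sup>2\<close>.
\<close>

lemma form_quotients_comparable:
  assumes X: "X \<in> C" and Y: "Y \<in> C" and G: "1 < G" and cb: "cross_bounded G X Y"
    and ml: "m \<in> dual" "l \<in> dual" "0 < form m l X" "0 < form m l Y"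
    and ml': "m' \<in> dual" "l' \<in> dual" "0 < form m' l' X" "0 < form m' l' Y"
  shows "form m l Y / form m l X \<le> G ^ 8 * (form m' l' Y / form m' l' X)"
proof -
  have nz: "l X \<noteq> 0" "l Y \<noteq> 0" "l' X \<noteq> 0" "l' Y \<noteq> 0" using ml ml' by (auto simp: form_def)
  define u v u' v' where "u = (cmod (l X))\<^sup>2" and "v = (cmod (l Y))\<^sup>2"
    and "u' = (cmod (l' X))\<^sup>2" and "v' = (cmod (l' Y))\<^sup>2"
  have pos: "0 < u" "0 < v" "0 < u'" "0 < v'" using nz by (auto simp: u_def v_def u'_def v'_def)
  define P Q P' Q' where "P = form m l X" and "Q = form m l Y" and "P' = form m' l' X" and "Q' = form m' l' Y"
  have PQ: "0 < P" "0 < Q" "0 < P'" "0 < Q'" using ml ml' by (auto simp: P_def Q_def P'_def Q'_def)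
  have 1: "Q * u \<le> G\<^sup>2 * (P * v)"
    unfolding Q_def u_def P_def v_def using ml nz by (intro cross_quotient(1)[OF X Y _ _ G cb]) auto
  have 2: "P' * v' \<le> G\<^sup>2 * (Q' * u')"
    unfolding Q'_def u'_def P'_def v'_def using ml' nz by (intro cross_quotient(2)[OF X Y _ _ G cb]) auto
  have "cmod (l Y) * cmod (l' X) \<le> G\<^sup>2 * (cmod (l X) * cmod (l' Y))"
    using ml ml' nz by (intro cross_quotient(3)[OF X Y _ _ G cb]) auto
  then have "(cmod (l Y) * cmod (l' X))\<^sup>2 \<le> (G\<^sup>2 * (cmod (l X) * cmod (l' Y)))\<^sup>2" by (intro power_mono) auto
  then have 3: "v * u' \<le> G ^ 4 * (u * v')" by (simp add: power_mult_distrib u_def v_def u'_def v'_def flip: power_mult)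
  have "(Q * P') * (u * v') = (Q * u) * (P' * v')" by (simp only: mult_ac)
  also have "\<dots> \<le> (G\<^sup>2 * (P * v)) * (G\<^sup>2 * (Q' * u'))"
    by (rule mult_mono[OF 1 2]) (use PQ pos in auto)
  also have "\<dots> = (G ^ 4 * (P * Q')) * (v * u')" by (simp add: power2_eq_square power4_eq_xxxx)
  also have "\<dots> \<le> (G ^ 4 * (P * Q')) * (G ^ 4 * (u * v'))" using 3 PQ G by (intro mult_left_mono) auto
  also have "\<dots> = (G ^ 8 * (P * Q')) * (u * v')" by (simp flip: power_add)
  finally have "Q * P' \<le> G ^ 8 * (P * Q')" by (rule mult_right_le_imp_le) (use pos in simp)
  then have "Q / P \<le> G ^ 8 * (Q' / P')" using PQ by (simp add: field_simps)
  then show ?thesis by (simp add: P_def Q_def P'_def Q'_def)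
qed

text \<open>
  Put the geometric mean of the extreme bounds for \<open>form m l Y / form m l X\<close> at \<open>1\<close>: these quotients
  lie in an interval \<open>[i, G ^ 8 * i]\<close>, and \<open>\<sigma>\<^sup>2\<close> is \<open>G ^ 4 * i\<close>.
\<close>

lemma balancing_scale:
  assumes X: "X \<in> C" and Y: "Y \<in> C" and G: "1 < G" and cb: "cross_bounded G X Y"
  obtains \<sigma> where "0 < \<sigma>" "\<And>m l. m \<in> dual \<Longrightarrow> l \<in> dual \<Longrightarrow> 0 < form m l X \<Longrightarrow> 0 < form m l Y \<Longrightarrow>
     form m l X \<le> G ^ 4 * (form m l Y / \<sigma>\<^sup>2) \<and> form m l Y / \<sigma>\<^sup>2 \<le> G ^ 4 * form m l X"
proof -
  define B where "B = {form m l Y / form m l X |m l. m \<in> dual \<and> l \<in> dual \<and> 0 < form m l X \<and> 0 < form m l Y}"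
  show thesis
  proof (cases "B = {}")
    case True then show thesis by (intro that[of 1]) (auto simp: B_def)
  next
    case False
    have comp: "q \<le> G ^ 8 * q'" if "q \<in> B" "q' \<in> B" for q q'
      using that unfolding B_def by (auto intro: form_quotients_comparable[OF X Y G cb])
    obtain q0 where q0: "q0 \<in> B" using False by auto
    then have q0pos: "0 < q0" by (auto simp: B_def)
    have G8: "0 < G ^ 8" using G by simp
    define i where "i = Inf B"
    have bdd: "bdd_below B" by (rule bdd_belowI[of _ 0]) (auto simp: B_def intro: less_imp_le)
    have low: "i \<le> q" if "q \<in> B" for q unfolding i_def by (rule cInf_lower[OF that bdd])
    have up: "q \<le> G ^ 8 * i" if q: "q \<in> B" for q
    proof -
      have "q / G ^ 8 \<le> i" unfolding i_def
        using comp[OF q] G8 by (intro cInf_greatest[OF False]) (simp add: divide_le_eq mult.commute)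
      then show ?thesis using G8 by (simp add: divide_le_eq mult.commute)
    qed
    have i: "0 < i" using up[OF q0] q0pos G8 by (metis less_le_trans zero_less_mult_pos)
    define \<sigma> where "\<sigma> = G\<^sup>2 * sqrt i"
    have \<sigma>: "0 < \<sigma>" using G i by (simp add: \<sigma>_def)
    have \<sigma>2: "\<sigma>\<^sup>2 = G ^ 4 * i" using i by (simp add: \<sigma>_def power_mult_distrib flip: power_mult)
    show thesis
    proof (rule that[OF \<sigma>])
      fix m l assume a: "m \<in> dual" "l \<in> dual" "0 < form m l X" "0 < form m l Y"
      then have q: "form m l Y / form m l X \<in> B" unfolding B_def by blast
      have 1: "i * form m l X \<le> form m l Y" using low[OF q] a by (simp add: pos_le_divide_eq)
      have 2: "form m l Y \<le> G ^ 8 * i * form m l X" using up[OF q] a by (simp add: pos_divide_le_eq)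
      have "G ^ 4 * (form m l Y / \<sigma>\<^sup>2) = form m l Y / i" using G i by (simp add: \<sigma>2)
      moreover have "form m l X \<le> form m l Y / i" using 1 i by (simp add: pos_le_divide_eq mult.commute)
      moreover have "form m l Y / \<sigma>\<^sup>2 \<le> G ^ 4 * form m l X"
      proof -
        have "G ^ 8 = G ^ 4 * G ^ 4" by (simp flip: power_add)
        then have "G ^ 8 * i * form m l X = G ^ 4 * form m l X * \<sigma>\<^sup>2" unfolding \<sigma>2 by (simp only: mult_ac)
        then have "form m l Y \<le> G ^ 4 * form m l X * \<sigma>\<^sup>2" using 2 by (simp only:)
        moreover have "0 < \<sigma>\<^sup>2" using \<sigma> by simp
        ultimately show ?thesis by (simp only: pos_divide_le_eq)
      qed
      ultimately show "form m l X \<le> G ^ 4 * (form m l Y / \<sigma>\<^sup>2) \<and> form m l Y / \<sigma>\<^sup>2 \<le> G ^ 4 * form m l X" by simp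
    qed
  qed
qed

text \<open>
  Rotate the vectors of the two points into \<open>R\<close> and scale one of them as in \<open>balancing_scale\<close>. By
  \<open>lens_region\<close> and \<open>lens_form_nonneg\<close>, the vectors \<open>\<zeta> X - Y\<close> with \<open>\<zeta>\<close> in the lens lie in \<open>C\<close>. This
  parametrizes a part of the slice by a wedge, in which \<open>1\<close> and \<open>r\<^sup>2\<close> stand for the two points, and
  Schwarz-Pick bounds their distance in the slice by their distance in the wedge.
\<close>

lemma slice_distance_bound:
  assumes e: "e \<notin> C" and f: "f holomorphic_on interior (slice x e)" "f ` interior (slice x e) \<subseteq> ball 0 1"
    and w: "w1 \<in> interior (slice x e)" "w2 \<in> interior (slice x e)" and G: "1 < G"
    and cb: "cross_bounded G (x + w1 *\<^sub>C e) (x + w2 *\<^sub>C e)"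
  shows "disk_dist (f w1) (f w2) \<le> sqrt 2 * pi * G\<^sup>2"
proof (cases "w1 = w2")
  case True then show ?thesis by (simp add: disk_dist_self)
next
  case False
  have inC: "x + w1 *\<^sub>C e \<in> C" "x + w2 *\<^sub>C e \<in> C" using w interior_subset by (auto simp: slice_def)
  obtain c1 where c1: "c1 \<noteq> 0" "c1 *\<^sub>C (x + w1 *\<^sub>C e) \<in> R" using C_obtain[OF inC(1)] by metis
  obtain d2 where d2: "d2 \<noteq> 0" "d2 *\<^sub>C (x + w2 *\<^sub>C e) \<in> R" using C_obtain[OF inC(2)] by metis
  define X Y0 where "X = c1 *\<^sub>C (x + w1 *\<^sub>C e)" and "Y0 = d2 *\<^sub>C (x + w2 *\<^sub>C e)"
  have XY: "X \<in> C" "Y0 \<in> C" using c1 d2 R_subset_C by (auto simp: X_def Y0_def)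
  have cb0: "cross_bounded G X Y0" unfolding X_def Y0_def by (rule cross_bounded_scale[OF cb])
  obtain \<sigma> where \<sigma>: "0 < \<sigma>" and bal: "\<And>m l. m \<in> dual \<Longrightarrow> l \<in> dual \<Longrightarrow> 0 < form m l X \<Longrightarrow> 0 < form m l Y0 \<Longrightarrow>
     form m l X \<le> G ^ 4 * (form m l Y0 / \<sigma>\<^sup>2) \<and> form m l Y0 / \<sigma>\<^sup>2 \<le> G ^ 4 * form m l X"
    using balancing_scale[OF XY G cb0] by blast
  define c2 where "c2 = of_real (1 / \<sigma>) * d2"
  define Y where "Y = c2 *\<^sub>C (x + w2 *\<^sub>C e)"
  have c2: "c2 \<noteq> 0" using d2 \<sigma> by (simp add: c2_def)
  have YY0: "Y = (1 / \<sigma>) *\<^sub>R Y0" "Y = of_real (1 / \<sigma>) *\<^sub>C Y0"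
    by (simp_all add: Y_def Y0_def c2_def scaleC_scaleC flip: scaleC_of_real)
  have XR: "X \<in> R" "Y \<in> R" using c1 d2 \<sigma> unfolding YY0(1) by (auto simp: X_def Y0_def intro!: R_scale)
  have cbY: "cross_bounded G X Y"
    using cross_bounded_scale[OF cb0, of 1 "of_real (1 / \<sigma>)"] by (simp add: YY0(2) scaleC_one)
  have fY: "form m l Y = form m l Y0 / \<sigma>\<^sup>2" if "m \<in> dual" "l \<in> dual" for m l
    unfolding YY0(2) form_scale[OF that] using \<sigma> by (simp add: norm_divide power_divide)
  \<comment> \<open>The balanced quotients are at least \<open>1 / G ^ 4\<close>, and this is the radius up to which \<open>Y\<close> dominates.\<close>
  define r where "r = 1 / G ^ 3"
  have r: "0 < r" "r < 1" using G by (auto simp: r_def divide_less_eq one_less_power)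
  define \<kappa> where "\<kappa> = (1 - r\<^sup>2) / ((1 + r\<^sup>2) * G)"
  define \<psi> where "\<psi> = arctan \<kappa>"
  have \<kappa>: "0 < \<kappa>" unfolding \<kappa>_def using r G by (intro divide_pos_pos mult_pos_pos) (auto simp: power_less_one_iff add_pos_nonneg)
  have \<psi>: "0 < \<psi>" "\<psi> < pi / 2" "tan \<psi> = \<kappa>" using \<kappa> arctan_ubound by (auto simp: \<psi>_def tan_arctan)
  define V where "V = {s. 0 < Re s \<and> \<bar>Im s\<bar> < \<kappa> * Re s}"
  have V: "open V" unfolding V_def by (intro open_Collect_conj open_Collect_less continuous_intros)
  have vC: "(of_real r - s / of_real r) *\<^sub>C X - (1 - s) *\<^sub>C Y \<in> C" if s: "s \<in> V" for s
  proof (cases "s = 1")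
    case True
    then show ?thesis using C_scale_iff[of "of_real r - 1 / of_real r" X] XY r
      by (cases "of_real r - 1 / complex_of_real r = 0") (auto simp: zero_in_C)
  next
    case False
    define \<zeta> where "\<zeta> = (of_real r - s / of_real r) / (1 - s)"
    have \<zeta>: "\<zeta> * (1 - s) = of_real r - s / of_real r" using False by (simp add: \<zeta>_def)
    have reg: "cmod \<zeta> \<le> r \<or> 1 / r \<le> cmod \<zeta> \<or> G * \<bar>Im \<zeta>\<bar> < cmod \<zeta> - Re \<zeta>"
      using s G by (intro lens_region[OF r _ \<zeta>]) (auto simp: V_def \<kappa>_def)
    have "\<zeta> *\<^sub>C X + (-1) *\<^sub>C Y \<in> C"
      unfolding in_C_iff_form
    proof (intro ballI)
      fix m l assume ml: "m \<in> dual" "l \<in> dual"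
      have "0 \<le> (cmod \<zeta>)\<^sup>2 * form m l X + form m l Y - Re (\<zeta> * cross m l X Y)"
      proof (rule lens_form_nonneg[OF G])
        show "0 \<le> form m l X" "0 \<le> form m l Y" using XR R_subset_C ml by (auto intro: form_nonneg)
        show "0 \<le> Re (cross m l X Y)" using XR ml by (rule cross_nonneg)
        show "(cmod (cross m l X Y))\<^sup>2 \<le> (G + 1 / G)\<^sup>2 * (form m l X * form m l Y)"
          using cbY ml unfolding cross_bounded_def by blast
        show "form m l X \<le> G ^ 4 * form m l Y \<and> form m l Y \<le> G ^ 4 * form m l X" if "0 < form m l X" "0 < form m l Y"
          using bal[OF ml that(1)] that(2) \<sigma> unfolding fY[OF ml] by (simp add: zero_less_divide_iff)
        show "cmod \<zeta> \<le> 1 / G ^ 3 \<or> G ^ 3 \<le> cmod \<zeta> \<or> G * \<bar>Im \<zeta>\<bar> < cmod \<zeta> - Re \<zeta>"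
          using reg by (simp add: r_def)
      qed
      then show "0 \<le> form m l (\<zeta> *\<^sub>C X + (-1) *\<^sub>C Y)"
        unfolding form_combination[OF dualD[OF ml(1)] dualD[OF ml(2)]] by simp
    qed
    then have "(1 - s) *\<^sub>C (\<zeta> *\<^sub>C X + (-1) *\<^sub>C Y) \<in> C" using False by (subst C_scale_iff) auto
    also have "(1 - s) *\<^sub>C (\<zeta> *\<^sub>C X + (-1) *\<^sub>C Y) = (\<zeta> * (1 - s)) *\<^sub>C X - (1 - s) *\<^sub>C Y"
      by (simp add: scaleC_add_right scaleC_scaleC scaleC_minus_left scaleC_minus_right scaleC_diff_right scaleC_one mult.commute)
    finally show ?thesis unfolding \<zeta> .
  qed
  define \<rho> where "\<rho> = complex_of_real r"
  have \<rho>: "\<rho> \<noteq> 0" using r by (simp add: \<rho>_def)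
  have \<rho>1: "\<rho> * \<rho> \<noteq> 1"
  proof -
    have "r * r < 1 * 1" using r by (intro mult_strict_mono') auto
    then show ?thesis unfolding \<rho>_def by (metis less_irrefl mult_1 of_real_eq_1_iff of_real_mult)
  qed
  have \<rho>2: "\<rho> - 1 / \<rho> \<noteq> 0" using \<rho> \<rho>1 by (simp add: field_simps)
  define a0 a1 b0 b1 where "a0 = \<rho> * c1 - c2" and "a1 = c2 - c1 / \<rho>"
    and "b0 = \<rho> * c1 * w1 - c2 * w2" and "b1 = c2 * w2 - c1 * w1 / \<rho>"
  have line: "(a0 + a1 * s) *\<^sub>C x + (b0 + b1 * s) *\<^sub>C e = (of_real r - s / of_real r) *\<^sub>C X - (1 - s) *\<^sub>C Y" for s
  proof -
    have A: "a0 + a1 * s = (\<rho> - s / \<rho>) * c1 - (1 - s) * c2" and B: "b0 + b1 * s = (\<rho> - s / \<rho>) * c1 * w1 - (1 - s) * c2 * w2"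
      by (simp_all add: a0_def a1_def b0_def b1_def algebra_simps)
    show ?thesis unfolding A B X_def Y_def \<rho>_def[symmetric]
      by (simp add: scaleC_add_right scaleC_scaleC scaleC_diff_left mult.assoc)
  qed
  \<comment> \<open>The wedge parametrization is nondegenerate as \<open>w1 \<noteq> w2\<close> and \<open>r \<noteq> 1\<close>.\<close>
  have det: "a0 * b1 \<noteq> a1 * b0"
  proof
    assume "a0 * b1 = a1 * b0"
    moreover have "a0 * b1 - a1 * b0 = c1 * c2 * (w2 - w1) * (\<rho> - 1 / \<rho>)"
      using \<rho> by (simp add: a0_def a1_def b0_def b1_def field_simps)
    ultimately show False using c1 c2 False \<rho>2 by simp
  qed
  have lineC: "(a0 + a1 * s) *\<^sub>C x + (b0 + b1 * s) *\<^sub>C e \<in> C" if "s \<in> V" for s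
    unfolding line by (rule vC[OF that])
  define k where "k = (\<lambda>s. (b0 + b1 * s) / (a0 + a1 * s))"
  have k: "k holomorphic_on V" "k ` V \<subseteq> interior (slice x e)"
    unfolding k_def using Moebius_curve_in_interior(2,3)[OF e V det lineC] by auto
  have k1: "k 1 = w1"
  proof -
    have "b0 + b1 * 1 = (c1 * (\<rho> - 1 / \<rho>)) * w1" "a0 + a1 * 1 = c1 * (\<rho> - 1 / \<rho>)"
      by (simp_all add: a0_def a1_def b0_def b1_def algebra_simps)
    then show ?thesis using c1 \<rho>2 by (simp add: k_def)
  qed
  have k2: "k (of_real (r\<^sup>2)) = w2"
  proof -
    have "b0 + b1 * (\<rho> * \<rho>) = (c2 * (\<rho> * \<rho> - 1)) * w2" "a0 + a1 * (\<rho> * \<rho>) = c2 * (\<rho> * \<rho> - 1)"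
      using \<rho> by (simp_all add: a0_def a1_def b0_def b1_def field_simps)
    then show ?thesis using c2 \<rho>1 by (simp add: k_def \<rho>_def power2_eq_square)
  qed
  obtain \<mu> \<tau> where \<mu>: "\<mu> holomorphic_on ball 0 1"
      "\<And>\<xi>. cmod \<xi> < 1 \<Longrightarrow> 0 < Re (\<mu> \<xi>) \<and> \<bar>Im (\<mu> \<xi>)\<bar> < tan \<psi> * Re (\<mu> \<xi>)"
      "cmod \<tau> < 1" "\<mu> 0 = 1" "\<mu> \<tau> = of_real (r\<^sup>2)" "disk_dist 0 \<tau> = - (pi / \<psi>) * ln r"
    using wedge_map[OF \<psi>(1,2) r] by blast
  have \<mu>V: "\<mu> \<xi> \<in> V" if "\<xi> \<in> ball 0 1" for \<xi> using \<mu>(2)[of \<xi>] that by (simp add: V_def \<psi>(3))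
  define h where "h = (\<lambda>\<xi>. f (k (\<mu> \<xi>)))"
  have "h holomorphic_on ball 0 1"
    unfolding h_def using \<mu>V k(2) by (intro holomorphic_on_comp[OF holomorphic_on_comp[OF \<mu>(1) k(1)] f(1)]) auto
  moreover have "h ` ball 0 1 \<subseteq> ball 0 1" unfolding h_def using \<mu>V k(2) f(2) by blast
  ultimately have "disk_dist (h 0) (h \<tau>) \<le> disk_dist 0 \<tau>" using \<mu>(3) by (intro Schwarz_Pick) auto
  also have "disk_dist 0 \<tau> = pi / \<psi> * (3 * ln G)"
    using G by (simp add: \<mu>(6) r_def ln_div ln_realpow)
  also have "\<dots> \<le> pi / \<psi> * (sqrt 2 * G\<^sup>2 * \<psi>)"
    using lens_width_bound[OF G r_def] \<psi>(1) by (intro mult_left_mono) (auto simp: \<psi>_def \<kappa>_def)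
  also have "\<dots> = sqrt 2 * pi * G\<^sup>2" using \<psi>(1) by simp
  finally show ?thesis unfolding h_def \<mu>(4,5) k1 k2 .
qed

end

section \<open>Contraction\<close>

lemma le_mult_Inf_ennreal:
  fixes P :: ennreal
  assumes \<kappa>: "0 < \<kappa>" and le: "\<And>s. s \<in> S \<Longrightarrow> P \<le> ennreal \<kappa> * s"
  shows "P \<le> ennreal \<kappa> * Inf S"
proof -
  have "ennreal (1 / \<kappa>) * P \<le> Inf S"
  proof (rule Inf_greatest)
    fix s assume "s \<in> S"
    then have "ennreal (1 / \<kappa>) * P \<le> ennreal (1 / \<kappa>) * (ennreal \<kappa> * s)" by (intro mult_left_mono le) auto
    also have "\<dots> = s" using \<kappa> by (simp add: mult.assoc[symmetric] flip: ennreal_mult)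
    finally show "ennreal (1 / \<kappa>) * P \<le> s" .
  qed
  then have "ennreal \<kappa> * (ennreal (1 / \<kappa>) * P) \<le> ennreal \<kappa> * Inf S" by (intro mult_left_mono) auto
  then show ?thesis using \<kappa> by (simp add: mult.assoc[symmetric] flip: ennreal_mult)
qed

context proper_quadrant_cone begin

lemma cross_bounded_of_chain_dist:
  assumes "x \<in> C - {0}" "y \<in> C - {0}" "chain_dist C x y \<le> ennreal D" and G: "exp (D / 2) < G" and D: "0 \<le> D"
  shows "cross_bounded G x y"
proof -
  have G0: "0 < G" using G exp_gt_zero less_trans by blast
  have "D / 2 < ln G" using G G0 by (metis exp_less_cancel_iff exp_ln)
  then have "D < 2 * ln G" by simp
  then have lt: "chain_dist C x y < ennreal (2 * ln G)"
    using assms(3) D by (meson ennreal_lessI le_less_trans less_le_trans not_le)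
  have "exp (2 * ln G / 2) = G" using G0 by simp
  then show ?thesis
    unfolding cross_bounded_def using cross_bound[OF assms(1,2) lt] by simp
qed

text \<open>
  The Riemann map of the slice of \<open>T x, T y\<close>, composed with any Riemann map of the domain of
  \<open>x, y\<close>, is a map of the disk to itself. Its image has diameter at most \<open>sqrt 2 * pi * exp D\<close>, as its points stand
  for vectors in the image of \<open>T\<close>, and \<open>disk_contraction\<close> applies.
\<close>

theorem gauge_contraction:
  assumes C1: "complex_cone C1" and T: "Vector_Spaces.linear scaleC scaleC T"
    and TC: "T ` (C1 - {0}) \<subseteq> C - {0}"
    and D: "0 \<le> D" "\<And>u v. u \<in> C1 - {0} \<Longrightarrow> v \<in> C1 - {0} \<Longrightarrow> chain_dist C (T u) (T v) \<le> ennreal D"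
    and x: "x \<in> C1 - {0}" and y: "y \<in> C1 - {0}"
  shows "gauge_dist C (T x) (T y) \<le> ennreal (tanh (pi * exp D / (2 * sqrt 2))) * gauge_dist C1 x y"
proof -
  have Tadd: "T (u + v) = T u + T v" and Tscale: "T (c *\<^sub>C u) = c *\<^sub>C T u" for u v c
    using T by (auto simp: Vector_Spaces.linear_iff)
  have Tdiff: "T (u - v) = T u - T v" for u v
    using Tadd[of "u - v" v] by (simp add: algebra_simps)
  have T0: "T 0 = 0" using Tscale[of 0 0] by simp
  define \<Delta> where "\<Delta> = sqrt 2 * pi * exp D"
  have "pi * exp D / (2 * sqrt 2) = pi * exp D / 4 * (2 / sqrt 2)" by simp
  also have "2 / sqrt 2 = sqrt 2" by (rule real_div_sqrt) simp
  finally have const: "pi * exp D / (2 * sqrt 2) = \<Delta> / 4" by (simp only: \<Delta>_def mult_ac times_divide_eq_left times_divide_eq_right)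
  define \<kappa> where "\<kappa> = tanh (\<Delta> / 4)"
  have \<kappa>: "0 < \<kappa>" by (simp add: \<kappa>_def \<Delta>_def)
  have "gauge_dist C (T x) (T y) \<le> ennreal \<kappa> * gauge_dist C1 x y"
  proof (cases "clin_indep (T x) (T y)")
    case False then show ?thesis by (simp add: gauge_dist_def)
  next
    case indT: True
    have ind: "clin_indep x y"
      unfolding clin_indep_iff
    proof (intro allI impI)
      fix a b assume "a *\<^sub>C x + b *\<^sub>C y = 0"
      then have "a *\<^sub>C T x + b *\<^sub>C T y = 0" using T0 by (simp flip: Tadd Tscale)
      then show "a = 0 \<and> b = 0" using indT unfolding clin_indep_iff by blast
    qed
    have xC: "T x \<in> C" using x TC by auto
    have nz: "a *\<^sub>C x - b *\<^sub>C y \<noteq> 0" if "a \<noteq> 0 \<or> b \<noteq> 0" for a b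
      using ind that unfolding clin_indep_iff by (metis diff_conv_add_uminus neg_equal_0_iff_equal scaleC_minus_left)
    have lines: "z *\<^sub>C T x - T y \<in> C" if "z *\<^sub>C x - y \<in> C1" for z
    proof -
      have "z *\<^sub>C x - y \<in> C1 - {0}" using that nz[of z 1] by (auto simp: scaleC_one)
      then have "T (z *\<^sub>C x - y) \<in> C" using TC by blast
      then show ?thesis by (simp add: Tdiff Tscale)
    qed
    have sub: "cone_L_interior C1 x y \<subseteq> cone_L_interior C (T x) (T y)"
      by (rule cone_L_interior_mono) (rule lines)
    show ?thesis
    proof (cases "Some 0 \<in> cone_L_interior C1 x y \<and> None \<in> cone_L_interior C1 x y")
      case False
      then have "gauge_dist C1 x y = \<infinity>" using ind by (auto simp: gauge_dist_def)
      then show ?thesis using \<kappa> by (simp add: ennreal_mult_top)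
    next
      case int: True
      obtain p where p: "p *\<^sub>C T x - T y \<notin> C" using obtains_pole[OF xC indT] .
      define e where "e = p *\<^sub>C T x - T y"
      note iff = cone_L_interior_iff[OF p xC, folded e_def]
      have eC: "e \<notin> C" using p by (simp add: e_def)
      have O0: "0 \<in> interior (slice (T x) e)" using int sub iff[of None] by (auto simp: chart_def)
      obtain f g where f: "f holomorphic_on interior (slice (T x) e)"
          "\<And>w. w \<in> interior (slice (T x) e) \<Longrightarrow> f w \<in> ball 0 1" "\<And>w. w \<in> interior (slice (T x) e) \<Longrightarrow> g (f w) = w"
        and g: "g holomorphic_on ball 0 1"
          "\<And>z. z \<in> ball 0 1 \<Longrightarrow> g z \<in> interior (slice (T x) e)" "\<And>z. z \<in> ball 0 1 \<Longrightarrow> f (g z) = z"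
        using slice_Riemann_map[OF eC O0] by metis
      have upper: "poincare_dist (cone_L_interior C (T x) (T y)) q1 q2 \<le> ennreal (disk_dist (f (chart p q1)) (f (chart p q2)))"
        if q: "q1 \<in> cone_L_interior C (T x) (T y)" "q2 \<in> cone_L_interior C (T x) (T y)" for q1 q2
        unfolding poincare_dist_def
      proof (rule Inf_lower, rule CollectI, intro exI conjI)
        let ?F = "\<lambda>\<xi>. inv_chart p (g \<xi>)"
        show "sphere_holomorphic_on ?F (ball 0 1)" by (rule inv_chart_holomorphic[OF g(1) open_ball])
        show "bij_betw ?F (ball 0 1) (cone_L_interior C (T x) (T y))"
        proof (rule bij_betw_byWitness[where f' = "\<lambda>q. f (chart p q)"])
          show "\<forall>\<xi>\<in>ball 0 1. f (chart p (?F \<xi>)) = \<xi>" using g(3) by (simp add: chart_inv_chart)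
          show "\<forall>q\<in>cone_L_interior C (T x) (T y). ?F (f (chart p q)) = q"
            using iff f(3) by (simp add: inv_chart_chart)
          show "?F ` ball 0 1 \<subseteq> cone_L_interior C (T x) (T y)"
            using iff g(2) by (auto simp: inv_chart_avoids chart_inv_chart)
          show "(\<lambda>q. f (chart p q)) ` cone_L_interior C (T x) (T y) \<subseteq> ball 0 1" using iff f(2) by blast
        qed
        show "f (chart p q1) \<in> ball 0 1" "f (chart p q2) \<in> ball 0 1" using q iff f(2) by blast+
        show "?F (f (chart p q1)) = q1" "?F (f (chart p q2)) = q2" using q iff f(3) by (simp_all add: inv_chart_chart)
      qed simp
      have image: "T x + chart p q *\<^sub>C e \<in> T ` (C1 - {0})" if q: "q \<in> cone_L_interior C1 x y" for q
      proof (cases q)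
        case None then show ?thesis using x by (simp add: chart_def)
      next
        case (Some z)
        have "q \<noteq> Some p" using q sub iff by blast
        then have zp: "z - p \<noteq> 0" using Some by auto
        have "q \<in> cone_L C1 x y" using q interior_of_subset[of riemann_sphere "cone_L C1 x y"] unfolding cone_L_interior_def by blast
        then have z: "z *\<^sub>C x - y \<in> C1" using Some by (auto simp: cone_L_def)
        define w where "w = 1 / (z - p)"
        have "w * (z - p) = 1" using zp by (simp add: w_def)
        then have w: "w \<noteq> 0" "w * z = 1 + w * p" by (auto simp: algebra_simps)
        have "w *\<^sub>C (z *\<^sub>C x - y) \<in> C1" using C1 z w(1) unfolding complex_cone_def by blast
        moreover have "w *\<^sub>C (z *\<^sub>C x - y) \<noteq> 0"
          using nz[of "w * z" w] w(1) by (simp add: scaleC_diff_right scaleC_scaleC)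
        moreover have "T (w *\<^sub>C (z *\<^sub>C x - y)) = T x + w *\<^sub>C e"
          using w(2) by (simp add: Tscale Tdiff Tadd scaleC_diff_right scaleC_scaleC e_def scaleC_add_left scaleC_one)
        ultimately show ?thesis using Some by (auto simp: chart_def w_def[symmetric] intro: image_eqI[OF sym])
      qed
      have "gauge_dist C (T x) (T y) = poincare_dist (cone_L_interior C (T x) (T y)) (Some 0) None"
        using indT int sub by (auto simp: gauge_dist_def)
      also have "\<dots> \<le> ennreal \<kappa> * poincare_dist (cone_L_interior C1 x y) (Some 0) None"
        unfolding poincare_dist_def[of "cone_L_interior C1 x y"]
      proof (rule le_mult_Inf_ennreal[OF \<kappa>], clarify)
        fix F a b
        assume F: "sphere_holomorphic_on F (ball 0 1)" "bij_betw F (ball 0 1) (cone_L_interior C1 x y)"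
          and ab: "a \<in> ball 0 1" "b \<in> ball 0 1" "F a = Some 0" "F b = None"
        have Fin: "F \<xi> \<in> cone_L_interior C1 x y" if "\<xi> \<in> ball 0 1" for \<xi> using bij_betwE[OF F(2)] that by blast
        then have Fch: "F \<xi> \<noteq> Some p" "chart p (F \<xi>) \<in> interior (slice (T x) e)" if "\<xi> \<in> ball 0 1" for \<xi>
          using that sub iff by blast+
        define h where "h = (\<lambda>\<xi>. f (chart p (F \<xi>)))"
        have h: "h holomorphic_on ball 0 1" "h ` ball 0 1 \<subseteq> ball 0 1"
          unfolding h_def using Fch f(2) by (auto intro!: holomorphic_on_comp[OF _ f(1)] chart_holomorphic F(1))
        have "disk_dist (h \<xi>) (h \<xi>') \<le> \<Delta>" if \<xi>: "cmod \<xi> < 1" "cmod \<xi>' < 1" for \<xi> \<xi>'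
        proof -
          define w w' where "w = chart p (F \<xi>)" and "w' = chart p (F \<xi>')"
          have w: "w \<in> interior (slice (T x) e)" "w' \<in> interior (slice (T x) e)"
            unfolding w_def w'_def using \<xi> Fch by auto
          have im: "T x + w *\<^sub>C e \<in> T ` (C1 - {0})" "T x + w' *\<^sub>C e \<in> T ` (C1 - {0})"
            unfolding w_def w'_def using \<xi> Fin by (auto intro!: image)
          have bound: "disk_dist (h \<xi>) (h \<xi>') \<le> sqrt 2 * pi * G\<^sup>2" if G: "exp (D / 2) < G" for G
          proof -
            have "1 < G" using G D(1) by (smt (verit) one_le_exp_iff zero_le_divide_iff)
            moreover have "cross_bounded G (T x + w *\<^sub>C e) (T x + w' *\<^sub>C e)"
              using im TC D(2) by (intro cross_bounded_of_chain_dist[OF _ _ _ G D(1)]) auto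
            ultimately show ?thesis unfolding h_def w_def[symmetric] w'_def[symmetric]
              using f(2) w by (intro slice_distance_bound[OF eC f(1)]) auto
          qed
          have "disk_dist (h \<xi>) (h \<xi>') \<le> sqrt 2 * pi * (exp (D / 2))\<^sup>2"
          proof (rule tendsto_lowerbound)
            show "((\<lambda>G. sqrt 2 * pi * G\<^sup>2) \<longlongrightarrow> sqrt 2 * pi * (exp (D / 2))\<^sup>2) (at_right (exp (D / 2)))"
              by (intro tendsto_intros)
            show "\<forall>\<^sub>F G in at_right (exp (D / 2)). disk_dist (h \<xi>) (h \<xi>') \<le> sqrt 2 * pi * G\<^sup>2"
              using bound by (auto simp: eventually_at_right_field intro!: exI[of _ "exp (D / 2) + 1"])
          qed simp
          then show ?thesis by (simp add: \<Delta>_def flip: exp_double)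
        qed
        then have "disk_dist (h a) (h b) \<le> \<kappa> * disk_dist a b"
          unfolding \<kappa>_def using ab by (intro disk_contraction[OF h]) auto
        then have "ennreal (disk_dist (h a) (h b)) \<le> ennreal \<kappa> * ennreal (disk_dist a b)"
          using \<kappa> by (simp add: ennreal_leI flip: ennreal_mult')
        moreover have "poincare_dist (cone_L_interior C (T x) (T y)) (Some 0) None \<le> ennreal (disk_dist (h a) (h b))"
          using upper[of "Some 0" None] int sub ab by (auto simp: h_def)
        ultimately show "poincare_dist (cone_L_interior C (T x) (T y)) (Some 0) None \<le> ennreal \<kappa> * ennreal (disk_dist a b)"
          by (rule order_trans[rotated])
      qed
      also have "poincare_dist (cone_L_interior C1 x y) (Some 0) None = gauge_dist C1 x y"
        using ind int by (simp add: gauge_dist_def)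
      finally show ?thesis .
    qed
  qed
  then show ?thesis unfolding \<kappa>_def const .
qed

end

theorem theorem5p7:
  fixes C\<^sub>1 :: "'a::complex_banach set" and C\<^sub>2 :: "'b::complex_banach set"
    and T :: "'a \<Rightarrow> 'b" and \<Delta> :: ennreal
  assumes "complex_cone C\<^sub>1" and "complex_cone C\<^sub>2"
    and "\<exists>R\<^sub>1. closed_convex_cone R\<^sub>1 \<and> cond_C1 C\<^sub>1 R\<^sub>1" and "cond_C2 C\<^sub>1"
    and "\<exists>R\<^sub>2. closed_convex_cone R\<^sub>2 \<and> cond_C1 C\<^sub>2 R\<^sub>2" and "cond_C2 C\<^sub>2"
    and "Vector_Spaces.linear scaleC scaleC T"
    and "T ` (C\<^sub>1 - {0}) \<subseteq> C\<^sub>2 - {0}"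
    and "\<Delta> = (SUP x\<in>C\<^sub>1 - {0}. SUP y\<in>C\<^sub>1 - {0}. chain_dist C\<^sub>2 (T x) (T y))"
    and "\<Delta> < \<infinity>"
  shows "\<forall>x\<in>C\<^sub>1 - {0}. \<forall>y\<in>C\<^sub>1 - {0}.
    chain_dist C\<^sub>2 (T x) (T y)
      \<le> ennreal (tanh (pi * exp (enn2real \<Delta>) / (2 * sqrt 2))) * chain_dist C\<^sub>1 x y"
proof (intro ballI)
  fix x y assume "x \<in> C\<^sub>1 - {0}" "y \<in> C\<^sub>1 - {0}"
  obtain R where R: "closed_convex_cone R" "cond_C1 C\<^sub>2 R" using assms(5) by blast
  interpret proper_quadrant_cone C\<^sub>2 R
    using R assms(6) by unfold_locales (auto simp: cond_C2_def)
  define D where "D = enn2real \<Delta>"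
  define \<kappa> where "\<kappa> = tanh (pi * exp D / (2 * sqrt 2))"
  have \<kappa>: "0 < \<kappa>" by (simp add: \<kappa>_def)
  have D: "0 \<le> D" "ennreal D = \<Delta>" using assms(10) by (simp_all add: D_def)
  have diam: "chain_dist C\<^sub>2 (T u) (T v) \<le> ennreal D" if "u \<in> C\<^sub>1 - {0}" "v \<in> C\<^sub>1 - {0}" for u v
    unfolding D(2) assms(9) using that by (blast intro: SUP_upper2)
  note step = gauge_contraction[OF assms(1,7,8) D(1) diam, folded \<kappa>_def]
  have "chain_dist C\<^sub>2 (T x) (T y) \<le> ennreal \<kappa> * chain_dist C\<^sub>1 x y"
    unfolding chain_dist_def[of C\<^sub>1]
  proof (rule le_mult_Inf_ennreal[OF \<kappa>], clarify)
    fix n :: nat and X assume n: "1 \<le> n" "x = X 0" "y = X n" and X: "\<forall>k\<le>n. X k \<in> C\<^sub>1 - {0}"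
    have "chain_dist C\<^sub>2 (T (X 0)) (T (X n)) \<le> (\<Sum>k<n. gauge_dist C\<^sub>2 (T (X k)) (T (X (Suc k))))"
      unfolding chain_dist_def
    proof (rule Inf_lower, rule CollectI, intro exI conjI)
      show "\<forall>k\<le>n. (T \<circ> X) k \<in> C\<^sub>2 - {0}" using X assms(8) by auto
    qed (use n in auto)
    also have "\<dots> \<le> (\<Sum>k<n. ennreal \<kappa> * gauge_dist C\<^sub>1 (X k) (X (Suc k)))"
      using X by (intro sum_mono step) auto
    also have "\<dots> = ennreal \<kappa> * (\<Sum>k<n. gauge_dist C\<^sub>1 (X k) (X (Suc k)))" by (simp add: sum_distrib_left)
    finally show "chain_dist C\<^sub>2 (T (X 0)) (T (X n)) \<le> ennreal \<kappa> * (\<Sum>k<n. gauge_dist C\<^sub>1 (X k) (X (Suc k)))" .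
  qed
  then show "chain_dist C\<^sub>2 (T x) (T y) \<le> ennreal (tanh (pi * exp (enn2real \<Delta>) / (2 * sqrt 2))) * chain_dist C\<^sub>1 x y"
    by (simp add: \<kappa>_def D_def)
qed

end
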